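(* Let $V$ be a separable Hilbert space, $Q$ a symmetric (self-adjoint), non-negative definite bounded linear operator on $V$, and $B=\{B_t(h): t\ge 0, h\in V\}$ a cylindrical Wiener process on $V$ with covariance $Q$. Let $T>0$. For any predictable process $g\in L^2(\Omega\times[0,T],V_Q)$, the Russo-Vallois-forward integral $\int_0^T g_s\,dB_s^-$ exists and is equal to the (classical) stochastic integral $$\int_0^T g_s\,dB_s=\sum_{j=1}^\infty\int_0^T\langle g_s,v_j\rangle_{V_Q}\,dB_s(v_j).$$
   Context: **Cylindrical Wiener process.** Let $V$ be a separable Hilbert space with inner product $\langle\cdot,\cdot\rangle$ and $Q$ a symmetric, non-negative definite bounded linear operator on $V$. A family of random variables $B=\{B_t(h):t\ge0,h\in V\}$ is a cylindrical Wiener process on $V$ with covariance $Q$ if (1) for every $h\in V$, $\{B_t(h)\}_{t\ge0}$ is a Brownian motion with variance $t\langle Qh,h\rangle$; (2) for all $s,t\ge 0$ and $h,g\in V$, $\mathbb{E}(B_s(h)B_t(g))=(s\wedge t)\langle Qh,g\rangle$. **Filtration and the space $V_Q$.** $\mathcal{F}_t$ is the $\sigma$-field generated by $\{B_s(h):h\in V,0\le s\le t\}$ and the $P$-null sets. The predictable $\sigma$-field on $[0,T]\times\Omega$ is generated by the sets $(s,t]\times A$, $A\in\mathcal{F}_s$, $0\le s<t\le T$. $V_Q$ denotes the completion of $V$ endowed with $\langle h,g\rangle_{V_Q}:=\langle Qh,g\rangle$ (after identifying elements at distance zero); $B_t(h)$ is extended to $h\in V_Q$ by the isometry $\mathbb{E}(B_t(h)^2)=t\|h\|_{V_Q}^2$.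 Fix a complete orthonormal basis $\{v_j\}_{j\in\mathbb{N}}$ of $V_Q$. The processes $B(v_j)$, $j\in\mathbb{N}$, are independent standard Brownian motions with respect to $(\mathcal{F}_t)$. **Classical integral.** For predictable $g\in L^2(\Omega\times[0,T],V_Q)$, define $\int_0^T g_s\,dB_s:=\sum_{j=1}^\infty\int_0^T\langle g_s,v_j\rangle_{V_Q}\,dB_s(v_j)$, where each summand is an Itô integral and the series converges in $L^2(\Omega)$ (the sum does not depend on the orthonormal basis). **Forward integral of real processes.** For a continuous real process $X=(X_t)_{t\ge0}$ and a real process $Y$ with locally integrable paths, $\int_0^t Y_s\,dX_s^-:=\lim_{\epsilon\to0^+}\int_0^t Y_s\frac{X_{s+\epsilon}-X_s}{\epsilon}\,ds$, provided the limit exists ucp (in probability, uniformly for $t$ in compact sets; here on $[0,T]$). **Russo-Vallois-forward integral.** Let $g$ be a $V_Q$-valued stochastic process (no adaptedness required) whose Fourier coefficients $\langle g,v_j\rangle_{V_Q}$ are finite for all $t$ and $\omega$. Suppose that for every $j\in\mathbb{N}$ the forward integral $c_j=\int_0^T\langle g_s,v_j\rangle_{V_Q}\,dB_s^-(v_j)$ exists and that $\sum_{j=1}^m c_j$ converges in probability as $m\to\infty$. Then the Russo-Vallois-forward integral is $\int_0^T g_s\,dB_s^-:=\lim_{m\to\infty}\sum_{j=1}^m c_j$ (limit in probability). *)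

theory Defs
  imports "HOL-Probability.Probability"
begin

section \<open>Cylindrical Wiener processes\<close>

text \<open>Processes are curried functions \<open>X t \<omega>\<close>; only the values at times \<open>t \<ge> 0\<close> matter.\<close>

definition generated_filtration ::
  "'a measure \<Rightarrow> (real \<Rightarrow> 'v \<Rightarrow> 'a \<Rightarrow> real) \<Rightarrow> real \<Rightarrow> 'a measure" where
  "generated_filtration M B t =
     sigma (space M)
       ({B s h -` A \<inter> space M | s h A. 0 \<le> s \<and> s \<le> t \<and> A \<in> sets borel} \<union> null_sets M)"

text \<open>The law \<open>N(0, c)\<close> is written as the law of \<open>sqrt c\<close> times a standard normal variable,
  which includes the degenerate case \<open>c = 0\<close>.\<close>

definition centered_gaussian_law :: "real \<Rightarrow> real measure" where
  "centered_gaussian_law c = distr std_normal_distribution borel (\<lambda>x. sqrt c * x)"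

text \<open>Brownian motion relative to a filtration \<open>F\<close>, with variance \<open>c * t\<close> at time \<open>t\<close>.\<close>

definition brownian_motion ::
  "'a measure \<Rightarrow> (real \<Rightarrow> 'a measure) \<Rightarrow> real \<Rightarrow> (real \<Rightarrow> 'a \<Rightarrow> real) \<Rightarrow> bool" where
  "brownian_motion M F c X \<longleftrightarrow>
     (\<forall>t\<ge>0. X t \<in> borel_measurable (F t)) \<and>
     (AE \<omega> in M. X 0 \<omega> = 0) \<and>
     (\<forall>s t. 0 \<le> s \<longrightarrow> s \<le> t \<longrightarrow>
        distr M borel (\<lambda>\<omega>. X t \<omega> - X s \<omega>) = centered_gaussian_law ((t - s) * c) \<and>
        prob_space.indep_set M (sets (F s))
          (sets (vimage_algebra (space M) (\<lambda>\<omega>. X t \<omega> - X s \<omega>) borel))) \<and>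
     (AE \<omega> in M. continuous_on {0..} (\<lambda>t. X t \<omega>))"

text \<open>In the first condition ``Brownian motion'' is meant relative to the filtration generated by
  the whole family \<open>B\<close>.  Brownian motion in its own filtration, together with the covariance
  condition, does not determine the joint law of \<open>B\<close>: it would not even make the family Gaussian,
  nor the coordinate processes independent Brownian motions for that filtration.\<close>

definition cylindrical_wiener ::
  "'a measure \<Rightarrow> ('v::real_inner \<Rightarrow> 'v) \<Rightarrow> (real \<Rightarrow> 'v \<Rightarrow> 'a \<Rightarrow> real) \<Rightarrow> bool" where
  "cylindrical_wiener M Q B \<longleftrightarrow>
     (\<forall>t\<ge>0. \<forall>h. B t h \<in> borel_measurable M) \<and>
     (\<forall>h. brownian_motion M (generated_filtration M B) (inner (Q h) h) (\<lambda>t. B t h)) \<and>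
     (\<forall>s\<ge>0. \<forall>t\<ge>0. \<forall>h g.
        has_bochner_integral M (\<lambda>\<omega>. B s h \<omega> * B t g \<omega>) (min s t * inner (Q h) g))"


section \<open>The space \<open>V_Q\<close> and the extended process\<close>

text \<open>The Hausdorff completion of \<open>V\<close> for the semi-inner product \<open>inner (Q h) g\<close> is given by a
  complete inner product space \<open>'w\<close> and the canonical map \<open>\<iota>\<close>, which need not be injective.
  These data are unique up to a unique isometric isomorphism.\<close>

definition is_completion_for ::
  "('v::real_inner \<Rightarrow> 'v) \<Rightarrow> ('v \<Rightarrow> 'w::{real_inner,complete_space}) \<Rightarrow> bool" where
  "is_completion_for Q \<iota> \<longleftrightarrow>
     linear \<iota> \<and> (\<forall>h g. inner (\<iota> h) (\<iota> g) = inner (Q h) g) \<and> closure (range \<iota>) = UNIV"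

text \<open>The extension of \<open>B\<close> to \<open>V_Q\<close> as a linear isometry into \<open>L\<^sup>2\<close> fixes each \<open>W t x\<close> only almost
  surely; \<open>W\<close> denotes any choice with almost surely continuous paths.\<close>

definition isometric_extension ::
  "'a measure \<Rightarrow> (real \<Rightarrow> 'v \<Rightarrow> 'a \<Rightarrow> real) \<Rightarrow> ('v \<Rightarrow> 'w::real_inner)
    \<Rightarrow> (real \<Rightarrow> 'w \<Rightarrow> 'a \<Rightarrow> real) \<Rightarrow> bool" where
  "isometric_extension M B \<iota> W \<longleftrightarrow>
     (\<forall>t\<ge>0. \<forall>x. W t x \<in> borel_measurable M \<and>
        has_bochner_integral M (\<lambda>\<omega>. (W t x \<omega>)\<^sup>2) (t * (norm x)\<^sup>2)) \<and>
     (\<forall>t\<ge>0. \<forall>h. AE \<omega> in M. W t (\<iota> h) \<omega> = B t h \<omega>) \<and>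
     (\<forall>t\<ge>0. \<forall>x y. AE \<omega> in M. W t (x + y) \<omega> = W t x \<omega> + W t y \<omega>) \<and>
     (\<forall>t\<ge>0. \<forall>a x. AE \<omega> in M. W t (a *\<^sub>R x) \<omega> = a * W t x \<omega>) \<and>
     (\<forall>x. AE \<omega> in M. continuous_on {0..} (\<lambda>t. W t x \<omega>))"

text \<open>The index set is \<open>UNIV\<close> if \<open>V_Q\<close> is infinite-dimensional; a finite index set
  covers operators \<open>Q\<close> of finite rank.\<close>

definition orthonormal_basis_on :: "nat set \<Rightarrow> (nat \<Rightarrow> 'w::real_inner) \<Rightarrow> bool" where
  "orthonormal_basis_on J v \<longleftrightarrow>
     (\<forall>i\<in>J. \<forall>j\<in>J. inner (v i) (v j) = (if i = j then 1 else 0)) \<and>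
     closure (span (v ` J)) = UNIV"


section \<open>Predictability and the classical integral\<close>

definition predictable_sigma :: "'a measure \<Rightarrow> (real \<Rightarrow> 'a measure) \<Rightarrow> real \<Rightarrow> (real \<times> 'a) measure" where
  "predictable_sigma M F T =
     sigma ({0..T} \<times> space M)
       {{s<..t} \<times> A | s t A. 0 \<le> s \<and> s < t \<and> t \<le> T \<and> A \<in> sets (F s)}"

abbreviation time_measure :: "'a measure \<Rightarrow> real \<Rightarrow> (real \<times> 'a) measure" where
  "time_measure M T \<equiv> restrict_space lborel {0..T} \<Otimes>\<^sub>M M"

definition predictable_L2 ::
  "'a measure \<Rightarrow> (real \<Rightarrow> 'a measure) \<Rightarrow> real \<Rightarrow> (real \<Rightarrow> 'a \<Rightarrow> 'w::real_normed_vector) \<Rightarrow> bool" where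
  "predictable_L2 M F T Y \<longleftrightarrow>
     (\<lambda>(s, \<omega>). Y s \<omega>) \<in> borel_measurable (predictable_sigma M F T) \<and>
     integrable (time_measure M T) (\<lambda>(s, \<omega>). (norm (Y s \<omega>))\<^sup>2)"

text \<open>A simple process is \<open>\<Sum>i<n. \<xi> i\<close> on \<open>(\<tau> i, \<tau> (i+1)]\<close>, with \<open>\<xi> i\<close> bounded and measurable at
  time \<open>\<tau> i\<close>.\<close>

definition simple_data ::
  "'a measure \<Rightarrow> (real \<Rightarrow> 'a measure) \<Rightarrow> real \<Rightarrow> nat \<Rightarrow> (nat \<Rightarrow> real) \<Rightarrow> (nat \<Rightarrow> 'a \<Rightarrow> real) \<Rightarrow> bool" where
  "simple_data M F T n \<tau> \<xi> \<longleftrightarrow>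
     (\<forall>i<n. \<tau> i \<le> \<tau> (Suc i)) \<and> (\<forall>i\<le>n. 0 \<le> \<tau> i \<and> \<tau> i \<le> T) \<and>
     (\<forall>i<n. \<xi> i \<in> borel_measurable (F (\<tau> i)) \<and> (\<exists>K. \<forall>\<omega>\<in>space M. \<bar>\<xi> i \<omega>\<bar> \<le> K))"

definition simple_process ::
  "nat \<Rightarrow> (nat \<Rightarrow> real) \<Rightarrow> (nat \<Rightarrow> 'a \<Rightarrow> real) \<Rightarrow> real \<Rightarrow> 'a \<Rightarrow> real" where
  "simple_process n \<tau> \<xi> s \<omega> = (\<Sum>i<n. \<xi> i \<omega> * indicator {\<tau> i<..\<tau> (Suc i)} s)"

definition simple_integral ::
  "(real \<Rightarrow> 'a \<Rightarrow> real) \<Rightarrow> nat \<Rightarrow> (nat \<Rightarrow> real) \<Rightarrow> (nat \<Rightarrow> 'a \<Rightarrow> real) \<Rightarrow> 'a \<Rightarrow> real" where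
  "simple_integral X n \<tau> \<xi> \<omega> = (\<Sum>i<n. \<xi> i \<omega> * (X (\<tau> (Suc i)) \<omega> - X (\<tau> i) \<omega>))"

definition L2_tendsto :: "'a measure \<Rightarrow> (nat \<Rightarrow> 'a \<Rightarrow> real) \<Rightarrow> ('a \<Rightarrow> real) \<Rightarrow> bool" where
  "L2_tendsto M f g \<longleftrightarrow>
     (\<forall>n. f n \<in> borel_measurable M) \<and> g \<in> borel_measurable M \<and>
     (\<lambda>n. \<integral>\<^sup>+x. ennreal ((f n x - g x)\<^sup>2) \<partial>M) \<longlonglongrightarrow> 0"

text \<open>\<open>I\<close> is a version of the It\^o integral of \<open>Y\<close> over \<open>[0,T]\<close>, with respect to a process \<open>X\<close>
  that is meant to be a Brownian motion for the filtration \<open>F\<close>.\<close>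

definition has_ito_integral ::
  "'a measure \<Rightarrow> (real \<Rightarrow> 'a measure) \<Rightarrow> real \<Rightarrow> (real \<Rightarrow> 'a \<Rightarrow> real) \<Rightarrow> (real \<Rightarrow> 'a \<Rightarrow> real)
    \<Rightarrow> ('a \<Rightarrow> real) \<Rightarrow> bool" where
  "has_ito_integral M F T X Y I \<longleftrightarrow>
     predictable_L2 M F T Y \<and>
     (\<exists>n \<tau> \<xi>. (\<forall>k. simple_data M F T (n k) (\<tau> k) (\<xi> k)) \<and>
        L2_tendsto (time_measure M T)
          (\<lambda>k (s, \<omega>). simple_process (n k) (\<tau> k) (\<xi> k) s \<omega>) (\<lambda>(s, \<omega>). Y s \<omega>) \<and>
        L2_tendsto M (\<lambda>k. simple_integral X (n k) (\<tau> k) (\<xi> k)) I)"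

definition has_classical_integral ::
  "'a measure \<Rightarrow> (real \<Rightarrow> 'a measure) \<Rightarrow> real \<Rightarrow> nat set \<Rightarrow> (nat \<Rightarrow> 'w::real_inner)
    \<Rightarrow> (real \<Rightarrow> 'w \<Rightarrow> 'a \<Rightarrow> real) \<Rightarrow> (real \<Rightarrow> 'a \<Rightarrow> 'w) \<Rightarrow> ('a \<Rightarrow> real) \<Rightarrow> bool" where
  "has_classical_integral M F T J v W g I \<longleftrightarrow>
     (\<exists>c. (\<forall>j\<in>J. has_ito_integral M F T (\<lambda>t. W t (v j)) (\<lambda>s \<omega>. inner (g s \<omega>) (v j)) (c j)) \<and>
        L2_tendsto M (\<lambda>m \<omega>. \<Sum>j | j \<in> J \<and> j < m. c j \<omega>) I)"


section \<open>The forward integrals\<close>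

definition forward_approximation ::
  "(real \<Rightarrow> 'a \<Rightarrow> real) \<Rightarrow> (real \<Rightarrow> 'a \<Rightarrow> real) \<Rightarrow> real \<Rightarrow> real \<Rightarrow> 'a \<Rightarrow> real" where
  "forward_approximation X Y \<epsilon> t \<omega> =
     (LINT s:{0..t}|lborel. Y s \<omega> * ((X (s + \<epsilon>) \<omega> - X s \<omega>) / \<epsilon>))"

text \<open>The convergence is uniform on \<open>[0,T]\<close> in probability.  It is expressed with outer
  probability, since the event that the supremum over \<open>t\<close> exceeds \<open>\<eta>\<close> may fail to be measurable
  for general \<open>X\<close> and \<open>Y\<close>.  As usual, path properties are required almost surely.\<close>

definition has_forward_integral ::
  "'a measure \<Rightarrow> real \<Rightarrow> (real \<Rightarrow> 'a \<Rightarrow> real) \<Rightarrow> (real \<Rightarrow> 'a \<Rightarrow> real) \<Rightarrow> (real \<Rightarrow> 'a \<Rightarrow> real) \<Rightarrow> bool" where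
  "has_forward_integral M T X Y L \<longleftrightarrow>
     (AE \<omega> in M. continuous_on {0..} (\<lambda>t. X t \<omega>)) \<and>
     (AE \<omega> in M. set_integrable lborel {0..T} (\<lambda>s. Y s \<omega>)) \<and>
     (\<forall>t\<in>{0..T}. L t \<in> borel_measurable M) \<and>
     (\<forall>\<eta>>0. \<forall>\<delta>>0. \<forall>\<^sub>F \<epsilon> in at_right 0. \<exists>A\<in>sets M.
        {\<omega>\<in>space M. \<exists>t\<in>{0..T}. \<bar>forward_approximation X Y \<epsilon> t \<omega> - L t \<omega>\<bar> > \<eta>} \<subseteq> A \<and>
        measure M A < \<delta>)"

definition tendsto_in_probability :: "'a measure \<Rightarrow> (nat \<Rightarrow> 'a \<Rightarrow> real) \<Rightarrow> ('a \<Rightarrow> real) \<Rightarrow> bool" where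
  "tendsto_in_probability M f g \<longleftrightarrow>
     (\<forall>n. f n \<in> borel_measurable M) \<and> g \<in> borel_measurable M \<and>
     (\<forall>\<eta>>0. (\<lambda>n. measure M {\<omega>\<in>space M. \<bar>f n \<omega> - g \<omega>\<bar> > \<eta>}) \<longlonglongrightarrow> 0)"

definition has_russo_vallois_forward_integral ::
  "'a measure \<Rightarrow> real \<Rightarrow> nat set \<Rightarrow> (nat \<Rightarrow> 'w::real_inner)
    \<Rightarrow> (real \<Rightarrow> 'w \<Rightarrow> 'a \<Rightarrow> real) \<Rightarrow> (real \<Rightarrow> 'a \<Rightarrow> 'w) \<Rightarrow> ('a \<Rightarrow> real) \<Rightarrow> bool" where
  "has_russo_vallois_forward_integral M T J v W g I \<longleftrightarrow>
     (\<exists>L. (\<forall>j\<in>J. has_forward_integral M T (\<lambda>t. W t (v j)) (\<lambda>s \<omega>. inner (g s \<omega>) (v j)) (L j)) \<and>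
        tendsto_in_probability M (\<lambda>m \<omega>. \<Sum>j | j \<in> J \<and> j < m. L j T \<omega>) I)"

end

theory Submission
  imports Defs
begin

text \<open>
  Let \<open>U s = \<Sum>\<^sub>j Y\<^sub>j(s) (X\<^sub>j(s + \<epsilon>) - X\<^sub>j(s)) / \<epsilon>\<close> be the integrand of a forward approximation
  for orthonormal coordinates \<open>X\<^sub>j\<close>.  Given the past at time \<open>s\<close> it is centred, with second moment
  \<open>\<Sum>\<^sub>j Y\<^sub>j(s)\<^sup>2 / \<epsilon>\<close>, and it is known at time \<open>s + \<epsilon>\<close>.  Cut time into blocks of length \<open>\<epsilon>\<close>: the
  integrals of \<open>U\<close> over the even blocks are martingale differences, and so are those over the odd
  blocks.  Kolmogorov's inequality then bounds \<open>sup\<^sub>t \<bar>\<integral>\<^sub>0\<^sup>t U\<bar>\<close> in probability, and orthogonality bounds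
  \<open>\<integral>\<^sub>0\<^sup>T U\<close> in \<open>L\<^sup>2\<close>, by the \<open>L\<^sup>2\<close> norm of \<open>Y\<close> and uniformly in \<open>\<epsilon>\<close>.  For simple \<open>Y\<close> the forward
  approximations converge by continuity of the paths, so by density they converge for every
  predictable square-integrable \<open>Y\<close>.  Fatou's lemma transfers the \<open>L\<^sup>2\<close> bound to the limit \<open>c\<close>: the
  squared distance of \<open>c\<close> to a simple integral is at most twice that of the integrands, which makes \<open>c\<close> the
  Ito integral.  The same bound for finitely many coordinates, with Bessel's inequality, gives the
  convergence of the series.
\<close>

section \<open>Martingale differences\<close>

text \<open>The difference quotient has conditional second moment 1/\<epsilon> per unit of energy,
  so it blows up as \<epsilon> shrinks and only its time integral can be controlled. Cauchy-Schwarz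
  on a block of length \<epsilon> returns exactly one factor \<epsilon>, and this cancellation is
  the source of the uniformity. Since the quotient looks ahead by \<epsilon>, the integral over a
  block is known only at the end of the following block. Neighbouring blocks are therefore not in
  martingale order, which forces the split by parity and costs a factor 2 compared with the Ito
  isometry; for convergence any constant will do. The comparison of \<open>c\<close> with simple
  integrals holds along every approximating sequence, so it gives existence and uniqueness of the
  Ito integral at the same time. Two gaps separate \<open>W\<close> from the setting of these
  estimates. Conditional moments of increments are given for vectors coming from \<open>V\<close>
  and reach the completion by density. Paths of \<open>W\<close> are continuous only almost surely,
  and a modification repairs this because the filtration contains all null sets.\<close>

lemma integrable_mult_of_squares:
  fixes f g :: "'a \<Rightarrow> real"
  assumes [measurable]: "f \<in> borel_measurable M" "g \<in> borel_measurable M"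
    and "integrable M (\<lambda>x. (f x)\<^sup>2)" "integrable M (\<lambda>x. (g x)\<^sup>2)"
  shows "integrable M (\<lambda>x. f x * g x)"
proof (rule Bochner_Integration.integrable_bound)
  show "integrable M (\<lambda>x. (f x)\<^sup>2 + (g x)\<^sup>2)" using assms by auto
  have "\<bar>f x * g x\<bar> \<le> (f x)\<^sup>2 + (g x)\<^sup>2" for x
  proof -
    have "2 * (\<bar>f x\<bar> * \<bar>g x\<bar>) \<le> (f x)\<^sup>2 + (g x)\<^sup>2"
      using sum_squares_bound[of "\<bar>f x\<bar>" "\<bar>g x\<bar>"] by simp
    moreover have "0 \<le> \<bar>f x\<bar> * \<bar>g x\<bar>" by simp
    ultimately show ?thesis by (simp only: abs_mult)
  qed
  then show "AE x in M. norm (f x * g x) \<le> norm ((f x)\<^sup>2 + (g x)\<^sup>2)" by auto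
qed measurable

lemma integrable_square_add:
  fixes f g :: "'a \<Rightarrow> real"
  assumes [measurable]: "f \<in> borel_measurable M" "g \<in> borel_measurable M"
    and "integrable M (\<lambda>x. (f x)\<^sup>2)" "integrable M (\<lambda>x. (g x)\<^sup>2)"
  shows "integrable M (\<lambda>x. (f x + g x)\<^sup>2)"
  using integrable_mult_of_squares[OF assms] assms(3,4)
  by (simp add: power2_sum mult.assoc)

lemma integrable_square_sum:
  fixes f :: "'i \<Rightarrow> 'a \<Rightarrow> real"
  assumes "\<And>i. i \<in> I \<Longrightarrow> f i \<in> borel_measurable M" "\<And>i. i \<in> I \<Longrightarrow> integrable M (\<lambda>x. (f i x)\<^sup>2)"
  shows "integrable M (\<lambda>x. (\<Sum>i\<in>I. f i x)\<^sup>2)"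
  using assms
proof (induction I rule: infinite_finite_induct)
  case (insert i I)
  then show ?case by (auto intro!: integrable_square_add)
qed auto

context prob_space
begin

text \<open>Conditional centring is expressed as orthogonality to all square-integrable functions
  known at stage \<open>k\<close>. This is what Fubini's theorem yields for integrals over blocks,
  and it makes every product that occurs integrable.\<close>

definition martingale_differences :: "(nat \<Rightarrow> 'a measure) \<Rightarrow> (nat \<Rightarrow> 'a \<Rightarrow> real) \<Rightarrow> bool" where
  "martingale_differences G D \<longleftrightarrow>
     (\<forall>k. subalgebra M (G k) \<and> sets (G k) \<subseteq> sets (G (Suc k)) \<and> D k \<in> borel_measurable (G (Suc k)) \<and>
       integrable M (\<lambda>\<omega>. (D k \<omega>)\<^sup>2) \<and>
       (\<forall>Z\<in>borel_measurable (G k). integrable M (\<lambda>\<omega>. (Z \<omega>)\<^sup>2) \<longrightarrow> (\<integral>\<omega>. Z \<omega> * D k \<omega> \<partial>M) = 0))"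

lemma martingale_differencesD:
  assumes "martingale_differences G D"
  shows "subalgebra M (G k)" and "sets (G k) \<subseteq> sets (G (Suc k))"
    and "D k \<in> borel_measurable (G (Suc k))" and "D k \<in> borel_measurable M"
    and "integrable M (\<lambda>\<omega>. (D k \<omega>)\<^sup>2)"
    and "Z \<in> borel_measurable (G k) \<Longrightarrow> integrable M (\<lambda>\<omega>. (Z \<omega>)\<^sup>2) \<Longrightarrow> (\<integral>\<omega>. Z \<omega> * D k \<omega> \<partial>M) = 0"
proof -
  note D = assms[unfolded martingale_differences_def]
  show "subalgebra M (G k)" "sets (G k) \<subseteq> sets (G (Suc k))" "D k \<in> borel_measurable (G (Suc k))"
    "integrable M (\<lambda>\<omega>. (D k \<omega>)\<^sup>2)"
    using D by auto
  show "D k \<in> borel_measurable M"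
    using measurable_from_subalg[of M "G (Suc k)" "D k" borel] D by simp
  show "(\<integral>\<omega>. Z \<omega> * D k \<omega> \<partial>M) = 0"
    if "Z \<in> borel_measurable (G k)" "integrable M (\<lambda>\<omega>. (Z \<omega>)\<^sup>2)"
    using D[rule_format, of k] that by simp
qed

lemma martingale_differences_partial_sum:
  assumes "martingale_differences G D"
  shows "(\<lambda>\<omega>. \<Sum>k<n. D k \<omega>) \<in> borel_measurable (G n)"
proof (induction n)
  case (Suc n)
  have "subalgebra (G (Suc n)) (G n)"
    using martingale_differencesD(1,2)[OF assms, of n] martingale_differencesD(1)[OF assms, of "Suc n"]
    unfolding subalgebra_def by simp
  then have "(\<lambda>\<omega>. \<Sum>k<n. D k \<omega>) \<in> borel_measurable (G (Suc n))"
    using Suc measurable_from_subalg by blast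
  then show ?case using martingale_differencesD(3)[OF assms, of n] by simp
qed auto

text \<open>Pythagoras: the partial sum up to \<open>n\<close> is known at stage \<open>n\<close>
  and square-integrable, hence an admissible test function against \<open>D n\<close>, and the cross
  term vanishes.\<close>

lemma martingale_differences_integral_square:
  assumes D: "martingale_differences G D"
  shows "integrable M (\<lambda>\<omega>. (\<Sum>k<n. D k \<omega>)\<^sup>2)"
    and "(\<integral>\<omega>. (\<Sum>k<n. D k \<omega>)\<^sup>2 \<partial>M) = (\<Sum>k<n. \<integral>\<omega>. (D k \<omega>)\<^sup>2 \<partial>M)"
proof -
  note sub = martingale_differencesD(1)[OF D] and Dm[measurable] = martingale_differencesD(4)[OF D]
    and Di = martingale_differencesD(5)[OF D]
  have Si: "integrable M (\<lambda>\<omega>. (\<Sum>k<n. D k \<omega>)\<^sup>2)" for n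
    by (intro integrable_square_sum Dm Di)
  then show "integrable M (\<lambda>\<omega>. (\<Sum>k<n. D k \<omega>)\<^sup>2)" .
  show "(\<integral>\<omega>. (\<Sum>k<n. D k \<omega>)\<^sup>2 \<partial>M) = (\<Sum>k<n. \<integral>\<omega>. (D k \<omega>)\<^sup>2 \<partial>M)"
  proof (induction n)
    case (Suc n)
    have SD: "integrable M (\<lambda>\<omega>. (\<Sum>k<n. D k \<omega>) * D n \<omega>)"
      by (intro integrable_mult_of_squares Si Di) auto
    have z: "(\<integral>\<omega>. (\<Sum>k<n. D k \<omega>) * D n \<omega> \<partial>M) = 0"
      by (rule martingale_differencesD(6)[OF D martingale_differences_partial_sum[OF D] Si])
    have "(\<integral>\<omega>. (\<Sum>k<Suc n. D k \<omega>)\<^sup>2 \<partial>M) =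
        (\<integral>\<omega>. ((\<Sum>k<n. D k \<omega>)\<^sup>2 + (D n \<omega>)\<^sup>2) + 2 * ((\<Sum>k<n. D k \<omega>) * D n \<omega>) \<partial>M)"
      by (simp add: power2_sum algebra_simps)
    also have "\<dots> = (\<integral>\<omega>. (\<Sum>k<n. D k \<omega>)\<^sup>2 \<partial>M) + (\<integral>\<omega>. (D n \<omega>)\<^sup>2 \<partial>M)"
      using SD z Si Di by simp
    finally show ?case using Suc by simp
  qed simp
qed

text \<open>An event known before \<open>D k\<close> can be absorbed into the test function
  \<open>Z\<close>, so discarding differences by a rule that does not look ahead keeps the
  orthogonality.\<close>

lemma martingale_differences_stopped:
  assumes D: "martingale_differences G D" and A: "\<And>k. A k \<in> sets (G k)"
  shows "martingale_differences G (\<lambda>k \<omega>. indicator (A k) \<omega> * D k \<omega>)"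
  unfolding martingale_differences_def
proof (intro allI conjI ballI impI)
  fix k
  show sub: "subalgebra M (G k)" and mono: "sets (G k) \<subseteq> sets (G (Suc k))"
    using martingale_differencesD(1,2)[OF D] by auto
  have [measurable]: "A k \<in> sets (G k)" "A k \<in> sets (G (Suc k))" "D k \<in> borel_measurable (G (Suc k))"
    using martingale_differencesD(3)[OF D] A mono by auto
  have [measurable]: "A k \<in> sets M" using A sub unfolding subalgebra_def by blast
  have [measurable]: "D k \<in> borel_measurable M"
    by (rule martingale_differencesD(4)[OF D])
  note Di = martingale_differencesD(5)[OF D]
  show "(\<lambda>\<omega>. indicator (A k) \<omega> * D k \<omega>) \<in> borel_measurable (G (Suc k))" by measurable
  show "integrable M (\<lambda>\<omega>. (indicator (A k) \<omega> * D k \<omega>)\<^sup>2)"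
    by (rule Bochner_Integration.integrable_bound[OF Di]) (auto simp: indicator_def)
  fix Z :: "'a \<Rightarrow> real"
  assume Z[measurable]: "Z \<in> borel_measurable (G k)" and Zi: "integrable M (\<lambda>\<omega>. (Z \<omega>)\<^sup>2)"
  have [measurable]: "Z \<in> borel_measurable M" using Z sub measurable_from_subalg by blast
  have "integrable M (\<lambda>\<omega>. (Z \<omega> * indicator (A k) \<omega>)\<^sup>2)"
    by (rule Bochner_Integration.integrable_bound[OF Zi]) (auto simp: indicator_def)
  moreover have "(\<lambda>\<omega>. Z \<omega> * indicator (A k) \<omega>) \<in> borel_measurable (G k)" by measurable
  ultimately have "(\<integral>\<omega>. (Z \<omega> * indicator (A k) \<omega>) * D k \<omega> \<partial>M) = 0"
    by (intro martingale_differencesD(6)[OF D])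
  then show "(\<integral>\<omega>. Z \<omega> * (indicator (A k) \<omega> * D k \<omega>) \<partial>M) = 0" by (simp add: mult.assoc)
qed

text \<open>Stopping the partial sums when they first exceed \<open>\<eta>\<close> again gives martingale differences,
  and the stopped sum exceeds \<open>\<eta>\<close> whenever one of the partial sums does.\<close>

lemma martingale_differences_maximal_inequality:
  assumes D: "martingale_differences G D" and \<eta>: "\<eta> > 0"
  shows "{\<omega>\<in>space M. \<exists>n\<le>N. \<bar>\<Sum>k<n. D k \<omega>\<bar> > \<eta>} \<in> sets M"
    and "measure M {\<omega>\<in>space M. \<exists>n\<le>N. \<bar>\<Sum>k<n. D k \<omega>\<bar> > \<eta>} \<le> (\<Sum>k<N. \<integral>\<omega>. (D k \<omega>)\<^sup>2 \<partial>M) / \<eta>\<^sup>2"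
proof -
  note sub = martingale_differencesD(1)[OF D] and Dm[measurable] = martingale_differencesD(4)[OF D]
    and Di = martingale_differencesD(5)[OF D]
  show "{\<omega>\<in>space M. \<exists>n\<le>N. \<bar>\<Sum>k<n. D k \<omega>\<bar> > \<eta>} \<in> sets M" by measurable
  define A where "A k = {\<omega>\<in>space (G k). \<forall>n\<le>k. \<bar>\<Sum>i<n. D i \<omega>\<bar> \<le> \<eta>}" for k
  have mono: "sets (G n) \<subseteq> sets (G k)" if "n \<le> k" for n k
    by (rule lift_Suc_mono_le[of "\<lambda>k. sets (G k)"]) (use martingale_differencesD(2)[OF D] that in auto)
  have A: "A k \<in> sets (G k)" for k
  proof -
    have "(\<lambda>\<omega>. \<Sum>i<n. D i \<omega>) \<in> borel_measurable (G k)" if "n \<le> k" for n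
      using measurable_from_subalg[OF _ martingale_differences_partial_sum[OF D, of n], of "G k"]
        mono[OF that] sub unfolding subalgebra_def by auto
    then have "{\<omega>\<in>space (G k). \<bar>\<Sum>i<n. D i \<omega>\<bar> \<le> \<eta>} \<in> sets (G k)" if "n \<le> k" for n
      using that by measurable
    then have "(\<Inter>n\<in>{..k}. {\<omega>\<in>space (G k). \<bar>\<Sum>i<n. D i \<omega>\<bar> \<le> \<eta>}) \<in> sets (G k)"
      by (intro sets.finite_INT) auto
    moreover have "A k = (\<Inter>n\<in>{..k}. {\<omega>\<in>space (G k). \<bar>\<Sum>i<n. D i \<omega>\<bar> \<le> \<eta>})"
      unfolding A_def by auto
    ultimately show ?thesis by simp
  qed
  define E where "E k \<omega> = indicator (A k) \<omega> * D k \<omega>" for k \<omega>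
  have E: "martingale_differences G E"
    unfolding E_def[abs_def] by (rule martingale_differences_stopped[OF D A])
  have stop: "\<bar>\<Sum>k<N. E k \<omega>\<bar> > \<eta>" if \<omega>: "\<omega> \<in> space M" and ex: "\<exists>n\<le>N. \<bar>\<Sum>k<n. D k \<omega>\<bar> > \<eta>" for \<omega>
  proof -
    \<comment> \<open>\<open>n\<close> is the first overshoot. Then \<open>E\<close> agrees with
      \<open>D\<close> below \<open>n\<close> and vanishes from \<open>n\<close> on, so its sum up
      to \<open>N\<close> is frozen at a value beyond \<eta>, even if the sums of \<open>D\<close>
      come back later.\<close>
    define n where "n = (LEAST n. \<bar>\<Sum>k<n. D k \<omega>\<bar> > \<eta>)"
    have n: "\<bar>\<Sum>k<n. D k \<omega>\<bar> > \<eta>" unfolding n_def using ex by (metis LeastI)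
    have least: "\<bar>\<Sum>k<i. D k \<omega>\<bar> \<le> \<eta>" if "i < n" for i
      using not_less_Least[of i "\<lambda>n. \<bar>\<Sum>k<n. D k \<omega>\<bar> > \<eta>"] that unfolding n_def by linarith
    have nN: "n \<le> N" unfolding n_def using ex by (metis (mono_tags, lifting) Least_le order.trans)
    have "E k \<omega> = (if k < n then D k \<omega> else 0)" for k
    proof (cases "k < n")
      case True
      then show ?thesis using least \<omega> sub unfolding E_def A_def subalgebra_def by auto
    next
      case False
      then have "\<omega> \<notin> A k" using n unfolding A_def by (auto simp: not_le not_less)
      then show ?thesis using False by (simp add: E_def)
    qed
    then have "(\<Sum>k<N. E k \<omega>) = (\<Sum>k\<in>{..<N} \<inter> {k. k < n}. D k \<omega>)"
      by (simp add: sum.inter_restrict)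
    also have "{..<N} \<inter> {k. k < n} = {..<n}" using nN by auto
    finally show ?thesis using n by simp
  qed
  note Em[measurable] = martingale_differencesD(4)[OF E]
  have "measure M {\<omega>\<in>space M. \<exists>n\<le>N. \<bar>\<Sum>k<n. D k \<omega>\<bar> > \<eta>} \<le> measure M {\<omega>\<in>space M. \<eta>\<^sup>2 \<le> (\<Sum>k<N. E k \<omega>)\<^sup>2}"
  proof (rule finite_measure_mono)
    show "{\<omega>\<in>space M. \<exists>n\<le>N. \<bar>\<Sum>k<n. D k \<omega>\<bar> > \<eta>} \<subseteq> {\<omega>\<in>space M. \<eta>\<^sup>2 \<le> (\<Sum>k<N. E k \<omega>)\<^sup>2}"
    proof safe
      fix \<omega> n assume "\<omega> \<in> space M" "n \<le> N" "\<bar>\<Sum>k<n. D k \<omega>\<bar> > \<eta>"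
      with stop[of \<omega>] have "\<eta> \<le> \<bar>\<Sum>k<N. E k \<omega>\<bar>" by force
      then show "\<eta>\<^sup>2 \<le> (\<Sum>k<N. E k \<omega>)\<^sup>2" using \<eta> by (metis abs_le_square_iff abs_of_pos)
    qed
    show "{\<omega> \<in> space M. \<eta>\<^sup>2 \<le> (\<Sum>k<N. E k \<omega>)\<^sup>2} \<in> events" by measurable
  qed
  also have "\<dots> \<le> (\<integral>\<omega>. (\<Sum>k<N. E k \<omega>)\<^sup>2 \<partial>M) / \<eta>\<^sup>2"
    using integral_Markov_inequality_measure[OF martingale_differences_integral_square(1)[OF E, of N],
      of "space M" "\<eta>\<^sup>2"] \<eta> by simp
  also have "(\<integral>\<omega>. (\<Sum>k<N. E k \<omega>)\<^sup>2 \<partial>M) = (\<Sum>k<N. \<integral>\<omega>. (E k \<omega>)\<^sup>2 \<partial>M)"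
    by (rule martingale_differences_integral_square(2)[OF E])
  also have "\<dots> \<le> (\<Sum>k<N. \<integral>\<omega>. (D k \<omega>)\<^sup>2 \<partial>M)"
    using martingale_differencesD(5)[OF E] Di
    by (intro sum_mono integral_mono) (auto simp: E_def indicator_def)
  finally show "measure M {\<omega>\<in>space M. \<exists>n\<le>N. \<bar>\<Sum>k<n. D k \<omega>\<bar> > \<eta>} \<le> (\<Sum>k<N. \<integral>\<omega>. (D k \<omega>)\<^sup>2 \<partial>M) / \<eta>\<^sup>2"
    by (simp add: divide_right_mono)
qed

end

section \<open>A maximal inequality for delayed integrands\<close>

text \<open>The indicator is idempotent: one copy stays with \<open>f\<close>, the other contributes
  the measure of \<open>B\<close>, which is \<epsilon> for a block.\<close>

lemma Cauchy_Schwarz_set_nn_integral: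
  assumes [measurable]: "f \<in> borel_measurable N" "B \<in> sets N"
  shows "(\<integral>\<^sup>+x. indicator B x * ennreal \<bar>f x\<bar> \<partial>N)\<^sup>2 \<le> emeasure N B * (\<integral>\<^sup>+x. indicator B x * ennreal ((f x)\<^sup>2) \<partial>N)"
proof -
  have "(\<integral>\<^sup>+x. indicator B x * ennreal \<bar>f x\<bar> \<partial>N)\<^sup>2
      = (\<integral>\<^sup>+x. indicator B x * (indicator B x * ennreal \<bar>f x\<bar>) \<partial>N)\<^sup>2"
    by (intro arg_cong[where f="\<lambda>x. x\<^sup>2"] nn_integral_cong) (auto simp: indicator_def)
  also have "\<dots> \<le> (\<integral>\<^sup>+x. (indicator B x)\<^sup>2 \<partial>N) * (\<integral>\<^sup>+x. (indicator B x * ennreal \<bar>f x\<bar>)\<^sup>2 \<partial>N)"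
    by (rule Cauchy_Schwarz_nn_integral) measurable
  also have "(\<integral>\<^sup>+x. (indicator B x)\<^sup>2 \<partial>N) = (\<integral>\<^sup>+x. indicator B x \<partial>N)"
    by (intro nn_integral_cong) (auto simp: indicator_def)
  also have "(\<integral>\<^sup>+x. (indicator B x * ennreal \<bar>f x\<bar>)\<^sup>2 \<partial>N) = (\<integral>\<^sup>+x. indicator B x * ennreal ((f x)\<^sup>2) \<partial>N)"
    by (intro nn_integral_cong) (auto simp: indicator_def ennreal_power)
  finally show ?thesis by simp
qed

text \<open>For a non-integrable function the Bochner integral has the default value 0 and the bound
  is trivial.\<close>

lemma ennreal_abs_lebesgue_integral_le:
  fixes f :: "'a \<Rightarrow> real"
  shows "ennreal \<bar>\<integral>x. f x \<partial>N\<bar> \<le> (\<integral>\<^sup>+x. ennreal \<bar>f x\<bar> \<partial>N)"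
  using integral_norm_bound_ennreal[of N f] by (cases "integrable N f") (auto simp: not_integrable_integral_eq)

lemma ennreal_abs_set_lebesgue_integral_le:
  fixes f :: "'a \<Rightarrow> real"
  shows "ennreal \<bar>LINT x:B|N. f x\<bar> \<le> (\<integral>\<^sup>+x. indicator B x * ennreal \<bar>f x\<bar> \<partial>N)"
proof -
  have "ennreal \<bar>LINT x:B|N. f x\<bar> \<le> (\<integral>\<^sup>+x. ennreal \<bar>indicator B x *\<^sub>R f x\<bar> \<partial>N)"
    unfolding set_lebesgue_integral_def by (rule ennreal_abs_lebesgue_integral_le)
  also have "\<dots> = (\<integral>\<^sup>+x. indicator B x * ennreal \<bar>f x\<bar> \<partial>N)"
    by (intro nn_integral_cong) (auto simp: indicator_def)
  finally show ?thesis .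
qed

text \<open>\<open>(n + 1) div 2\<close> and \<open>n div 2\<close> count the even and the odd
  indices below \<open>n\<close>.\<close>

lemma sum_even_odd: "(\<Sum>k<n. f k) = (\<Sum>k<(n + 1) div 2. f (2 * k)) + (\<Sum>k<n div 2. f (2 * k + 1))"
  for f :: "nat \<Rightarrow> real"
proof (induction n)
  case (Suc n)
  then show ?case by (cases "even n") (auto elim!: evenE oddE)
qed simp

section \<open>Filtrations on a probability space\<close>

locale filtered_prob_space = prob_space M for M :: "'a measure" +
  fixes F :: "real \<Rightarrow> 'a measure"
  assumes filtration_subalgebra: "subalgebra M (F t)"
    and filtration_mono: "s \<le> t \<Longrightarrow> sets (F s) \<subseteq> sets (F t)"
begin

lemma filtration_space [simp]: "space (F t) = space M"
  using filtration_subalgebra by (simp add: subalgebra_def)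

lemma filtration_measurable: "f \<in> measurable (F t) N \<Longrightarrow> f \<in> measurable M N"
  using measurable_from_subalg[OF filtration_subalgebra] by blast

lemma filtration_measurable_mono: "f \<in> measurable (F s) N \<Longrightarrow> s \<le> t \<Longrightarrow> f \<in> measurable (F t) N"
  by (rule measurable_from_subalg[of "F t" "F s"])
    (auto simp: subalgebra_def filtration_mono[THEN subsetD])

text \<open>The identity is measurable from the product with \<open>M\<close> to the product with
  \<open>F t\<close>, so each set of the smaller product is its own preimage in the larger
  one.\<close>

lemma filtration_pair_measurable:
  "f \<in> measurable (N \<Otimes>\<^sub>M F t) K \<Longrightarrow> f \<in> measurable (N \<Otimes>\<^sub>M M) K"
proof (rule measurable_from_subalg[of "N \<Otimes>\<^sub>M M" "N \<Otimes>\<^sub>M F t"])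
  have "id \<in> measurable M (F t)" using filtration_measurable[of id t "F t"] by simp
  then have [measurable]: "(\<lambda>x. x) \<in> measurable M (F t)" by (simp add: id_def)
  have "(\<lambda>x. (fst x, snd x)) \<in> measurable (N \<Otimes>\<^sub>M M) (N \<Otimes>\<^sub>M F t)" by measurable
  then have id: "(\<lambda>x. x) \<in> measurable (N \<Otimes>\<^sub>M M) (N \<Otimes>\<^sub>M F t)" by simp
  show "subalgebra (N \<Otimes>\<^sub>M M) (N \<Otimes>\<^sub>M F t)"
    unfolding subalgebra_def
  proof
    show "space (N \<Otimes>\<^sub>M F t) = space (N \<Otimes>\<^sub>M M)" by (simp add: space_pair_measure)
    show "sets (N \<Otimes>\<^sub>M F t) \<subseteq> sets (N \<Otimes>\<^sub>M M)"
    proof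
      fix A assume A: "A \<in> sets (N \<Otimes>\<^sub>M F t)"
      then have "A \<subseteq> space (N \<Otimes>\<^sub>M M)"
        using sets.sets_into_space[OF A] by (simp add: space_pair_measure)
      then have "(\<lambda>x. x) -` A \<inter> space (N \<Otimes>\<^sub>M M) = A" by auto
      with measurable_sets[OF id A] show "A \<in> sets (N \<Otimes>\<^sub>M M)" by simp
    qed
  qed
qed

end

text \<open>\<open>U\<close> models the integrand of a forward approximation with parameter \<open>\<epsilon>\<close>: at time \<open>s\<close> it is
  centred given \<open>F s\<close> but only known at time \<open>s + \<epsilon>\<close>.\<close>

locale delayed_integrand = filtered_prob_space +
  fixes U :: "real \<Rightarrow> 'a \<Rightarrow> real" and \<epsilon> T H :: real
  assumes eps_pos: "\<epsilon> > 0" and T_pos: "T > 0" and H_nonneg: "H \<ge> 0"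
    and U_zero: "s \<notin> {0..T} \<Longrightarrow> U s \<omega> = 0"
    and U_progressive: "0 \<le> b \<Longrightarrow>
      (\<lambda>(s, \<omega>). indicator {..b} s * U s \<omega>) \<in> borel_measurable (borel \<Otimes>\<^sub>M F (b + \<epsilon>))"
    and U_square: "(\<integral>\<^sup>+s. \<integral>\<^sup>+\<omega>. ennreal ((U s \<omega>)\<^sup>2) \<partial>M \<partial>lborel) \<le> ennreal H"
    and U_centred: "AE s in lborel. 0 \<le> s \<longrightarrow> (\<forall>Z\<in>borel_measurable (F s).
      integrable M (\<lambda>\<omega>. (Z \<omega>)\<^sup>2) \<longrightarrow> (\<integral>\<omega>. Z \<omega> * U s \<omega> \<partial>M) = 0)"
begin

sublocale pair: pair_sigma_finite lborel M ..

text \<open>Half-open intervals, so that the blocks tile the half-line without overlap.\<close>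

definition block :: "nat \<Rightarrow> real set" where
  "block k = {\<epsilon> * real k..<\<epsilon> * real (Suc k)}"

lemma block_sets [measurable]: "block k \<in> sets borel"
  by (simp add: block_def)

definition D :: "nat \<Rightarrow> 'a \<Rightarrow> real" where
  "D k \<omega> = (LINT s:block k|lborel. U s \<omega>)"

text \<open>Dominates the integral of \<open>U\<close> over every part of block \<open>k\<close>,
  hence also over a block cut off at an arbitrary time. It takes extended values because paths are
  integrable only almost surely.\<close>

definition E :: "nat \<Rightarrow> 'a \<Rightarrow> ennreal" where
  "E k \<omega> = (\<integral>\<^sup>+s. indicator (block k) s * ennreal \<bar>U s \<omega>\<bar> \<partial>lborel)"

text \<open>The share of block \<open>k\<close> in the total second moment; over all blocks the
  shares add up to at most \<open>H\<close>.\<close>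

definition h :: "nat \<Rightarrow> ennreal" where
  "h k = (\<integral>\<^sup>+\<omega>. \<integral>\<^sup>+s. indicator (block k) s * ennreal ((U s \<omega>)\<^sup>2) \<partial>lborel \<partial>M)"

lemma U_measurable_pair: "(\<lambda>(s, \<omega>). U s \<omega>) \<in> borel_measurable (borel \<Otimes>\<^sub>M M)"
proof -
  have "(\<lambda>(s, \<omega>). indicator {..T} s * U s \<omega>) = (\<lambda>(s, \<omega>). U s \<omega>)"
    using U_zero by (auto simp: fun_eq_iff indicator_def)
  then show ?thesis
    using filtration_pair_measurable[OF U_progressive[of T]] T_pos by simp
qed

lemma U_measurable [measurable (raw)]:
  "f \<in> borel_measurable N \<Longrightarrow> g \<in> measurable N M \<Longrightarrow> (\<lambda>x. U (f x) (g x)) \<in> borel_measurable N"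
  using measurable_compose[OF _ U_measurable_pair, of "\<lambda>x. (f x, g x)" N] by simp

text \<open>Block \<open>k\<close> ends at \<open>\<epsilon> * (k + 1)\<close> and \<open>U\<close>
  looks ahead by \<epsilon>. This delay of one block is what separates even from odd
  indices.\<close>

lemma D_measurable: "D k \<in> borel_measurable (F (\<epsilon> * real (k + 2)))"
proof -
  have b: "\<epsilon> * real (Suc k) + \<epsilon> = \<epsilon> * real (k + 2)" by (simp add: algebra_simps)
  have U': "(\<lambda>(s, \<omega>). indicator {..\<epsilon> * real (Suc k)} s * U s \<omega>) \<in> borel_measurable (borel \<Otimes>\<^sub>M F (\<epsilon> * real (k + 2)))"
    by (rule U_progressive[of "\<epsilon> * real (Suc k)", unfolded b]) (use eps_pos in simp)
  have "(\<lambda>p. (snd p, fst p)) \<in> measurable (F (\<epsilon> * real (k + 2)) \<Otimes>\<^sub>M lborel) (borel \<Otimes>\<^sub>M F (\<epsilon> * real (k + 2)))"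
    by measurable
  from measurable_compose[OF this U'] have [measurable]: "(\<lambda>p. indicator {..\<epsilon> * real (Suc k)} (snd p) * U (snd p) (fst p))
      \<in> borel_measurable (F (\<epsilon> * real (k + 2)) \<Otimes>\<^sub>M lborel)"
    by simp
  \<comment> \<open>On the block the additional indicator equals 1; it puts \<open>U\<close> into
    the form for which progressive measurability is given.\<close>
  have "(\<lambda>p. indicator (block k) (snd p) * (indicator {..\<epsilon> * real (Suc k)} (snd p) * U (snd p) (fst p)))
      \<in> borel_measurable (F (\<epsilon> * real (k + 2)) \<Otimes>\<^sub>M lborel)" by measurable
  also have "(\<lambda>p. indicator (block k) (snd p) * (indicator {..\<epsilon> * real (Suc k)} (snd p) * U (snd p) (fst p)))
      = (\<lambda>(\<omega>, s). indicator (block k) s * U s \<omega>)"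
    by (auto simp: fun_eq_iff block_def indicator_def)
  finally have "(\<lambda>\<omega>. \<integral>s. indicator (block k) s * U s \<omega> \<partial>lborel) \<in> borel_measurable (F (\<epsilon> * real (k + 2)))"
    by (rule lborel.borel_measurable_lebesgue_integral)
  then show ?thesis by (simp add: D_def[abs_def] set_lebesgue_integral_def)
qed

lemma D_measurable' [measurable]: "D k \<in> borel_measurable M"
  by (rule filtration_measurable[OF D_measurable])

lemma E_measurable [measurable]: "E k \<in> borel_measurable M"
  unfolding E_def[abs_def] by measurable

lemma emeasure_block: "emeasure lborel (block k) = ennreal \<epsilon>"
  using eps_pos by (simp add: block_def algebra_simps)

text \<open>Cauchy-Schwarz in time for each path; the length of the block supplies the factor
  \<epsilon> that later cancels the 1/\<epsilon> in \<open>H\<close>.\<close>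

lemma E_square: "(\<integral>\<^sup>+\<omega>. (E k \<omega>)\<^sup>2 \<partial>M) \<le> ennreal \<epsilon> * h k"
proof -
  have "(\<integral>\<^sup>+\<omega>. (E k \<omega>)\<^sup>2 \<partial>M) \<le> (\<integral>\<^sup>+\<omega>. ennreal \<epsilon> * (\<integral>\<^sup>+s. indicator (block k) s * ennreal ((U s \<omega>)\<^sup>2) \<partial>lborel) \<partial>M)"
  proof (rule nn_integral_mono)
    fix \<omega> assume "\<omega> \<in> space M"
    then have [measurable]: "(\<lambda>s. U s \<omega>) \<in> borel_measurable lborel" by measurable
    show "(E k \<omega>)\<^sup>2 \<le> ennreal \<epsilon> * (\<integral>\<^sup>+s. indicator (block k) s * ennreal ((U s \<omega>)\<^sup>2) \<partial>lborel)"
      using Cauchy_Schwarz_set_nn_integral[of "\<lambda>s. U s \<omega>" lborel "block k"]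
      unfolding E_def emeasure_block by simp
  qed
  also have "\<dots> = ennreal \<epsilon> * h k" unfolding h_def by (rule nn_integral_cmult) measurable
  finally show ?thesis .
qed

lemma D_le_E: "ennreal \<bar>D k \<omega>\<bar> \<le> E k \<omega>"
  unfolding D_def E_def by (rule ennreal_abs_set_lebesgue_integral_le)

lemma D_square: "(\<integral>\<^sup>+\<omega>. ennreal ((D k \<omega>)\<^sup>2) \<partial>M) \<le> ennreal \<epsilon> * h k"
proof -
  have "(\<integral>\<^sup>+\<omega>. ennreal ((D k \<omega>)\<^sup>2) \<partial>M) \<le> (\<integral>\<^sup>+\<omega>. (E k \<omega>)\<^sup>2 \<partial>M)"
  proof (rule nn_integral_mono)
    fix \<omega>
    show "ennreal ((D k \<omega>)\<^sup>2) \<le> (E k \<omega>)\<^sup>2"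
      using power_mono[OF D_le_E[of k \<omega>] zero_le, of 2] by (simp add: ennreal_power)
  qed
  then show ?thesis by (rule order_trans[OF _ E_square])
qed

lemma U_square_swap: "(\<integral>\<^sup>+\<omega>. \<integral>\<^sup>+s. ennreal ((U s \<omega>)\<^sup>2) \<partial>lborel \<partial>M) \<le> ennreal H"
proof -
  have "(\<integral>\<^sup>+s. \<integral>\<^sup>+\<omega>. ennreal ((U s \<omega>)\<^sup>2) \<partial>M \<partial>lborel) = (\<integral>\<^sup>+\<omega>. \<integral>\<^sup>+s. ennreal ((U s \<omega>)\<^sup>2) \<partial>lborel \<partial>M)"
    by (rule pair.Fubini'[symmetric]) measurable
  with U_square show ?thesis by simp
qed

lemma disjoint_blocks: "disjoint_family block"
proof -
  have "block i \<inter> block j = {}" if "i < j" for i j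
  proof -
    have "real (Suc i) \<le> real j" using that by linarith
    then have "\<epsilon> * real (Suc i) \<le> \<epsilon> * real j" using eps_pos by (intro mult_left_mono) auto
    then show ?thesis unfolding block_def by force
  qed
  then show ?thesis unfolding disjoint_family_on_def by (metis inf_commute linorder_neqE_nat)
qed

lemma sum_indicator_blocks_le: "finite K \<Longrightarrow> (\<Sum>k\<in>K. indicator (block k) s) \<le> (1::ennreal)"
proof -
  assume "finite K"
  then have *: "indicator (\<Union>k\<in>K. block k) s = (\<Sum>k\<in>K. indicator (block k) s :: ennreal)"
    using disjoint_blocks by (intro indicator_UN_disjoint) (auto simp: disjoint_family_on_def)
  show ?thesis unfolding *[symmetric] by (simp add: indicator_def)
qed

lemma sum_h_le: "finite K \<Longrightarrow> (\<Sum>k\<in>K. h k) \<le> ennreal H"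
proof -
  assume K: "finite K"
  have "(\<Sum>k\<in>K. h k) = (\<integral>\<^sup>+\<omega>. (\<Sum>k\<in>K. \<integral>\<^sup>+s. indicator (block k) s * ennreal ((U s \<omega>)\<^sup>2) \<partial>lborel) \<partial>M)"
    unfolding h_def by (rule nn_integral_sum[symmetric]) measurable
  also have "\<dots> = (\<integral>\<^sup>+\<omega>. \<integral>\<^sup>+s. (\<Sum>k\<in>K. indicator (block k) s * ennreal ((U s \<omega>)\<^sup>2)) \<partial>lborel \<partial>M)"
    by (intro nn_integral_cong nn_integral_sum[symmetric]) measurable
  also have "\<dots> \<le> (\<integral>\<^sup>+\<omega>. \<integral>\<^sup>+s. ennreal ((U s \<omega>)\<^sup>2) \<partial>lborel \<partial>M)"
    using mult_right_mono[OF sum_indicator_blocks_le[OF K]]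
    by (intro nn_integral_mono) (simp add: sum_distrib_right[symmetric])
  also have "\<dots> \<le> ennreal H" by (rule U_square_swap)
  finally show ?thesis .
qed

lemma D_square_integrable: "integrable M (\<lambda>\<omega>. (D k \<omega>)\<^sup>2)"
proof (rule integrableI_bounded)
  have "(\<integral>\<^sup>+\<omega>. ennreal ((D k \<omega>)\<^sup>2) \<partial>M) \<le> ennreal \<epsilon> * ennreal H"
    by (rule order_trans[OF D_square mult_left_mono]) (use sum_h_le[of "{k}"] in auto)
  also have "\<dots> < \<infinity>" by (simp add: ennreal_mult_less_top)
  finally show "(\<integral>\<^sup>+\<omega>. ennreal (norm ((D k \<omega>)\<^sup>2)) \<partial>M) < \<infinity>" by simp
qed measurable

text \<open>Fubini moves the expectation inside the time integral. For \<open>s\<close> in block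
  \<open>k\<close> the test function is already known at time \<open>s\<close>, and \<open>U\<close>
  is centred there for almost every \<open>s\<close>.\<close>

lemma D_centred:
  assumes Z: "Z \<in> borel_measurable (F (\<epsilon> * real k))" and Zi: "integrable M (\<lambda>\<omega>. (Z \<omega>)\<^sup>2)"
  shows "(\<integral>\<omega>. Z \<omega> * D k \<omega> \<partial>M) = 0"
proof -
  have [measurable]: "Z \<in> borel_measurable M" by (rule filtration_measurable[OF Z])
  define f where "f s \<omega> = indicator (block k) s * (Z \<omega> * U s \<omega>)" for s \<omega>
  have [measurable]: "(\<lambda>(s, \<omega>). f s \<omega>) \<in> borel_measurable (lborel \<Otimes>\<^sub>M M)"
    unfolding f_def by measurable
  have Z2: "(\<integral>\<^sup>+\<omega>. ennreal ((Z \<omega>)\<^sup>2) \<partial>M) < \<infinity>"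
    using Zi by (simp add: integrable_iff_bounded)
  have "integrable (lborel \<Otimes>\<^sub>M M) (\<lambda>(s, \<omega>). f s \<omega>)"
  proof (rule integrableI_bounded)
    have "(\<integral>\<^sup>+p. ennreal (norm (case p of (s, \<omega>) \<Rightarrow> f s \<omega>)) \<partial>(lborel \<Otimes>\<^sub>M M))
        = (\<integral>\<^sup>+s. \<integral>\<^sup>+\<omega>. ennreal \<bar>f s \<omega>\<bar> \<partial>M \<partial>lborel)"
      by (subst nn_integral_fst[symmetric]) (simp_all add: case_prod_beta')
    \<comment> \<open>From \<open>2 * \<bar>Z U\<bar> \<le> Z\<^sup>2 + U\<^sup>2\<close>. The term
      with \<open>Z\<close> is kept on the block only, since its integral over all times could be
      infinite.\<close>
    also have "\<dots> \<le> (\<integral>\<^sup>+s. \<integral>\<^sup>+\<omega>. indicator (block k) s * ennreal ((Z \<omega>)\<^sup>2) + ennreal ((U s \<omega>)\<^sup>2) \<partial>M \<partial>lborel)"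
    proof (intro nn_integral_mono)
      fix s \<omega>
      have "2 * (\<bar>Z \<omega>\<bar> * \<bar>U s \<omega>\<bar>) \<le> (Z \<omega>)\<^sup>2 + (U s \<omega>)\<^sup>2"
        using sum_squares_bound[of "\<bar>Z \<omega>\<bar>" "\<bar>U s \<omega>\<bar>"] by simp
      moreover have "0 \<le> \<bar>Z \<omega>\<bar> * \<bar>U s \<omega>\<bar>" by simp
      ultimately have "\<bar>Z \<omega> * U s \<omega>\<bar> \<le> (Z \<omega>)\<^sup>2 + (U s \<omega>)\<^sup>2" by (simp only: abs_mult)
      then show "ennreal \<bar>f s \<omega>\<bar> \<le> indicator (block k) s * ennreal ((Z \<omega>)\<^sup>2) + ennreal ((U s \<omega>)\<^sup>2)"
        by (auto simp: f_def indicator_def ennreal_plus[symmetric] simp del: ennreal_plus)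
    qed
    also have "\<dots> = (\<integral>\<^sup>+s. indicator (block k) s * (\<integral>\<^sup>+\<omega>. ennreal ((Z \<omega>)\<^sup>2) \<partial>M) \<partial>lborel)
        + (\<integral>\<^sup>+s. \<integral>\<^sup>+\<omega>. ennreal ((U s \<omega>)\<^sup>2) \<partial>M \<partial>lborel)"
      by (simp add: nn_integral_add nn_integral_cmult)
    also have "\<dots> = ennreal \<epsilon> * (\<integral>\<^sup>+\<omega>. ennreal ((Z \<omega>)\<^sup>2) \<partial>M) + (\<integral>\<^sup>+s. \<integral>\<^sup>+\<omega>. ennreal ((U s \<omega>)\<^sup>2) \<partial>M \<partial>lborel)"
      by (simp add: nn_integral_multc emeasure_block)
    also have "\<dots> < \<infinity>"
      using Z2 le_less_trans[OF U_square ennreal_less_top] by (simp add: ennreal_mult_less_top)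
    finally show "(\<integral>\<^sup>+p. ennreal (norm (case p of (s, \<omega>) \<Rightarrow> f s \<omega>)) \<partial>(lborel \<Otimes>\<^sub>M M)) < \<infinity>" .
  qed measurable
  then have "(\<integral>\<omega>. (\<integral>s. f s \<omega> \<partial>lborel) \<partial>M) = (\<integral>s. (\<integral>\<omega>. f s \<omega> \<partial>M) \<partial>lborel)"
    by (rule pair.Fubini_integral)
  also have "\<dots> = 0"
  proof (rule integral_eq_zero_AE)
    show "AE s in lborel. (\<integral>\<omega>. f s \<omega> \<partial>M) = 0"
      using U_centred
    proof eventually_elim
      case (elim s)
      show ?case
      proof (cases "s \<in> block k")
        case True
        then have s: "0 \<le> s" "\<epsilon> * real k \<le> s"
          using eps_pos unfolding block_def by (auto intro: order_trans[rotated])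
        have "(\<integral>\<omega>. Z \<omega> * U s \<omega> \<partial>M) = 0"
          using elim s(1) filtration_measurable_mono[OF Z s(2)] Zi by blast
        then show ?thesis using True by (simp add: f_def)
      qed (simp add: f_def)
    qed
  qed
  finally have "(\<integral>\<omega>. (\<integral>s. f s \<omega> \<partial>lborel) \<partial>M) = 0" .
  moreover have "(\<integral>s. f s \<omega> \<partial>lborel) = Z \<omega> * D k \<omega>" for \<omega>
    unfolding f_def D_def set_lebesgue_integral_def
    by (simp add: mult.left_commute[of _ "Z \<omega>"])
  ultimately show ?thesis by simp
qed

text \<open>The offset \<open>i\<close> fixes the parity. \<open>D (2 * k + i)\<close> is known at
  the start of block \<open>2 * k + i + 2\<close>, the next block of the same parity, and it is
  centred given the start of its own block.\<close>

lemma D_martingale_differences: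
  "martingale_differences (\<lambda>k. F (\<epsilon> * real (2 * k + i))) (\<lambda>k. D (2 * k + i))"
  unfolding martingale_differences_def
proof (intro allI conjI ballI impI)
  fix k
  show "sets (F (\<epsilon> * real (2 * k + i))) \<subseteq> sets (F (\<epsilon> * real (2 * Suc k + i)))"
    using eps_pos by (intro filtration_mono mult_left_mono) auto
  have "2 * k + i + 2 = 2 * Suc k + i" by simp
  then show "D (2 * k + i) \<in> borel_measurable (F (\<epsilon> * real (2 * Suc k + i)))"
    using D_measurable[of "2 * k + i"] by metis
qed (auto intro: filtration_subalgebra D_square_integrable D_centred)

lemma sum_D_square_le:
  assumes "finite K"
  shows "(\<Sum>k\<in>K. \<integral>\<omega>. (D k \<omega>)\<^sup>2 \<partial>M) \<le> \<epsilon> * H"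
proof -
  have "ennreal (\<Sum>k\<in>K. \<integral>\<omega>. (D k \<omega>)\<^sup>2 \<partial>M) = (\<Sum>k\<in>K. \<integral>\<^sup>+\<omega>. ennreal ((D k \<omega>)\<^sup>2) \<partial>M)"
    using D_square_integrable by (simp add: nn_integral_eq_integral sum_ennreal)
  also have "\<dots> \<le> (\<Sum>k\<in>K. ennreal \<epsilon> * h k)" by (intro sum_mono D_square)
  also have "\<dots> = ennreal \<epsilon> * (\<Sum>k\<in>K. h k)" by (simp add: sum_distrib_left)
  also have "\<dots> \<le> ennreal \<epsilon> * ennreal H" by (intro mult_left_mono sum_h_le assms) auto
  also have "\<dots> = ennreal (\<epsilon> * H)" using eps_pos H_nonneg by (simp add: ennreal_mult)
  finally show ?thesis using eps_pos H_nonneg by simp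
qed

text \<open>On \<open>{0..T}\<close> the bound \<open>\<bar>U\<bar> \<le> 1 + U\<^sup>2\<close>
  reduces integrability of a path to square integrability, which holds almost surely by
  Tonelli.\<close>

lemma AE_integrable: "AE \<omega> in M. integrable lborel (\<lambda>s. U s \<omega>)"
proof -
  have "AE \<omega> in M. (\<integral>\<^sup>+s. ennreal ((U s \<omega>)\<^sup>2) \<partial>lborel) \<noteq> \<infinity>"
    using le_less_trans[OF U_square_swap ennreal_less_top] by (intro nn_integral_PInf_AE) (simp_all add: less_top)
  then show ?thesis
  proof (rule AE_mp, intro AE_I2 impI)
    fix \<omega> assume \<omega>: "\<omega> \<in> space M" and fin: "(\<integral>\<^sup>+s. ennreal ((U s \<omega>)\<^sup>2) \<partial>lborel) \<noteq> \<infinity>"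
    have [measurable]: "(\<lambda>s. U s \<omega>) \<in> borel_measurable lborel" using \<omega> by measurable
    have int: "integrable lborel (\<lambda>s. (U s \<omega>)\<^sup>2)"
      using fin by (auto simp: integrable_iff_bounded top.not_eq_extremum)
    show "integrable lborel (\<lambda>s. U s \<omega>)"
    proof (rule Bochner_Integration.integrable_bound)
      show "integrable lborel (\<lambda>s. indicator {0..T} s + (U s \<omega>)\<^sup>2)"
        using int by (intro Bochner_Integration.integrable_add) (auto simp: integrable_indicator_iff emeasure_lborel_Icc_eq)
      have "\<bar>U s \<omega>\<bar> \<le> indicator {0..T} s + (U s \<omega>)\<^sup>2" for s
      proof (cases "s \<in> {0..T}")
        case True
        have "2 * \<bar>U s \<omega>\<bar> \<le> 1 + (U s \<omega>)\<^sup>2" using sum_squares_bound[of 1 "\<bar>U s \<omega>\<bar>"] by simp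
        then show ?thesis using True by simp
      qed (simp add: U_zero)
      then show "AE s in lborel. norm (U s \<omega>) \<le> norm (indicator {0..T} s + (U s \<omega>)\<^sup>2)"
        by (intro AE_I2) (auto intro: order_trans)
    qed measurable
  qed
qed

section \<open>Time integrals as sums over blocks\<close>

lemma integral_blocks:
  assumes int: "integrable lborel (\<lambda>s. U s \<omega>)"
  shows "(LINT s:{0..<\<epsilon> * real n}|lborel. U s \<omega>) = (\<Sum>k<n. D k \<omega>)"
proof (induction n)
  case (Suc n)
  have "{0..<\<epsilon> * real (Suc n)} = {0..<\<epsilon> * real n} \<union> block n"
    using eps_pos unfolding block_def by (intro ivl_disj_un_two(3)[symmetric]) auto
  moreover have "(LINT s:{0..<\<epsilon> * real n} \<union> block n|lborel. U s \<omega>)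
      = (LINT s:{0..<\<epsilon> * real n}|lborel. U s \<omega>) + (LINT s:block n|lborel. U s \<omega>)"
  proof (rule set_integral_Un)
    show "{0..<\<epsilon> * real n} \<inter> block n = {}" by (auto simp: block_def)
  qed (auto simp: set_integrable_def intro: integrable_mult_indicator[OF _ int, simplified])
  ultimately show ?case using Suc by (simp add: D_def)
qed (simp add: set_lebesgue_integral_def)

text \<open>With \<open>n\<close> the number of complete blocks before \<open>t\<close>, what
  remains is the integral over an initial piece of block \<open>n\<close>.\<close>

lemma integral_upto_bound:
  assumes int: "integrable lborel (\<lambda>s. U s \<omega>)" and t: "0 \<le> t"
  shows "\<exists>n. \<epsilon> * real n \<le> t \<and>
    ennreal \<bar>(LINT s:{0..t}|lborel. U s \<omega>) - (\<Sum>k<n. D k \<omega>)\<bar> \<le> E n \<omega>"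
proof (intro exI conjI)
  define n where "n = nat \<lfloor>t / \<epsilon>\<rfloor>"
  have "0 \<le> t / \<epsilon>" using t eps_pos by simp
  then have "real n \<le> t / \<epsilon>" "t / \<epsilon> < real n + 1"
    unfolding n_def by linarith+
  then have n: "\<epsilon> * real n \<le> t" "t < \<epsilon> * real (Suc n)"
    using eps_pos by (auto simp: field_simps)
  show "\<epsilon> * real n \<le> t" by (rule n(1))
  have si: "set_integrable lborel B (\<lambda>s. U s \<omega>)" if "B \<in> sets borel" for B
    unfolding set_integrable_def by (intro integrable_mult_indicator int) (use that in simp)
  have "{0..t} = {0..<\<epsilon> * real n} \<union> {\<epsilon> * real n..t}"
    using n(1) eps_pos by (intro ivl_disj_un_two(7)[symmetric]) auto
  moreover have "(LINT s:{0..<\<epsilon> * real n} \<union> {\<epsilon> * real n..t}|lborel. U s \<omega>) =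
      (LINT s:{0..<\<epsilon> * real n}|lborel. U s \<omega>) + (LINT s:{\<epsilon> * real n..t}|lborel. U s \<omega>)"
    by (intro set_integral_Un si) auto
  ultimately have "(LINT s:{0..t}|lborel. U s \<omega>) - (\<Sum>k<n. D k \<omega>) = (LINT s:{\<epsilon> * real n..t}|lborel. U s \<omega>)"
    using integral_blocks[OF int, of n] by simp
  then have "ennreal \<bar>(LINT s:{0..t}|lborel. U s \<omega>) - (\<Sum>k<n. D k \<omega>)\<bar>
      \<le> (\<integral>\<^sup>+s. indicator {\<epsilon> * real n..t} s * ennreal \<bar>U s \<omega>\<bar> \<partial>lborel)"
    by (metis ennreal_abs_set_lebesgue_integral_le)
  also have "\<dots> \<le> E n \<omega>"
    unfolding E_def block_def using n(2) by (intro nn_integral_mono) (auto simp: indicator_def)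
  finally show "ennreal \<bar>(LINT s:{0..t}|lborel. U s \<omega>) - (\<Sum>k<n. D k \<omega>)\<bar> \<le> E n \<omega>" .
qed

text \<open>Union bound and Markov's inequality for squares. The second moments of the
  \<open>E k\<close> add up to at most \<open>\<epsilon> * H\<close>, so the bound does not grow
  with the number of blocks.\<close>

lemma measure_E_exceeds:
  assumes \<eta>: "\<eta> > 0"
  shows "measure M {\<omega>\<in>space M. \<exists>k<N. E k \<omega> > ennreal \<eta>} \<le> \<epsilon> * H / \<eta>\<^sup>2"
proof -
  have "emeasure M {\<omega>\<in>space M. \<exists>k<N. E k \<omega> > ennreal \<eta>} \<le> (\<Sum>k<N. emeasure M {\<omega>\<in>space M. E k \<omega> > ennreal \<eta>})"
  proof -
    have "{\<omega>\<in>space M. \<exists>k<N. E k \<omega> > ennreal \<eta>} = (\<Union>k\<in>{..<N}. {\<omega>\<in>space M. E k \<omega> > ennreal \<eta>})" by auto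
    then show ?thesis by (simp only:) (rule emeasure_subadditive_finite, auto)
  qed
  also have "\<dots> \<le> (\<Sum>k<N. ennreal (1 / \<eta>\<^sup>2) * (ennreal \<epsilon> * h k))"
  proof (rule sum_mono)
    fix k
    have "emeasure M {\<omega>\<in>space M. E k \<omega> > ennreal \<eta>} \<le> emeasure M {\<omega>\<in>space M. 1 \<le> ennreal (1 / \<eta>\<^sup>2) * (E k \<omega>)\<^sup>2}"
    proof (rule emeasure_mono)
      show "{\<omega>\<in>space M. E k \<omega> > ennreal \<eta>} \<subseteq> {\<omega>\<in>space M. 1 \<le> ennreal (1 / \<eta>\<^sup>2) * (E k \<omega>)\<^sup>2}"
      proof safe
        fix \<omega> assume "ennreal \<eta> < E k \<omega>"
        then have "ennreal (1 / \<eta>\<^sup>2) * (ennreal \<eta>)\<^sup>2 \<le> ennreal (1 / \<eta>\<^sup>2) * (E k \<omega>)\<^sup>2"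
          by (intro mult_left_mono power_mono) auto
        then show "1 \<le> ennreal (1 / \<eta>\<^sup>2) * (E k \<omega>)\<^sup>2"
          using \<eta> by (simp add: ennreal_power ennreal_mult[symmetric])
      qed
    qed measurable
    also have "\<dots> \<le> ennreal (1 / \<eta>\<^sup>2) * (\<integral>\<^sup>+\<omega>. (E k \<omega>)\<^sup>2 * indicator (space M) \<omega> \<partial>M)"
      by (rule nn_integral_Markov_inequality) auto
    also have "(\<integral>\<^sup>+\<omega>. (E k \<omega>)\<^sup>2 * indicator (space M) \<omega> \<partial>M) = (\<integral>\<^sup>+\<omega>. (E k \<omega>)\<^sup>2 \<partial>M)"
      by (intro nn_integral_cong) simp
    also have "ennreal (1 / \<eta>\<^sup>2) * \<dots> \<le> ennreal (1 / \<eta>\<^sup>2) * (ennreal \<epsilon> * h k)"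
      by (intro mult_left_mono E_square) auto
    finally show "emeasure M {\<omega>\<in>space M. E k \<omega> > ennreal \<eta>} \<le> ennreal (1 / \<eta>\<^sup>2) * (ennreal \<epsilon> * h k)" .
  qed
  also have "\<dots> = ennreal (1 / \<eta>\<^sup>2) * (ennreal \<epsilon> * (\<Sum>k<N. h k))" by (simp add: sum_distrib_left)
  also have "\<dots> \<le> ennreal (1 / \<eta>\<^sup>2) * (ennreal \<epsilon> * ennreal H)"
    by (intro mult_left_mono sum_h_le) auto
  also have "\<dots> = ennreal (\<epsilon> * H / \<eta>\<^sup>2)" using eps_pos H_nonneg by (simp add: ennreal_mult[symmetric])
  finally show ?thesis using eps_pos H_nonneg by (simp add: emeasure_eq_measure)
qed

text \<open>An even number of blocks, so that both parities receive \<open>N\<close> of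
  them.\<close>

lemma ex_blocks: "\<exists>N. T < \<epsilon> * real (2 * N)"
proof -
  obtain N :: nat where N: "T / \<epsilon> < real N" using reals_Archimedean2 by blast
  then have "T < \<epsilon> * real N" using eps_pos by (simp add: field_simps)
  also have "\<dots> \<le> \<epsilon> * real (2 * N)" using eps_pos by simp
  finally show ?thesis by blast
qed

text \<open>The sums over even blocks and those over odd blocks are martingales; a single block
  contributes at most \<open>E k\<close>.\<close>

lemma maximal_inequality:
  assumes \<eta>: "\<eta> > 0"
  shows "\<exists>A\<in>sets M. {\<omega>\<in>space M. \<exists>t\<in>{0..T}. \<bar>LINT s:{0..t}|lborel. U s \<omega>\<bar> > 3 * \<eta>} \<subseteq> A \<and>
    measure M A \<le> 2 * \<epsilon> * H / \<eta>\<^sup>2"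
proof -
  obtain N where N: "T < \<epsilon> * real (2 * N)" using ex_blocks by blast
  \<comment> \<open>Exceptional sets: \<open>B\<close> for paths without integrability,
    \<open>C 0\<close> and \<open>C 1\<close> for the even and odd martingales, \<open>G\<close> for
    a single large block.\<close>
  obtain B where B: "{\<omega>\<in>space M. \<not> integrable lborel (\<lambda>s. U s \<omega>)} \<subseteq> B" "B \<in> sets M" "emeasure M B = 0"
    using AE_E[OF AE_integrable] by metis
  define C where "C i = {\<omega>\<in>space M. \<exists>n\<le>N. \<bar>\<Sum>k<n. D (2 * k + i) \<omega>\<bar> > \<eta>}" for i
  define G where "G = {\<omega>\<in>space M. \<exists>k<2 * N. E k \<omega> > ennreal \<eta>}"
  have C: "C i \<in> sets M" "measure M (C i) \<le> (\<Sum>k<N. \<integral>\<omega>. (D (2 * k + i) \<omega>)\<^sup>2 \<partial>M) / \<eta>\<^sup>2" for i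
    unfolding C_def by (rule martingale_differences_maximal_inequality[OF D_martingale_differences \<eta>])+
  have G: "G \<in> sets M" "measure M G \<le> \<epsilon> * H / \<eta>\<^sup>2"
    unfolding G_def using measure_E_exceeds[OF \<eta>] by auto
  have "measure M (B \<union> (C 0 \<union> C 1) \<union> G) \<le> measure M B + (measure M (C 0) + measure M (C 1)) + measure M G"
    using C(1) G(1) B(2) by (intro order_trans[OF measure_Un_le] add_mono measure_Un_le order_refl) auto
  also have "measure M B = 0" using B(3) by (simp add: measure_def)
  also have "measure M (C 0) + measure M (C 1) \<le> ((\<Sum>k<N. \<integral>\<omega>. (D (2 * k) \<omega>)\<^sup>2 \<partial>M)
      + (\<Sum>k<N. \<integral>\<omega>. (D (2 * k + 1) \<omega>)\<^sup>2 \<partial>M)) / \<eta>\<^sup>2"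
    using C(2)[of 0] C(2)[of 1] by (simp add: add_divide_distrib)
  \<comment> \<open>Together the two parities use each block once and cost a single
    \<open>\<epsilon> * H / \<eta>\<^sup>2\<close>; the other one comes from
    \<open>G\<close>.\<close>
  also have "\<dots> = (\<Sum>k<2 * N. \<integral>\<omega>. (D k \<omega>)\<^sup>2 \<partial>M) / \<eta>\<^sup>2"
    using sum_even_odd[of "\<lambda>k. \<integral>\<omega>. (D k \<omega>)\<^sup>2 \<partial>M" "2 * N"] by simp
  also have "\<dots> \<le> \<epsilon> * H / \<eta>\<^sup>2" by (intro divide_right_mono sum_D_square_le) auto
  finally have "measure M (B \<union> (C 0 \<union> C 1) \<union> G) \<le> \<epsilon> * H / \<eta>\<^sup>2 + \<epsilon> * H / \<eta>\<^sup>2" using G(2) by linarith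
  also have "\<dots> = 2 * \<epsilon> * H / \<eta>\<^sup>2" by (simp add: field_simps)
  finally have "measure M (B \<union> (C 0 \<union> C 1) \<union> G) \<le> 2 * \<epsilon> * H / \<eta>\<^sup>2" .
  moreover have "{\<omega>\<in>space M. \<exists>t\<in>{0..T}. \<bar>LINT s:{0..t}|lborel. U s \<omega>\<bar> > 3 * \<eta>} \<subseteq> B \<union> (C 0 \<union> C 1) \<union> G"
  proof (rule subsetI, rule ccontr)
    fix \<omega> assume "\<omega> \<in> {\<omega>\<in>space M. \<exists>t\<in>{0..T}. \<bar>LINT s:{0..t}|lborel. U s \<omega>\<bar> > 3 * \<eta>}"
      and nin: "\<omega> \<notin> B \<union> (C 0 \<union> C 1) \<union> G"
    then obtain t where \<omega>: "\<omega> \<in> space M" and t: "0 \<le> t" "t \<le> T"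
      and big: "\<bar>LINT s:{0..t}|lborel. U s \<omega>\<bar> > 3 * \<eta>" by auto
    have "integrable lborel (\<lambda>s. U s \<omega>)" using nin B \<omega> by auto
    then obtain n where n: "\<epsilon> * real n \<le> t"
        "ennreal \<bar>(LINT s:{0..t}|lborel. U s \<omega>) - (\<Sum>k<n. D k \<omega>)\<bar> \<le> E n \<omega>"
      using integral_upto_bound t by blast
    have "\<epsilon> * real n < \<epsilon> * real (2 * N)" using n(1) t N by linarith
    then have nN: "n < 2 * N" using eps_pos by (simp only: mult_less_cancel_left_pos of_nat_less_iff)
    have even: "\<bar>\<Sum>k<m. D (2 * k) \<omega>\<bar> \<le> \<eta>" and odd: "\<bar>\<Sum>k<m. D (2 * k + 1) \<omega>\<bar> \<le> \<eta>" if "m \<le> N" for m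
      using nin \<omega> that unfolding C_def by force+
    have "E n \<omega> \<le> ennreal \<eta>" using nin \<omega> nN unfolding G_def by (force simp: not_less)
    then have "\<bar>(LINT s:{0..t}|lborel. U s \<omega>) - (\<Sum>k<n. D k \<omega>)\<bar> \<le> \<eta>"
      using n(2) \<eta> by (meson ennreal_le_iff less_imp_le order_trans)
    moreover have "\<bar>\<Sum>k<(n + 1) div 2. D (2 * k) \<omega>\<bar> \<le> \<eta>" by (rule even) (use nN in simp)
    moreover have "\<bar>\<Sum>k<n div 2. D (2 * k + 1) \<omega>\<bar> \<le> \<eta>" by (rule odd) (use nN in simp)
    \<comment> \<open>Even sum, odd sum and unfinished block are each at most \<eta>, whence the
      threshold \<open>3 * \<eta>\<close>.\<close>
    ultimately show False
      using big sum_even_odd[of "\<lambda>k. D k \<omega>" n] by linarith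
  qed
  moreover have "B \<union> (C 0 \<union> C 1) \<union> G \<in> sets M" using B C G by auto
  ultimately show ?thesis by blast
qed

text \<open>The factor 2 comes from
  \<open>(a + b)\<^sup>2 \<le> 2 * a\<^sup>2 + 2 * b\<^sup>2\<close> for the even and the odd sum;
  within one parity orthogonality is exact.\<close>

lemma square_bound:
  "(\<integral>\<^sup>+\<omega>. ennreal ((LINT s:{0..T}|lborel. U s \<omega>)\<^sup>2) \<partial>M) \<le> ennreal (2 * \<epsilon> * H)"
proof -
  obtain N where N: "T < \<epsilon> * real (2 * N)" using ex_blocks by blast
  define S where "S i \<omega> = (\<Sum>k<N. D (2 * k + i) \<omega>)" for i \<omega>
  have Si: "integrable M (\<lambda>\<omega>. (S i \<omega>)\<^sup>2)"
    and Se: "(\<integral>\<omega>. (S i \<omega>)\<^sup>2 \<partial>M) = (\<Sum>k<N. \<integral>\<omega>. (D (2 * k + i) \<omega>)\<^sup>2 \<partial>M)" for i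
    unfolding S_def by (rule martingale_differences_integral_square[OF D_martingale_differences])+
  have "(\<integral>\<^sup>+\<omega>. ennreal ((LINT s:{0..T}|lborel. U s \<omega>)\<^sup>2) \<partial>M)
      \<le> (\<integral>\<^sup>+\<omega>. ennreal (2 * (S 0 \<omega>)\<^sup>2 + 2 * (S 1 \<omega>)\<^sup>2) \<partial>M)"
  proof (rule nn_integral_mono_AE)
    show "AE \<omega> in M. ennreal ((LINT s:{0..T}|lborel. U s \<omega>)\<^sup>2) \<le> ennreal (2 * (S 0 \<omega>)\<^sup>2 + 2 * (S 1 \<omega>)\<^sup>2)"
      using AE_integrable
    proof eventually_elim
      case (elim \<omega>)
      \<comment> \<open>\<open>U\<close> vanishes after \<open>T\<close>, so the integral may run
        over complete blocks.\<close>
      have "(LINT s:{0..T}|lborel. U s \<omega>) = (LINT s:{0..<\<epsilon> * real (2 * N)}|lborel. U s \<omega>)"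
        unfolding set_lebesgue_integral_def
        by (intro Bochner_Integration.integral_cong) (use N U_zero in \<open>auto simp: indicator_def\<close>)
      also have "\<dots> = (\<Sum>k<2 * N. D k \<omega>)" by (rule integral_blocks[OF elim])
      also have "\<dots> = S 0 \<omega> + S 1 \<omega>"
        using sum_even_odd[of "\<lambda>k. D k \<omega>" "2 * N"] by (simp add: S_def)
      finally have "(LINT s:{0..T}|lborel. U s \<omega>)\<^sup>2 \<le> 2 * (S 0 \<omega>)\<^sup>2 + 2 * (S 1 \<omega>)\<^sup>2"
        using sum_squares_bound[of "S 0 \<omega>" "S 1 \<omega>"] by (simp add: power2_sum)
      then show ?case by (rule ennreal_leI)
    qed
  qed
  also have "\<dots> = ennreal (\<integral>\<omega>. 2 * (S 0 \<omega>)\<^sup>2 + 2 * (S 1 \<omega>)\<^sup>2 \<partial>M)"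
  proof (rule nn_integral_eq_integral)
    show "integrable M (\<lambda>\<omega>. 2 * (S 0 \<omega>)\<^sup>2 + 2 * (S 1 \<omega>)\<^sup>2)"
      by (intro Bochner_Integration.integrable_add integrable_mult_right Si)
  qed auto
  also have "(\<integral>\<omega>. 2 * (S 0 \<omega>)\<^sup>2 + 2 * (S 1 \<omega>)\<^sup>2 \<partial>M) = 2 * (\<integral>\<omega>. (S 0 \<omega>)\<^sup>2 \<partial>M) + 2 * (\<integral>\<omega>. (S 1 \<omega>)\<^sup>2 \<partial>M)"
    by (simp add: Si)
  also have "\<dots> = 2 * (\<Sum>k<2 * N. \<integral>\<omega>. (D k \<omega>)\<^sup>2 \<partial>M)"
    unfolding Se sum_even_odd[of "\<lambda>k. \<integral>\<omega>. (D k \<omega>)\<^sup>2 \<partial>M" "2 * N"] by simp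
  also have "ennreal \<dots> \<le> ennreal (2 * \<epsilon> * H)"
  proof (rule ennreal_leI)
    have "(\<Sum>k<2 * N. \<integral>\<omega>. (D k \<omega>)\<^sup>2 \<partial>M) \<le> \<epsilon> * H" by (rule sum_D_square_le) simp
    then show "2 * (\<Sum>k<2 * N. \<integral>\<omega>. (D k \<omega>)\<^sup>2 \<partial>M) \<le> 2 * \<epsilon> * H" by linarith
  qed
  finally show ?thesis .
qed

end

section \<open>Forward approximations\<close>

text \<open>Time is rounded down to multiples of \<open>1 / (n + 1)\<close>: only countably many
  variables \<open>Z u\<close> occur, which gives joint measurability, and continuity of the paths
  gives the limit.\<close>

lemma borel_measurable_continuous_process:
  fixes Z :: "real \<Rightarrow> 'a \<Rightarrow> real"
  assumes Z: "\<And>u. Z u \<in> borel_measurable N"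
    and cont: "\<And>\<omega>. \<omega> \<in> space N \<Longrightarrow> continuous_on UNIV (\<lambda>u. Z u \<omega>)"
  shows "(\<lambda>(s, \<omega>). Z s \<omega>) \<in> borel_measurable (borel \<Otimes>\<^sub>M N)"
proof (rule borel_measurable_LIMSEQ_metric)
  define g :: "nat \<Rightarrow> real \<Rightarrow> real" where "g n s = of_int \<lfloor>real (Suc n) * s\<rfloor> / real (Suc n)" for n s
  show "(\<lambda>p. Z (g n (fst p)) (snd p)) \<in> borel_measurable (borel \<Otimes>\<^sub>M N)" for n
    unfolding g_def
    by (rule measurable_compose_countable[where f="\<lambda>i p. Z (of_int i / real (Suc n)) (snd p)"
          and g="\<lambda>p. \<lfloor>real (Suc n) * fst p\<rfloor>"]) (auto intro!: measurable_compose[OF measurable_snd Z])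
  fix p :: "real \<times> 'a" assume "p \<in> space (borel \<Otimes>\<^sub>M N)"
  then have p: "snd p \<in> space N" by (auto simp: space_pair_measure)
  have "(\<lambda>n. g n (fst p)) \<longlonglongrightarrow> fst p"
  proof (rule LIMSEQ_I)
    fix r :: real assume "r > 0"
    then obtain n0 where n0: "inverse (real (Suc n0)) < r" using reals_Archimedean by blast
    have "norm (g n (fst p) - fst p) < r" if "n \<ge> n0" for n
    proof -
      have "\<bar>of_int \<lfloor>real (Suc n) * fst p\<rfloor> - real (Suc n) * fst p\<bar> \<le> 1" by linarith
      moreover have "g n (fst p) - fst p = (of_int \<lfloor>real (Suc n) * fst p\<rfloor> - real (Suc n) * fst p) / real (Suc n)"
        unfolding g_def diff_divide_distrib by simp
      ultimately have "\<bar>g n (fst p) - fst p\<bar> \<le> inverse (real (Suc n))"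
        by (simp add: divide_right_mono inverse_eq_divide del: of_nat_Suc)
      also have "\<dots> \<le> inverse (real (Suc n0))" using that by (simp add: field_simps)
      finally show ?thesis using n0 by simp
    qed
    then show "\<exists>no. \<forall>n\<ge>no. norm (g n (fst p) - fst p) < r" by blast
  qed
  moreover have "isCont (\<lambda>u. Z u (snd p)) (fst p)"
    using cont[OF p] by (simp add: continuous_on_eq_continuous_at)
  ultimately show "(\<lambda>n. Z (g n (fst p)) (snd p)) \<longlonglongrightarrow> (case p of (s, \<omega>) \<Rightarrow> Z s \<omega>)"
    using isCont_tendsto_compose by (fastforce simp: case_prod_beta')
qed

section \<open>Progressive processes and their energy\<close>

context filtered_prob_space
begin

text \<open>The indicator expresses measurability on \<open>{0..b}\<close> inside the full product
  space, so that no restricted measure spaces arise.\<close>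

definition progressive :: "real \<Rightarrow> (real \<Rightarrow> 'a \<Rightarrow> real) \<Rightarrow> bool" where
  "progressive T Y \<longleftrightarrow>
    (\<forall>b\<in>{0..T}. (\<lambda>(s, \<omega>). indicator {0..b} s * Y s \<omega>) \<in> borel_measurable (borel \<Otimes>\<^sub>M F b))"

text \<open>The squared \<open>L\<^sup>2\<close> norm over time and probability, as an iterated
  integral with extended values: it makes sense before any integrability is known and has the order
  of integration used in \<open>U_square\<close>.\<close>

definition energy :: "real \<Rightarrow> (real \<Rightarrow> 'a \<Rightarrow> real) \<Rightarrow> ennreal" where
  "energy T Y = (\<integral>\<^sup>+s. indicator {0..T} s * (\<integral>\<^sup>+\<omega>. ennreal ((Y s \<omega>)\<^sup>2) \<partial>M) \<partial>lborel)"

lemma progressive_measurable: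
  assumes "progressive T Y" "0 \<le> T"
  shows "(\<lambda>(s, \<omega>). indicator {0..T} s * Y s \<omega>) \<in> borel_measurable (borel \<Otimes>\<^sub>M M)"
  using assms unfolding progressive_def by (intro filtration_pair_measurable[of _ _ T]) auto

lemma progressive_adapted:
  assumes Y: "progressive T Y" and s: "0 \<le> s" "s \<le> T"
  shows "Y s \<in> borel_measurable (F s)"
proof -
  have "(\<lambda>(s', \<omega>). indicator {0..s} s' * Y s' \<omega>) \<in> borel_measurable (borel \<Otimes>\<^sub>M F s)"
    using Y s unfolding progressive_def by auto
  moreover have "(\<lambda>\<omega>. (s, \<omega>)) \<in> measurable (F s) (borel \<Otimes>\<^sub>M F s)" by measurable
  ultimately have "(\<lambda>\<omega>. indicator {0..s} s * Y s \<omega>) \<in> borel_measurable (F s)"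
    using measurable_compose by fastforce
  then show ?thesis using s by simp
qed

lemma progressive_diff:
  assumes "progressive T Y" "progressive T Z"
  shows "progressive T (\<lambda>s \<omega>. Y s \<omega> - Z s \<omega>)"
  unfolding progressive_def
proof
  fix b assume "b \<in> {0..T}"
  then have "(\<lambda>(s, \<omega>). indicator {0..b} s * Y s \<omega>) \<in> borel_measurable (borel \<Otimes>\<^sub>M F b)"
    "(\<lambda>(s, \<omega>). indicator {0..b} s * Z s \<omega>) \<in> borel_measurable (borel \<Otimes>\<^sub>M F b)"
    using assms unfolding progressive_def by auto
  from borel_measurable_diff[OF this]
  show "(\<lambda>(s, \<omega>). indicator {0..b} s * (Y s \<omega> - Z s \<omega>)) \<in> borel_measurable (borel \<Otimes>\<^sub>M F b)"
    by (simp add: case_prod_beta' right_diff_distrib)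
qed

lemma progressive_sum:
  assumes "\<And>i. i \<in> I \<Longrightarrow> progressive T (Y i)"
  shows "progressive T (\<lambda>s \<omega>. \<Sum>i\<in>I. Y i s \<omega>)"
  unfolding progressive_def
proof
  fix b assume "b \<in> {0..T}"
  then have "(\<lambda>(s, \<omega>). indicator {0..b} s * Y i s \<omega>) \<in> borel_measurable (borel \<Otimes>\<^sub>M F b)" if "i \<in> I" for i
    using assms that unfolding progressive_def by auto
  then have "(\<lambda>p. \<Sum>i\<in>I. case p of (s, \<omega>) \<Rightarrow> indicator {0..b} s * Y i s \<omega>) \<in> borel_measurable (borel \<Otimes>\<^sub>M F b)"
    by (intro borel_measurable_sum) auto
  then show "(\<lambda>(s, \<omega>). indicator {0..b} s * (\<Sum>i\<in>I. Y i s \<omega>)) \<in> borel_measurable (borel \<Otimes>\<^sub>M F b)"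
    by (simp add: case_prod_beta' sum_distrib_left)
qed

end

section \<open>Integrators with orthonormal increments\<close>

text \<open>What is kept of Brownian motion is adaptedness, continuity of every path and the
  conditional first and second moments of increments, tested against integrable weights.
  Independence and normal laws enter when such a family is constructed from
  \<open>W\<close>.\<close>

locale orthonormal_family = filtered_prob_space +
  fixes X :: "'i \<Rightarrow> real \<Rightarrow> 'a \<Rightarrow> real" and J :: "'i set"
  assumes adapted: "j \<in> J \<Longrightarrow> 0 \<le> t \<Longrightarrow> X j t \<in> borel_measurable (F t)"
    and continuous: "j \<in> J \<Longrightarrow> \<omega> \<in> space M \<Longrightarrow> continuous_on {0..} (\<lambda>t. X j t \<omega>)"
    and increment_centred: "j \<in> J \<Longrightarrow> 0 \<le> s \<Longrightarrow> s \<le> t \<Longrightarrow> Z \<in> borel_measurable (F s) \<Longrightarrow> integrable M Z \<Longrightarrow>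
      has_bochner_integral M (\<lambda>\<omega>. Z \<omega> * (X j t \<omega> - X j s \<omega>)) 0"
    and increment_covariance: "i \<in> J \<Longrightarrow> j \<in> J \<Longrightarrow> 0 \<le> s \<Longrightarrow> s \<le> t \<Longrightarrow> Z \<in> borel_measurable (F s) \<Longrightarrow>
      integrable M Z \<Longrightarrow> has_bochner_integral M (\<lambda>\<omega>. Z \<omega> * ((X i t \<omega> - X i s \<omega>) * (X j t \<omega> - X j s \<omega>)))
        (if i = j then (t - s) * (\<integral>\<omega>. Z \<omega> \<partial>M) else 0)"
begin

definition difference_integrand :: "'i set \<Rightarrow> ('i \<Rightarrow> real \<Rightarrow> 'a \<Rightarrow> real) \<Rightarrow> real \<Rightarrow> real \<Rightarrow> real \<Rightarrow> 'a \<Rightarrow> real" where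
  "difference_integrand K Y \<epsilon> T s \<omega> =
    indicator {0..T} s * (\<Sum>j\<in>K. Y j s \<omega> * ((X j (s + \<epsilon>) \<omega> - X j s \<omega>) / \<epsilon>))"

text \<open>Clamping the time to \<open>{0..b}\<close> makes each variable known at time
  \<open>b\<close> and each path continuous on the whole line, as joint measurability
  requires.\<close>

lemma clamped_measurable:
  assumes j: "j \<in> J" and b: "0 \<le> b"
  shows "(\<lambda>(s, \<omega>). X j (max 0 (min b s)) \<omega>) \<in> borel_measurable (borel \<Otimes>\<^sub>M F b)"
proof (rule borel_measurable_continuous_process)
  show "X j (max 0 (min b u)) \<in> borel_measurable (F b)" for u
    using filtration_measurable_mono[OF adapted[OF j, of "max 0 (min b u)"]] b by simp
  fix \<omega> assume "\<omega> \<in> space (F b)"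
  then show "continuous_on UNIV (\<lambda>u. X j (max 0 (min b u)) \<omega>)"
    by (intro continuous_on_compose2[OF continuous[OF j]] continuous_intros) auto
qed

text \<open>For \<open>s \<le> b\<close> both \<open>s\<close> and \<open>s + \<epsilon>\<close> are
  at most \<open>b + \<epsilon>\<close>, so replacing \<open>X\<close> by its version clamped at
  that time changes nothing.\<close>

lemma difference_integrand_measurable:
  assumes K: "K \<subseteq> J" and Y: "\<And>j. j \<in> K \<Longrightarrow> progressive T (Y j)" and \<epsilon>: "\<epsilon> > 0" and T: "T > 0" and b: "0 \<le> b"
  shows "(\<lambda>(s, \<omega>). indicator {..b} s * difference_integrand K Y \<epsilon> T s \<omega>) \<in> borel_measurable (borel \<Otimes>\<^sub>M F (b + \<epsilon>))"
proof -
  \<comment> \<open>\<open>Y\<close> is progressive up to \<open>T\<close> only, while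
    \<open>b\<close> may be larger; beyond \<open>T\<close> the integrand is 0.\<close>
  define c where "c = min b T"
  have c: "0 \<le> c" "c \<le> T" "c \<le> b + \<epsilon>" using b T \<epsilon> by (auto simp: c_def)
  have "(\<lambda>p. (indicator {0..c} (fst p) * Y j (fst p) (snd p)) *
      ((X j (max 0 (min (b + \<epsilon>) (fst p + \<epsilon>))) (snd p) - X j (max 0 (min (b + \<epsilon>) (fst p))) (snd p)) / \<epsilon>))
      \<in> borel_measurable (borel \<Otimes>\<^sub>M F (b + \<epsilon>))" if j: "j \<in> K" for j
  proof (rule borel_measurable_times)
    have Yc: "(\<lambda>(s, \<omega>). indicator {0..c} s * Y j s \<omega>) \<in> borel_measurable (borel \<Otimes>\<^sub>M F c)"
      using Y[OF j] c unfolding progressive_def by auto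
    have "(\<lambda>x. x) \<in> measurable (F (b + \<epsilon>)) (F c)"
      by (rule filtration_measurable_mono[of _ c]) (use c in simp_all)
    then have "(\<lambda>p. (fst p, snd p)) \<in> measurable (borel \<Otimes>\<^sub>M F (b + \<epsilon>)) (borel \<Otimes>\<^sub>M F c)"
      by (intro measurable_Pair measurable_fst measurable_compose[OF measurable_snd])
    from measurable_compose[OF this Yc]
    show "(\<lambda>p. indicator {0..c} (fst p) * Y j (fst p) (snd p)) \<in> borel_measurable (borel \<Otimes>\<^sub>M F (b + \<epsilon>))"
      by simp
    have X: "(\<lambda>(s, \<omega>). X j (max 0 (min (b + \<epsilon>) s)) \<omega>) \<in> borel_measurable (borel \<Otimes>\<^sub>M F (b + \<epsilon>))"
      using clamped_measurable[of j "b + \<epsilon>"] j K b \<epsilon> by auto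
    then have X0: "(\<lambda>p. X j (max 0 (min (b + \<epsilon>) (fst p))) (snd p)) \<in> borel_measurable (borel \<Otimes>\<^sub>M F (b + \<epsilon>))"
      by (simp add: case_prod_beta')
    have "(\<lambda>p. (fst p + \<epsilon>, snd p)) \<in> measurable (borel \<Otimes>\<^sub>M F (b + \<epsilon>)) (borel \<Otimes>\<^sub>M F (b + \<epsilon>))" by measurable
    from measurable_compose[OF this X]
    have X1: "(\<lambda>p. X j (max 0 (min (b + \<epsilon>) (fst p + \<epsilon>))) (snd p)) \<in> borel_measurable (borel \<Otimes>\<^sub>M F (b + \<epsilon>))"
      by simp
    show "(\<lambda>p. (X j (max 0 (min (b + \<epsilon>) (fst p + \<epsilon>))) (snd p) - X j (max 0 (min (b + \<epsilon>) (fst p))) (snd p)) / \<epsilon>)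
        \<in> borel_measurable (borel \<Otimes>\<^sub>M F (b + \<epsilon>))"
      by (intro borel_measurable_divide borel_measurable_diff borel_measurable_const X0 X1)
  qed
  then have "(\<lambda>p. \<Sum>j\<in>K. (indicator {0..c} (fst p) * Y j (fst p) (snd p)) *
      ((X j (max 0 (min (b + \<epsilon>) (fst p + \<epsilon>))) (snd p) - X j (max 0 (min (b + \<epsilon>) (fst p))) (snd p)) / \<epsilon>))
      \<in> borel_measurable (borel \<Otimes>\<^sub>M F (b + \<epsilon>))"
    by (rule borel_measurable_sum)
  also have "(\<lambda>p. \<Sum>j\<in>K. (indicator {0..c} (fst p) * Y j (fst p) (snd p)) *
      ((X j (max 0 (min (b + \<epsilon>) (fst p + \<epsilon>))) (snd p) - X j (max 0 (min (b + \<epsilon>) (fst p))) (snd p)) / \<epsilon>))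
    = (\<lambda>(s, \<omega>). indicator {..b} s * difference_integrand K Y \<epsilon> T s \<omega>)"
  proof (rule ext, clarify)
    fix s \<omega>
    show "(\<Sum>j\<in>K. (indicator {0..c} (fst (s, \<omega>)) * Y j (fst (s, \<omega>)) (snd (s, \<omega>))) *
      ((X j (max 0 (min (b + \<epsilon>) (fst (s, \<omega>) + \<epsilon>))) (snd (s, \<omega>)) - X j (max 0 (min (b + \<epsilon>) (fst (s, \<omega>)))) (snd (s, \<omega>))) / \<epsilon>))
      = indicator {..b} s * difference_integrand K Y \<epsilon> T s \<omega>"
    proof (cases "s \<in> {0..c}")
      case True
      then show ?thesis using \<epsilon> by (simp add: difference_integrand_def c_def)
    next
      case False
      then have "indicator {..b} s * indicator {0..T} s = (0::real)" by (auto simp: c_def indicator_def)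
      then show ?thesis using False by (auto simp: difference_integrand_def)
    qed
  qed
  finally show ?thesis .
qed

text \<open>Expanding the square leaves only the diagonal, because increments of different
  coordinates are conditionally uncorrelated. A diagonal term carries the variance \<epsilon>
  divided by the square of \<epsilon>.\<close>

lemma difference_integrand_square:
  assumes K: "finite K" "K \<subseteq> J" and Y: "\<And>j. j \<in> K \<Longrightarrow> progressive T (Y j)" and \<epsilon>: "\<epsilon> > 0"
    and s: "0 \<le> s" "s \<le> T"
  shows "(\<integral>\<^sup>+\<omega>. ennreal ((difference_integrand K Y \<epsilon> T s \<omega>)\<^sup>2) \<partial>M)
    \<le> ennreal (1 / \<epsilon>) * (\<Sum>j\<in>K. \<integral>\<^sup>+\<omega>. ennreal ((Y j s \<omega>)\<^sup>2) \<partial>M)"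
proof (cases "\<forall>j\<in>K. (\<integral>\<^sup>+\<omega>. ennreal ((Y j s \<omega>)\<^sup>2) \<partial>M) < \<infinity>")
  \<comment> \<open>If some \<open>Y j s\<close> is not square-integrable the right side is
    infinite. Otherwise products of two coordinates are integrable and may serve as weights.\<close>
  case False
  then have "(\<Sum>j\<in>K. \<integral>\<^sup>+\<omega>. ennreal ((Y j s \<omega>)\<^sup>2) \<partial>M) = \<infinity>"
    using K(1) by (auto simp: less_top[symmetric])
  then show ?thesis using \<epsilon> by (simp add: ennreal_mult_top)
next
  case True
  define d where "d j \<omega> = X j (s + \<epsilon>) \<omega> - X j s \<omega>" for j \<omega>
  have Ym: "Y j s \<in> borel_measurable (F s)" if "j \<in> K" for j
    by (rule progressive_adapted[OF Y[OF that] s])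
  have YM: "Y j s \<in> borel_measurable M" if "j \<in> K" for j
    by (rule filtration_measurable[OF Ym[OF that]])
  have Yi: "integrable M (\<lambda>\<omega>. (Y j s \<omega>)\<^sup>2)" if "j \<in> K" for j
    using True that YM[OF that] by (auto simp: integrable_iff_bounded)
  have YY: "integrable M (\<lambda>\<omega>. Y i s \<omega> * Y j s \<omega>)" if "i \<in> K" "j \<in> K" for i j
    using that YM Yi by (intro integrable_mult_of_squares) auto
  have ij: "has_bochner_integral M (\<lambda>\<omega>. (Y i s \<omega> * Y j s \<omega>) * (d i \<omega> * d j \<omega>))
      (if i = j then \<epsilon> * (\<integral>\<omega>. (Y j s \<omega>)\<^sup>2 \<partial>M) else 0)" if "i \<in> K" "j \<in> K" for i j
  proof -
    have "i \<in> J" "j \<in> J" using that K(2) by auto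
    then show ?thesis
      using increment_covariance[of i j s "s + \<epsilon>" "\<lambda>\<omega>. Y i s \<omega> * Y j s \<omega>"] s \<epsilon>
        borel_measurable_times[OF Ym[OF that(1)] Ym[OF that(2)]] YY[OF that]
      by (cases "i = j") (simp_all add: d_def power2_eq_square)
  qed
  have "has_bochner_integral M (\<lambda>\<omega>. (\<Sum>i\<in>K. \<Sum>j\<in>K. (Y i s \<omega> * Y j s \<omega>) * (d i \<omega> * d j \<omega>)))
      (\<Sum>i\<in>K. \<Sum>j\<in>K. if i = j then \<epsilon> * (\<integral>\<omega>. (Y j s \<omega>)\<^sup>2 \<partial>M) else 0)"
    by (intro has_bochner_integral_sum ij)
  then have "has_bochner_integral M (\<lambda>\<omega>. (1 / \<epsilon>\<^sup>2) * (\<Sum>i\<in>K. \<Sum>j\<in>K. (Y i s \<omega> * Y j s \<omega>) * (d i \<omega> * d j \<omega>)))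
      ((1 / \<epsilon>\<^sup>2) * (\<Sum>i\<in>K. \<Sum>j\<in>K. if i = j then \<epsilon> * (\<integral>\<omega>. (Y j s \<omega>)\<^sup>2 \<partial>M) else 0))"
    by (intro has_bochner_integral_mult_right)
  also have "(\<lambda>\<omega>. (1 / \<epsilon>\<^sup>2) * (\<Sum>i\<in>K. \<Sum>j\<in>K. (Y i s \<omega> * Y j s \<omega>) * (d i \<omega> * d j \<omega>)))
      = (\<lambda>\<omega>. (difference_integrand K Y \<epsilon> T s \<omega>)\<^sup>2)"
  proof
    fix \<omega>
    have "(difference_integrand K Y \<epsilon> T s \<omega>)\<^sup>2 = (\<Sum>i\<in>K. \<Sum>j\<in>K. (Y i s \<omega> * (d i \<omega> / \<epsilon>)) * (Y j s \<omega> * (d j \<omega> / \<epsilon>)))"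
      using s by (simp only: power2_eq_square sum_product[symmetric]) (simp add: difference_integrand_def d_def)
    also have "\<dots> = (\<Sum>i\<in>K. \<Sum>j\<in>K. (1 / \<epsilon>\<^sup>2) * ((Y i s \<omega> * Y j s \<omega>) * (d i \<omega> * d j \<omega>)))"
      using \<epsilon> by (intro sum.cong refl) (simp add: field_simps power2_eq_square)
    finally show "(1 / \<epsilon>\<^sup>2) * (\<Sum>i\<in>K. \<Sum>j\<in>K. (Y i s \<omega> * Y j s \<omega>) * (d i \<omega> * d j \<omega>)) = (difference_integrand K Y \<epsilon> T s \<omega>)\<^sup>2"
      by (simp only: sum_distrib_left)
  qed
  also have "(1 / \<epsilon>\<^sup>2) * (\<Sum>i\<in>K. \<Sum>j\<in>K. if i = j then \<epsilon> * (\<integral>\<omega>. (Y j s \<omega>)\<^sup>2 \<partial>M) else 0)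
      = (1 / \<epsilon>) * (\<Sum>j\<in>K. (\<integral>\<omega>. (Y j s \<omega>)\<^sup>2 \<partial>M))"
    using K(1) \<epsilon> by (simp add: sum.delta' sum_distrib_left power2_eq_square)
  finally have hb: "has_bochner_integral M (\<lambda>\<omega>. (difference_integrand K Y \<epsilon> T s \<omega>)\<^sup>2)
      ((1 / \<epsilon>) * (\<Sum>j\<in>K. (\<integral>\<omega>. (Y j s \<omega>)\<^sup>2 \<partial>M)))" .
  then have "(\<integral>\<^sup>+\<omega>. ennreal ((difference_integrand K Y \<epsilon> T s \<omega>)\<^sup>2) \<partial>M)
      = ennreal ((1 / \<epsilon>) * (\<Sum>j\<in>K. (\<integral>\<omega>. (Y j s \<omega>)\<^sup>2 \<partial>M)))"
    by (simp add: has_bochner_integral_iff nn_integral_eq_integral)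
  also have "\<dots> = ennreal (1 / \<epsilon>) * (\<Sum>j\<in>K. \<integral>\<^sup>+\<omega>. ennreal ((Y j s \<omega>)\<^sup>2) \<partial>M)"
    using \<epsilon> Yi by (simp add: ennreal_mult sum_nonneg nn_integral_eq_integral sum_ennreal del: times_divide_eq_left)
  finally show ?thesis by simp
qed

text \<open>The estimate at fixed time, integrated over time, turns the energy bound
  \<open>H\<close> into \<open>H / \<epsilon>\<close>. Centring can be asserted for almost every
  \<open>s\<close>, namely where all coordinates are square-integrable at time
  \<open>s\<close>.\<close>

lemma difference_integrand_delayed:
  assumes K: "finite K" "K \<subseteq> J" and Y: "\<And>j. j \<in> K \<Longrightarrow> progressive T (Y j)"
    and E: "(\<Sum>j\<in>K. energy T (Y j)) \<le> ennreal H" and H: "H \<ge> 0" and \<epsilon>: "\<epsilon> > 0" and T: "T > 0"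
  shows "delayed_integrand M F (difference_integrand K Y \<epsilon> T) \<epsilon> T (H / \<epsilon>)"
proof unfold_locales
  show "(\<integral>\<^sup>+s. \<integral>\<^sup>+\<omega>. ennreal ((difference_integrand K Y \<epsilon> T s \<omega>)\<^sup>2) \<partial>M \<partial>lborel) \<le> ennreal (H / \<epsilon>)"
  proof -
    have Ym: "(\<lambda>s. indicator {0..T} s * (\<integral>\<^sup>+\<omega>. ennreal ((Y j s \<omega>)\<^sup>2) \<partial>M)) \<in> borel_measurable lborel" if "j \<in> K" for j
    proof -
      have [measurable]: "(\<lambda>(s, \<omega>). indicator {0..T} s * Y j s \<omega>) \<in> borel_measurable (borel \<Otimes>\<^sub>M M)"
        using progressive_measurable[OF Y[OF that]] T by simp
      have "(\<lambda>s. \<integral>\<^sup>+\<omega>. ennreal ((indicator {0..T} s * Y j s \<omega>)\<^sup>2) \<partial>M) \<in> borel_measurable lborel"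
        by measurable
      also have "(\<lambda>s. \<integral>\<^sup>+\<omega>. ennreal ((indicator {0..T} s * Y j s \<omega>)\<^sup>2) \<partial>M) = (\<lambda>s. indicator {0..T} s * (\<integral>\<^sup>+\<omega>. ennreal ((Y j s \<omega>)\<^sup>2) \<partial>M))"
        by (auto simp: fun_eq_iff indicator_def)
      finally show ?thesis .
    qed
    have "(\<integral>\<^sup>+s. \<integral>\<^sup>+\<omega>. ennreal ((difference_integrand K Y \<epsilon> T s \<omega>)\<^sup>2) \<partial>M \<partial>lborel)
        \<le> (\<integral>\<^sup>+s. ennreal (1 / \<epsilon>) * (\<Sum>j\<in>K. indicator {0..T} s * (\<integral>\<^sup>+\<omega>. ennreal ((Y j s \<omega>)\<^sup>2) \<partial>M)) \<partial>lborel)"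
    proof (rule nn_integral_mono)
      fix s
      show "(\<integral>\<^sup>+\<omega>. ennreal ((difference_integrand K Y \<epsilon> T s \<omega>)\<^sup>2) \<partial>M)
        \<le> ennreal (1 / \<epsilon>) * (\<Sum>j\<in>K. indicator {0..T} s * (\<integral>\<^sup>+\<omega>. ennreal ((Y j s \<omega>)\<^sup>2) \<partial>M))"
        using difference_integrand_square[OF K Y \<epsilon>, where s=s]
        by (cases "s \<in> {0..T}") (auto simp: difference_integrand_def)
    qed
    also have "\<dots> = ennreal (1 / \<epsilon>) * (\<Sum>j\<in>K. energy T (Y j))"
      using Ym by (simp add: nn_integral_cmult nn_integral_sum energy_def)
    also have "\<dots> \<le> ennreal (1 / \<epsilon>) * ennreal H" by (intro mult_left_mono E) auto
    also have "\<dots> = ennreal (H / \<epsilon>)" using \<epsilon> H by (simp add: ennreal_mult[symmetric])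
    finally show ?thesis .
  qed
  \<comment> \<open>Finite energy makes every coordinate square-integrable at almost every time; at
    such times its product with \<open>Z\<close> is an admissible weight.\<close>
  have "AE s in lborel. \<forall>j\<in>K. indicator {0..T} s * (\<integral>\<^sup>+\<omega>. ennreal ((Y j s \<omega>)\<^sup>2) \<partial>M) \<noteq> \<infinity>"
  proof (rule AE_finite_allI[OF K(1)])
    fix j assume j: "j \<in> K"
    have [measurable]: "(\<lambda>(s, \<omega>). indicator {0..T} s * Y j s \<omega>) \<in> borel_measurable (borel \<Otimes>\<^sub>M M)"
      using progressive_measurable[OF Y[OF j]] T by simp
    have "(\<lambda>s. \<integral>\<^sup>+\<omega>. ennreal ((indicator {0..T} s * Y j s \<omega>)\<^sup>2) \<partial>M) \<in> borel_measurable lborel"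
      by measurable
    also have "(\<lambda>s. \<integral>\<^sup>+\<omega>. ennreal ((indicator {0..T} s * Y j s \<omega>)\<^sup>2) \<partial>M) = (\<lambda>s. indicator {0..T} s * (\<integral>\<^sup>+\<omega>. ennreal ((Y j s \<omega>)\<^sup>2) \<partial>M))"
      by (auto simp: fun_eq_iff indicator_def)
    finally have m: "(\<lambda>s. indicator {0..T} s * (\<integral>\<^sup>+\<omega>. ennreal ((Y j s \<omega>)\<^sup>2) \<partial>M)) \<in> borel_measurable lborel" .
    have "energy T (Y j) \<le> (\<Sum>j\<in>K. energy T (Y j))" using j K(1) by (intro member_le_sum) auto
    then have "energy T (Y j) < \<infinity>" using E by (metis ennreal_less_top infinity_ennreal_def le_less_trans)
    then show "AE s in lborel. indicator {0..T} s * (\<integral>\<^sup>+\<omega>. ennreal ((Y j s \<omega>)\<^sup>2) \<partial>M) \<noteq> \<infinity>"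
      unfolding energy_def by (intro nn_integral_PInf_AE m) (simp add: less_top)
  qed
  then show "AE s in lborel. 0 \<le> s \<longrightarrow> (\<forall>Z\<in>borel_measurable (F s). integrable M (\<lambda>\<omega>. (Z \<omega>)\<^sup>2) \<longrightarrow>
      (\<integral>\<omega>. Z \<omega> * difference_integrand K Y \<epsilon> T s \<omega> \<partial>M) = 0)"
  proof eventually_elim
    case (elim s)
    show ?case
    proof (intro impI ballI)
      fix Z :: "'a \<Rightarrow> real"
      assume s: "0 \<le> s" and Z: "Z \<in> borel_measurable (F s)" and Zi: "integrable M (\<lambda>\<omega>. (Z \<omega>)\<^sup>2)"
      show "(\<integral>\<omega>. Z \<omega> * difference_integrand K Y \<epsilon> T s \<omega> \<partial>M) = 0"
      proof (cases "s \<le> T")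
        case True
        have j: "has_bochner_integral M (\<lambda>\<omega>. (Z \<omega> * Y j s \<omega>) * (X j (s + \<epsilon>) \<omega> - X j s \<omega>)) 0" if "j \<in> K" for j
        proof (rule increment_centred)
          have Yj: "Y j s \<in> borel_measurable (F s)" by (rule progressive_adapted[OF Y[OF that] s True])
          then show "(\<lambda>\<omega>. Z \<omega> * Y j s \<omega>) \<in> borel_measurable (F s)" using Z by simp
          have "integrable M (\<lambda>\<omega>. (Y j s \<omega>)\<^sup>2)"
            using elim that s True filtration_measurable[OF Yj] by (auto simp: integrable_iff_bounded less_top)
          then show "integrable M (\<lambda>\<omega>. Z \<omega> * Y j s \<omega>)"
            by (intro integrable_mult_of_squares filtration_measurable[OF Z] filtration_measurable[OF Yj] Zi)
        qed (use that K(2) s \<epsilon> in auto)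
        have "has_bochner_integral M (\<lambda>\<omega>. (1 / \<epsilon>) * (\<Sum>j\<in>K. (Z \<omega> * Y j s \<omega>) * (X j (s + \<epsilon>) \<omega> - X j s \<omega>))) ((1 / \<epsilon>) * (\<Sum>j\<in>K. 0))"
          by (intro has_bochner_integral_mult_right has_bochner_integral_sum j)
        moreover have "(1 / \<epsilon>) * (\<Sum>j\<in>K. (Z \<omega> * Y j s \<omega>) * (X j (s + \<epsilon>) \<omega> - X j s \<omega>)) = Z \<omega> * difference_integrand K Y \<epsilon> T s \<omega>" for \<omega>
          using s True by (simp add: difference_integrand_def sum_distrib_left sum_divide_distrib mult_ac)
        ultimately have "has_bochner_integral M (\<lambda>\<omega>. Z \<omega> * difference_integrand K Y \<epsilon> T s \<omega>) ((1 / \<epsilon>) * (\<Sum>j\<in>K. 0))"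
          by (simp only:)
        then show ?thesis by (simp add: has_bochner_integral_iff)
      qed (simp add: difference_integrand_def)
    qed
  qed
  show "difference_integrand K Y \<epsilon> T s \<omega> = 0" if "s \<notin> {0..T}" for s \<omega>
    using that by (simp add: difference_integrand_def)
  show "(\<lambda>(s, \<omega>). indicator {..b} s * difference_integrand K Y \<epsilon> T s \<omega>) \<in> borel_measurable (borel \<Otimes>\<^sub>M F (b + \<epsilon>))"
    if "0 \<le> b" for b
    by (rule difference_integrand_measurable[OF K(2) Y \<epsilon> T that])
qed (use \<epsilon> H T in auto)

lemma set_integral_difference_integrand:
  assumes "t \<le> T"
  shows "(LINT s:{0..t}|lborel. difference_integrand {j} (\<lambda>_. Y) \<epsilon> T s \<omega>) = forward_approximation (X j) Y \<epsilon> t \<omega>"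
  unfolding forward_approximation_def set_lebesgue_integral_def difference_integrand_def
  using assms by (intro Bochner_Integration.integral_cong) (auto simp: indicator_def)

section \<open>Estimates uniform in the regularization parameter\<close>

context
  fixes T :: real assumes T: "T > 0"
begin

lemma delayed_single:
  assumes "j \<in> J" "progressive T Y" "energy T Y < \<infinity>" "\<epsilon> > 0"
  shows "delayed_integrand M F (difference_integrand {j} (\<lambda>_. Y) \<epsilon> T) \<epsilon> T (enn2real (energy T Y) / \<epsilon>)"
  by (rule difference_integrand_delayed) (use assms T in auto)

lemma forward_approximation_measurable:
  assumes Y: "j \<in> J" "progressive T Y" and \<epsilon>: "\<epsilon> > 0" and t: "t \<le> T"
  shows "forward_approximation (X j) Y \<epsilon> t \<in> borel_measurable M"
proof -
  have "(\<lambda>(s, \<omega>). indicator {..T} s * difference_integrand {j} (\<lambda>_. Y) \<epsilon> T s \<omega>) \<in> borel_measurable (borel \<Otimes>\<^sub>M F (T + \<epsilon>))"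
    using difference_integrand_measurable[of "{j}" T "\<lambda>_. Y" \<epsilon> T] Y \<epsilon> T by simp
  from filtration_pair_measurable[OF this]
  have [measurable]: "(\<lambda>p. indicator {..T} (fst p) * difference_integrand {j} (\<lambda>_. Y) \<epsilon> T (fst p) (snd p)) \<in> borel_measurable (borel \<Otimes>\<^sub>M M)"
    by (simp add: case_prod_beta')
  have "(\<lambda>p. (snd p, fst p)) \<in> measurable (M \<Otimes>\<^sub>M lborel) (borel \<Otimes>\<^sub>M M)" by measurable
  from measurable_compose[OF this, of "\<lambda>p. indicator {0..t} (fst p) * (indicator {..T} (fst p) * difference_integrand {j} (\<lambda>_. Y) \<epsilon> T (fst p) (snd p))" borel]
  have "(\<lambda>(\<omega>, s). indicator {0..t} s * (indicator {..T} s * difference_integrand {j} (\<lambda>_. Y) \<epsilon> T s \<omega>)) \<in> borel_measurable (M \<Otimes>\<^sub>M lborel)"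
    by (simp add: case_prod_beta')
  then have "(\<lambda>\<omega>. \<integral>s. indicator {0..t} s * (indicator {..T} s * difference_integrand {j} (\<lambda>_. Y) \<epsilon> T s \<omega>) \<partial>lborel) \<in> borel_measurable M"
    by (rule lborel.borel_measurable_lebesgue_integral)
  also have "(\<lambda>\<omega>. \<integral>s. indicator {0..t} s * (indicator {..T} s * difference_integrand {j} (\<lambda>_. Y) \<epsilon> T s \<omega>) \<partial>lborel)
      = forward_approximation (X j) Y \<epsilon> t"
    unfolding set_integral_difference_integrand[OF t, symmetric] set_lebesgue_integral_def fun_eq_iff
    using t by (auto intro!: Bochner_Integration.integral_cong simp: indicator_def)
  finally show ?thesis .
qed

text \<open>The parameter \<epsilon> disappears: the blocks contribute \<epsilon>, the second moment
  of the quotient 1/\<epsilon>.\<close>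

lemma forward_approximation_maximal_inequality:
  assumes Y: "j \<in> J" "progressive T Y" "energy T Y < \<infinity>" and \<epsilon>: "\<epsilon> > 0" and \<eta>: "\<eta> > 0"
  shows "\<exists>A\<in>sets M. {\<omega>\<in>space M. \<exists>t\<in>{0..T}. \<bar>forward_approximation (X j) Y \<epsilon> t \<omega>\<bar> > 3 * \<eta>} \<subseteq> A \<and>
    measure M A \<le> 2 * enn2real (energy T Y) / \<eta>\<^sup>2"
proof -
  interpret d: delayed_integrand M F "difference_integrand {j} (\<lambda>_. Y) \<epsilon> T" \<epsilon> T "enn2real (energy T Y) / \<epsilon>"
    by (rule delayed_single[OF Y \<epsilon>])
  have "\<exists>A\<in>sets M. {\<omega>\<in>space M. \<exists>t\<in>{0..T}. \<bar>LINT s:{0..t}|lborel. difference_integrand {j} (\<lambda>_. Y) \<epsilon> T s \<omega>\<bar> > 3 * \<eta>} \<subseteq> A \<and>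
    measure M A \<le> 2 * \<epsilon> * (enn2real (energy T Y) / \<epsilon>) / \<eta>\<^sup>2"
    by (rule d.maximal_inequality[OF \<eta>])
  then show ?thesis using \<epsilon> by (simp add: set_integral_difference_integrand)
qed

lemma AE_forward_integrable:
  assumes Y: "j \<in> J" "progressive T Y" "energy T Y < \<infinity>" and \<epsilon>: "\<epsilon> > 0"
  shows "AE \<omega> in M. \<forall>t\<in>{0..T}. set_integrable lborel {0..t} (\<lambda>s. Y s \<omega> * ((X j (s + \<epsilon>) \<omega> - X j s \<omega>) / \<epsilon>))"
proof -
  interpret d: delayed_integrand M F "difference_integrand {j} (\<lambda>_. Y) \<epsilon> T" \<epsilon> T "enn2real (energy T Y) / \<epsilon>"
    by (rule delayed_single[OF Y \<epsilon>])
  show ?thesis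
    using d.AE_integrable
  proof eventually_elim
    case (elim \<omega>)
    show ?case
    proof
      fix t assume t: "t \<in> {0..T}"
      have "integrable lborel (\<lambda>s. indicator {0..t} s *\<^sub>R difference_integrand {j} (\<lambda>_. Y) \<epsilon> T s \<omega>)"
        by (intro integrable_mult_indicator elim) simp
      also have "(\<lambda>s. indicator {0..t} s *\<^sub>R difference_integrand {j} (\<lambda>_. Y) \<epsilon> T s \<omega>)
          = (\<lambda>s. indicator {0..t} s *\<^sub>R (Y s \<omega> * ((X j (s + \<epsilon>) \<omega> - X j s \<omega>) / \<epsilon>)))"
        using t by (auto simp: difference_integrand_def indicator_def fun_eq_iff)
      finally show "set_integrable lborel {0..t} (\<lambda>s. Y s \<omega> * ((X j (s + \<epsilon>) \<omega> - X j s \<omega>) / \<epsilon>))"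
        unfolding set_integrable_def .
    qed
  qed
qed

text \<open>Subtracting integrals requires both integrands to be integrable, hence the null set. It
  may depend on \<epsilon> but serves all \<open>t\<close> at once.\<close>

lemma AE_forward_approximation_diff:
  assumes j: "j \<in> J" and Y: "progressive T Y" "energy T Y < \<infinity>" and Z: "progressive T Z" "energy T Z < \<infinity>" and \<epsilon>: "\<epsilon> > 0"
  shows "AE \<omega> in M. \<forall>t\<in>{0..T}. forward_approximation (X j) (\<lambda>s \<omega>. Y s \<omega> - Z s \<omega>) \<epsilon> t \<omega> =
    forward_approximation (X j) Y \<epsilon> t \<omega> - forward_approximation (X j) Z \<epsilon> t \<omega>"
  using AE_forward_integrable[OF j Y \<epsilon>] AE_forward_integrable[OF j Z \<epsilon>]
proof eventually_elim
  case (elim \<omega>)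
  then show ?case
    unfolding forward_approximation_def left_diff_distrib by (auto intro!: set_integral_diff(2))
qed

text \<open>The whole sum is one delayed integrand, so the bound is additive in the energies and
  carries no factor for the number of coordinates. The convergence of the series rests on
  this.\<close>

lemma forward_approximation_sum_square:
  assumes K: "finite K" "K \<subseteq> J" and Y: "\<And>j. j \<in> K \<Longrightarrow> progressive T (Y j)"
    and E: "(\<Sum>j\<in>K. energy T (Y j)) < \<infinity>" and \<epsilon>: "\<epsilon> > 0"
  shows "(\<integral>\<^sup>+\<omega>. ennreal ((\<Sum>j\<in>K. forward_approximation (X j) (Y j) \<epsilon> T \<omega>)\<^sup>2) \<partial>M) \<le> 2 * (\<Sum>j\<in>K. energy T (Y j))"
proof -
  define H where "H = enn2real (\<Sum>j\<in>K. energy T (Y j))"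
  have H: "(\<Sum>j\<in>K. energy T (Y j)) = ennreal H" "H \<ge> 0" using E by (auto simp: H_def)
  interpret d: delayed_integrand M F "difference_integrand K Y \<epsilon> T" \<epsilon> T "H / \<epsilon>"
    by (rule difference_integrand_delayed) (use K Y H \<epsilon> T in auto)
  have fin: "energy T (Y j) < \<infinity>" if "j \<in> K" for j
    using E K(1) that by (simp add: less_top[symmetric])
  have "AE \<omega> in M. \<forall>j\<in>K. \<forall>t\<in>{0..T}. set_integrable lborel {0..t} (\<lambda>s. Y j s \<omega> * ((X j (s + \<epsilon>) \<omega> - X j s \<omega>) / \<epsilon>))"
    using K Y fin \<epsilon> by (intro AE_finite_allI AE_forward_integrable) auto
  then have "AE \<omega> in M. (\<Sum>j\<in>K. forward_approximation (X j) (Y j) \<epsilon> T \<omega>) = (LINT s:{0..T}|lborel. difference_integrand K Y \<epsilon> T s \<omega>)"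
  proof eventually_elim
    case (elim \<omega>)
    have "(LINT s:{0..T}|lborel. difference_integrand K Y \<epsilon> T s \<omega>)
        = (\<integral>s. (\<Sum>j\<in>K. indicator {0..T} s *\<^sub>R (Y j s \<omega> * ((X j (s + \<epsilon>) \<omega> - X j s \<omega>) / \<epsilon>))) \<partial>lborel)"
      unfolding set_lebesgue_integral_def difference_integrand_def
      by (intro Bochner_Integration.integral_cong) (auto simp: indicator_def)
    also have "\<dots> = (\<Sum>j\<in>K. forward_approximation (X j) (Y j) \<epsilon> T \<omega>)"
      unfolding forward_approximation_def set_lebesgue_integral_def
      by (rule Bochner_Integration.integral_sum) (use elim T in \<open>auto simp: set_integrable_def\<close>)
    finally show ?case ..
  qed
  then have "(\<integral>\<^sup>+\<omega>. ennreal ((\<Sum>j\<in>K. forward_approximation (X j) (Y j) \<epsilon> T \<omega>)\<^sup>2) \<partial>M)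
      = (\<integral>\<^sup>+\<omega>. ennreal ((LINT s:{0..T}|lborel. difference_integrand K Y \<epsilon> T s \<omega>)\<^sup>2) \<partial>M)"
    by (intro nn_integral_cong_AE) auto
  also have "\<dots> \<le> ennreal (2 * \<epsilon> * (H / \<epsilon>))" by (rule d.square_bound)
  also have "\<dots> = 2 * (\<Sum>j\<in>K. energy T (Y j))" using \<epsilon> H by (simp add: ennreal_mult)
  finally show ?thesis .
qed

end

end

section \<open>Forward approximations of simple processes\<close>

text \<open>Extending \<open>x\<close> constantly to the left of 0 makes the endpoint 0 interior, so
  that the derivative there is two-sided.\<close>

lemma continuous_on_imp_antiderivative:
  fixes x :: "real \<Rightarrow> real"
  assumes "continuous_on {0..} x"
  obtains G where "\<And>u. 0 \<le> u \<Longrightarrow> u \<le> b \<Longrightarrow> DERIV G u :> x (max 0 u)"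
proof -
  define y where "y u = x (max 0 u)" for u
  have "continuous_on {-1..b + 1} y"
    unfolding y_def by (rule continuous_on_compose2[OF assms]) (auto intro!: continuous_intros)
  then obtain G where G: "\<And>u. u \<in> {-1..b + 1} \<Longrightarrow> (G has_vector_derivative y u) (at u within {-1..b + 1})"
    using antiderivative_continuous by blast
  have "DERIV G u :> x (max 0 u)" if "0 \<le> u" "u \<le> b" for u
  proof -
    have "at u within {-1..b + 1} = at u" using that by (intro at_within_interior) auto
    then show ?thesis
      using G[of u] that by (simp add: y_def has_real_derivative_iff_has_vector_derivative)
  qed
  then show thesis by (rule that)
qed

text \<open>The integral of the quotient equals \<open>K q - K p\<close>, where \<open>K u\<close>
  is the mean of \<open>x\<close> over the window from \<open>u\<close> to
  \<open>u + \<epsilon>\<close>. By the mean value theorem this mean is a value of \<open>x\<close>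
  in the window, within \<eta> of \<open>x u\<close>; the two endpoints give
  \<open>2 * \<eta>\<close>.\<close>

lemma difference_quotient_integral_bound:
  fixes x :: "real \<Rightarrow> real"
  assumes x: "continuous_on {0..} x" and pq: "0 \<le> p" "p \<le> q" and \<epsilon>: "\<epsilon> > 0"
    and mod: "\<And>u r. u \<in> {p, q} \<Longrightarrow> 0 \<le> r \<Longrightarrow> r \<le> \<epsilon> \<Longrightarrow> \<bar>x (u + r) - x u\<bar> \<le> \<eta>"
  shows "\<bar>(LINT s:{p..q}|lborel. (x (s + \<epsilon>) - x s) / \<epsilon>) - (x q - x p)\<bar> \<le> 2 * \<eta>"
proof -
  obtain G where G: "\<And>u. 0 \<le> u \<Longrightarrow> u \<le> q + \<epsilon> \<Longrightarrow> DERIV G u :> x (max 0 u)"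
    using continuous_on_imp_antiderivative[OF x] by metis
  define y where "y u = x (max 0 u)" for u
  have y: "continuous_on UNIV y"
    unfolding y_def by (rule continuous_on_compose2[OF x]) (auto intro!: continuous_intros)
  define K where "K u = (G (u + \<epsilon>) - G u) / \<epsilon>" for u
  have "has_bochner_integral lborel (\<lambda>s. ((y (s + \<epsilon>) - y s) / \<epsilon>) * indicator {p..q} s) (K q - K p)"
  proof (rule has_bochner_integral_FTC_Icc_real)
    fix u assume u: "p \<le> u" "u \<le> q"
    have "DERIV G (u + \<epsilon>) :> y (u + \<epsilon>)" "DERIV G u :> y u"
      using G[of u] G[of "u + \<epsilon>"] u pq \<epsilon> by (auto simp: y_def)
    then show "DERIV K u :> (y (u + \<epsilon>) - y u) / \<epsilon>"
      unfolding K_def using \<epsilon> by (auto intro!: derivative_eq_intros simp: DERIV_shift)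
    have "continuous_on UNIV (\<lambda>u. (y (u + \<epsilon>) - y u) / \<epsilon>)"
      using \<epsilon> by (intro continuous_intros continuous_on_compose2[OF y]) auto
    then show "isCont (\<lambda>u. (y (u + \<epsilon>) - y u) / \<epsilon>) u"
      by (simp add: continuous_on_eq_continuous_at)
  qed fact
  then have "(\<integral>s. ((y (s + \<epsilon>) - y s) / \<epsilon>) * indicator {p..q} s \<partial>lborel) = K q - K p"
    by (simp add: has_bochner_integral_iff)
  also have "(\<integral>s. ((y (s + \<epsilon>) - y s) / \<epsilon>) * indicator {p..q} s \<partial>lborel)
      = (LINT s:{p..q}|lborel. (x (s + \<epsilon>) - x s) / \<epsilon>)"
    unfolding set_lebesgue_integral_def
    using pq \<epsilon> by (intro Bochner_Integration.integral_cong) (auto simp: y_def indicator_def)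
  finally have eq: "(LINT s:{p..q}|lborel. (x (s + \<epsilon>) - x s) / \<epsilon>) = K q - K p" .
  have "\<bar>K u - x u\<bar> \<le> \<eta>" if u: "u \<in> {p, q}" for u
  proof -
    have "0 \<le> u" "u \<le> q" using u pq by auto
    have "\<exists>z>u. z < u + \<epsilon> \<and> G (u + \<epsilon>) - G u = (u + \<epsilon> - u) * x (max 0 z)"
    proof (rule MVT2)
      show "DERIV G z :> x (max 0 z)" if "u \<le> z" "z \<le> u + \<epsilon>" for z
        by (rule G) (use that \<open>0 \<le> u\<close> \<open>u \<le> q\<close> in auto)
    qed (use \<epsilon> in simp)
    then obtain z where z: "z > u" "z < u + \<epsilon>" "G (u + \<epsilon>) - G u = (u + \<epsilon> - u) * x (max 0 z)"
      by blast
    then have "K u = x (u + (z - u))" using \<epsilon> \<open>0 \<le> u\<close> by (simp add: K_def max_def)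
    then show ?thesis using mod[OF u, of "z - u"] z by simp
  qed
  from this[of p] this[of q] show ?thesis unfolding eq by auto
qed

text \<open>Adding the left endpoint changes a null set. If \<open>t\<close> lies before
  \<open>a\<close>, the interval on the right shrinks to a point and both sides vanish.\<close>

lemma set_integral_Ioc_cap:
  fixes f :: "real \<Rightarrow> real"
  assumes "0 \<le> a" "a \<le> b" "0 \<le> t" and f: "continuous_on {0..} f"
  shows "(LINT s:{0..t}|lborel. c * indicator {a<..b} s * f s) = c * (LINT s:{min a t..min b t}|lborel. f s)"
proof -
  have "continuous_on {min a t..min b t} f" by (rule continuous_on_subset[OF f]) (use assms in auto)
  then have m: "(\<lambda>s. indicator {min a t..min b t} s * f s) \<in> borel_measurable lborel"
    using borel_measurable_continuous_on_indicator[of "{min a t..min b t}" f] by simp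
  have "(LINT s:{0..t}|lborel. c * indicator {a<..b} s * f s)
      = (\<integral>s. c * (indicator {min a t<..min b t} s * (indicator {min a t..min b t} s * f s)) \<partial>lborel)"
    unfolding set_lebesgue_integral_def
    using assms by (intro Bochner_Integration.integral_cong) (auto simp: indicator_def)
  also have "\<dots> = c * (\<integral>s. indicator {min a t<..min b t} s * (indicator {min a t..min b t} s * f s) \<partial>lborel)" by simp
  also have "(\<integral>s. indicator {min a t<..min b t} s * (indicator {min a t..min b t} s * f s) \<partial>lborel)
      = (\<integral>s. indicator {min a t..min b t} s * f s \<partial>lborel)"
  proof (rule Bochner_Integration.integral_cong_AE)
    have "AE s in lborel. s \<noteq> min a t" by (rule AE_lborel_singleton)
    then show "AE s in lborel. indicator {min a t<..min b t} s * (indicator {min a t..min b t} s * f s)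
        = indicator {min a t..min b t} s * f s"
      by eventually_elim (auto simp: indicator_def)
  qed (use m in measurable)
  finally show ?thesis by (simp add: set_lebesgue_integral_def)
qed

section \<open>Suprema in outer probability\<close>

context prob_space
begin

text \<open>An outer-probability bound for a supremum over \<open>{0..T}\<close>, which need not be measurable.\<close>

definition sup_small :: "real \<Rightarrow> real \<Rightarrow> real \<Rightarrow> (real \<Rightarrow> 'a \<Rightarrow> real) \<Rightarrow> bool" where
  "sup_small T \<eta> \<delta> f \<longleftrightarrow>
    (\<exists>A\<in>sets M. {\<omega>\<in>space M. \<exists>t\<in>{0..T}. \<bar>f t \<omega>\<bar> > \<eta>} \<subseteq> A \<and> measure M A < \<delta>)"

lemma sup_smallI:
  assumes "A \<in> sets M" "measure M A < \<delta>" "\<And>\<omega> t. \<omega> \<in> space M \<Longrightarrow> \<omega> \<notin> A \<Longrightarrow> 0 \<le> t \<Longrightarrow> t \<le> T \<Longrightarrow> \<bar>f t \<omega>\<bar> \<le> \<eta>"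
  shows "sup_small T \<eta> \<delta> f"
  unfolding sup_small_def
proof (intro bexI[of _ A] conjI subsetI)
  fix \<omega> assume "\<omega> \<in> {\<omega>\<in>space M. \<exists>t\<in>{0..T}. \<bar>f t \<omega>\<bar> > \<eta>}"
  then obtain t where t: "\<omega> \<in> space M" "0 \<le> t" "t \<le> T" "\<bar>f t \<omega>\<bar> > \<eta>" by auto
  show "\<omega> \<in> A"
  proof (rule ccontr)
    assume "\<omega> \<notin> A"
    from assms(3)[OF t(1) this t(2,3)] show False using t(4) by linarith
  qed
qed (use assms in auto)

lemma sup_smallE:
  assumes "sup_small T \<eta> \<delta> f"
  obtains A where "A \<in> sets M" "measure M A < \<delta>"
    "\<And>\<omega> t. \<omega> \<in> space M \<Longrightarrow> \<omega> \<notin> A \<Longrightarrow> 0 \<le> t \<Longrightarrow> t \<le> T \<Longrightarrow> \<bar>f t \<omega>\<bar> \<le> \<eta>"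
proof -
  obtain A where A: "A \<in> sets M" "measure M A < \<delta>" "{\<omega>\<in>space M. \<exists>t\<in>{0..T}. \<bar>f t \<omega>\<bar> > \<eta>} \<subseteq> A"
    using assms unfolding sup_small_def by auto
  show thesis
  proof (rule that[OF A(1,2)])
    fix \<omega> t assume "\<omega> \<in> space M" "\<omega> \<notin> A" "0 \<le> t" "t \<le> T"
    note * = this
    show "\<bar>f t \<omega>\<bar> \<le> \<eta>"
    proof (rule ccontr)
      assume "\<not> ?thesis"
      then have "\<omega> \<in> {\<omega>\<in>space M. \<exists>t\<in>{0..T}. \<bar>f t \<omega>\<bar> > \<eta>}"
        using * by (intro CollectI conjI bexI[of _ t]) auto
      with A(3) have "\<omega> \<in> A" by (rule subsetD)
      with * show False by simp
    qed
  qed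
qed

text \<open>The exceptional sets are united, together with a measurable null set off which the
  pointwise comparison holds for all times.\<close>

lemma sup_small_triangle:
  assumes f: "sup_small T \<eta>1 \<delta>1 f" and g: "sup_small T \<eta>2 \<delta>2 g"
    and h: "AE \<omega> in M. \<forall>t\<in>{0..T}. \<bar>h t \<omega>\<bar> \<le> \<bar>f t \<omega>\<bar> + \<bar>g t \<omega>\<bar>"
  shows "sup_small T (\<eta>1 + \<eta>2) (\<delta>1 + \<delta>2) h"
proof -
  obtain A where A: "A \<in> sets M" "measure M A < \<delta>1"
    "\<And>\<omega> t. \<omega> \<in> space M \<Longrightarrow> \<omega> \<notin> A \<Longrightarrow> 0 \<le> t \<Longrightarrow> t \<le> T \<Longrightarrow> \<bar>f t \<omega>\<bar> \<le> \<eta>1" by (rule sup_smallE[OF f], rule that)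
  obtain B where B: "B \<in> sets M" "measure M B < \<delta>2"
    "\<And>\<omega> t. \<omega> \<in> space M \<Longrightarrow> \<omega> \<notin> B \<Longrightarrow> 0 \<le> t \<Longrightarrow> t \<le> T \<Longrightarrow> \<bar>g t \<omega>\<bar> \<le> \<eta>2" by (rule sup_smallE[OF g], rule that)
  obtain N where N: "{\<omega>\<in>space M. \<not> (\<forall>t\<in>{0..T}. \<bar>h t \<omega>\<bar> \<le> \<bar>f t \<omega>\<bar> + \<bar>g t \<omega>\<bar>)} \<subseteq> N" "emeasure M N = 0" "N \<in> sets M"
    by (rule AE_E[OF h])
  show ?thesis
  proof (rule sup_smallI)
    show "A \<union> B \<union> N \<in> sets M" using A(1) B(1) N(3) by simp
    have "measure M (A \<union> B \<union> N) \<le> measure M A + measure M B + measure M N"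
      using measure_Un_le[of "A \<union> B" M N] measure_Un_le[of A M B] A(1) B(1) N(3) by simp
    also have "measure M N = 0" using N(2) by (simp add: measure_def)
    finally show "measure M (A \<union> B \<union> N) < \<delta>1 + \<delta>2" using A(2) B(2) by linarith
    fix \<omega> t assume *: "\<omega> \<in> space M" "\<omega> \<notin> A \<union> B \<union> N" "0 \<le> t" "t \<le> T"
    have "\<bar>h t \<omega>\<bar> \<le> \<bar>f t \<omega>\<bar> + \<bar>g t \<omega>\<bar>"
    proof (rule ccontr)
      assume "\<not> ?thesis"
      then have "\<omega> \<in> {\<omega>\<in>space M. \<not> (\<forall>t\<in>{0..T}. \<bar>h t \<omega>\<bar> \<le> \<bar>f t \<omega>\<bar> + \<bar>g t \<omega>\<bar>)}"
        using * by (intro CollectI conjI notI) (auto dest: bspec[of _ _ t])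
      with N(1) have "\<omega> \<in> N" by (rule subsetD)
      with * show False by simp
    qed
    moreover have "\<bar>f t \<omega>\<bar> \<le> \<eta>1" "\<bar>g t \<omega>\<bar> \<le> \<eta>2" using A(3)[of \<omega> t] B(3)[of \<omega> t] * by simp_all
    ultimately show "\<bar>h t \<omega>\<bar> \<le> \<eta>1 + \<eta>2" by linarith
  qed
qed

end

context orthonormal_family
begin

text \<open>Each path is uniformly continuous on a compact interval, so the events of a modulus
  above \<eta> at scale \<open>1 / (n + 1)\<close> decrease to the empty set, and their
  probabilities tend to 0. Restricting to rational times makes these events measurable.\<close>

lemma small_modulus_of_continuity:
  assumes j: "j \<in> J" and \<eta>: "\<eta> > 0" and \<delta>: "\<delta> > 0"
  shows "\<exists>\<rho>>0. \<exists>A\<in>sets M. measure M A < \<delta> \<and>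
    (\<forall>\<omega>\<in>space M - A. \<forall>u\<in>{0..b}. \<forall>u'\<in>{0..b}. \<bar>u - u'\<bar> < \<rho> \<longrightarrow> \<bar>X j u \<omega> - X j u' \<omega>\<bar> \<le> \<eta>)"
proof -
  \<comment> \<open>Clamping lets the rational times range over the whole line, so that points of
    the interval, its ends included, can be approached from the right.\<close>
  define Z where "Z u \<omega> = X j (max 0 (min u (max 0 b))) \<omega>" for u \<omega>
  have Z[measurable]: "Z u \<in> borel_measurable M" for u
    unfolding Z_def by (rule filtration_measurable[OF adapted[OF j]]) simp
  have cont: "continuous_on UNIV (\<lambda>u. Z u \<omega>)" if "\<omega> \<in> space M" for \<omega>
    unfolding Z_def by (rule continuous_on_compose2[OF continuous[OF j that]]) (auto intro!: continuous_intros)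
  define c :: "nat \<Rightarrow> real" where "c n = 1 / real (Suc n)" for n
  define A where "A n = (\<Union>u\<in>\<rat>. \<Union>u'\<in>\<rat>. {\<omega>\<in>space M. \<bar>u - u'\<bar> < c n \<and> \<bar>Z u \<omega> - Z u' \<omega>\<bar> > \<eta>})" for n
  have A: "A n \<in> sets M" for n
    unfolding A_def by (intro sets.countable_UN'' countable_rat) measurable
  have real: "\<bar>Z u \<omega> - Z u' \<omega>\<bar> \<le> \<eta>" if \<omega>: "\<omega> \<in> space M" "\<omega> \<notin> A n" and uu: "\<bar>u - u'\<bar> < c n" for n \<omega> u u'
  proof (rule ccontr)
    assume "\<not> ?thesis"
    then have \<gamma>: "(\<bar>Z u \<omega> - Z u' \<omega>\<bar> - \<eta>) / 2 > 0" by simp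
    have cu: "isCont (\<lambda>u. Z u \<omega>) u" for u using cont[OF \<omega>(1)] by (simp add: continuous_on_eq_continuous_at)
    obtain d where d: "d > 0" "\<And>w. \<bar>w - u\<bar> < d \<Longrightarrow> \<bar>Z w \<omega> - Z u \<omega>\<bar> < (\<bar>Z u \<omega> - Z u' \<omega>\<bar> - \<eta>) / 2"
      using cu[of u] \<gamma> unfolding continuous_at_eps_delta by (metis dist_real_def)
    obtain d' where d': "d' > 0" "\<And>w. \<bar>w - u'\<bar> < d' \<Longrightarrow> \<bar>Z w \<omega> - Z u' \<omega>\<bar> < (\<bar>Z u \<omega> - Z u' \<omega>\<bar> - \<eta>) / 2"
      using cu[of u'] \<gamma> unfolding continuous_at_eps_delta by (metis dist_real_def)
    \<comment> \<open>Both times move by less than half of what is missing to \<open>c n\<close>,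
      and each value of \<open>Z\<close> by less than half of the excess over \<eta>; both strict
      inequalities survive.\<close>
    define m where "m = min (min d d') ((c n - \<bar>u - u'\<bar>) / 2)"
    have m: "m > 0" using d d' uu by (simp add: m_def)
    obtain w where w: "w \<in> \<rat>" "u < w" "w < u + m" using Rats_dense_in_real[of u "u + m"] m by auto
    obtain w' where w': "w' \<in> \<rat>" "u' < w'" "w' < u' + m" using Rats_dense_in_real[of u' "u' + m"] m by auto
    have m': "m \<le> d" "m \<le> d'" "m \<le> (c n - \<bar>u - u'\<bar>) / 2"
      unfolding m_def by (simp_all only: min.cobounded2 min.coboundedI1 min.cobounded1)
    have "\<bar>w - u\<bar> < d" "\<bar>w' - u'\<bar> < d'" using w w' m m' by linarith+
    moreover have "\<bar>Z u \<omega> - Z u' \<omega>\<bar> \<le> \<bar>Z w \<omega> - Z u \<omega>\<bar> + \<bar>Z w \<omega> - Z w' \<omega>\<bar> + \<bar>Z w' \<omega> - Z u' \<omega>\<bar>"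
      by linarith
    ultimately have "\<bar>Z w \<omega> - Z w' \<omega>\<bar> > \<eta>" using d(2)[of w] d'(2)[of w'] by argo
    moreover have "\<bar>w - w'\<bar> < c n"
    proof -
      have "u - u' \<le> \<bar>u - u'\<bar>" "u' - u \<le> \<bar>u - u'\<bar>" by auto
      moreover have "\<bar>u - u'\<bar> + 2 * m \<le> c n" using m'(3) by (simp add: field_simps)
      ultimately have "w - w' < c n" "w' - w < c n" using w w' m by linarith+
      then show ?thesis by (simp add: abs_less_iff)
    qed
    ultimately have "\<bar>Z w \<omega> - Z w' \<omega>\<bar> > \<eta>" "\<bar>w - w'\<bar> < c n" by blast+
    then show False using \<omega> w(1) w'(1) unfolding A_def by blast
  qed
  have "(\<Inter>n. A n) = {}"
  proof (rule ccontr)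
    assume "(\<Inter>n. A n) \<noteq> {}"
    then obtain \<omega> where \<omega>: "\<And>n. \<omega> \<in> A n" by auto
    then have "\<omega> \<in> space M" using sets.sets_into_space[OF A] by blast
    have "uniformly_continuous_on {0..max 0 b} (\<lambda>u. X j u \<omega>)"
      by (intro compact_uniformly_continuous continuous_on_subset[OF continuous[OF j \<open>\<omega> \<in> space M\<close>]]) auto
    then obtain d where d: "d > 0" "\<And>u u'. u \<in> {0..max 0 b} \<Longrightarrow> u' \<in> {0..max 0 b} \<Longrightarrow> dist u' u < d \<Longrightarrow> dist (X j u' \<omega>) (X j u \<omega>) < \<eta>"
      using \<eta> unfolding uniformly_continuous_on_def by metis
    obtain n where n: "c n < d" using d(1) reals_Archimedean by (auto simp: inverse_eq_divide c_def)
    obtain u u' where uu: "\<bar>u - u'\<bar> < c n" "\<bar>Z u \<omega> - Z u' \<omega>\<bar> > \<eta>"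
      using \<omega>[of n] unfolding A_def by blast
    have "dist (max 0 (min u (max 0 b))) (max 0 (min u' (max 0 b))) < d"
      using uu(1) n by (simp add: dist_real_def) linarith
    then have "dist (Z u \<omega>) (Z u' \<omega>) < \<eta>" unfolding Z_def by (intro d(2)) auto
    then show False using uu(2) by (simp add: dist_real_def)
  qed
  moreover have "decseq A"
  proof (rule decseq_SucI)
    fix n
    have "c (Suc n) \<le> c n" by (simp add: frac_le c_def)
    then show "A (Suc n) \<subseteq> A n" unfolding A_def by fastforce
  qed
  ultimately have "(\<lambda>n. measure M (A n)) \<longlonglongrightarrow> 0"
    using finite_Lim_measure_decseq[of A] A by auto
  then obtain n where n: "measure M (A n) < \<delta>"
    using \<delta> by (metis (no_types, lifting) LIMSEQ_D diff_zero norm_ge_zero order_refl real_norm_def abs_less_iff)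
  show ?thesis
  proof (intro exI[of _ "c n"] conjI bexI[of _ "A n"] ballI impI)
    fix \<omega> u u' assume "\<omega> \<in> space M - A n" "u \<in> {0..b}" "u' \<in> {0..b}" "\<bar>u - u'\<bar> < c n"
    then show "\<bar>X j u \<omega> - X j u' \<omega>\<bar> \<le> \<eta>" using real[of \<omega> n u u'] by (simp add: Z_def max_def)
  qed (use n A in \<open>auto simp: c_def\<close>)
qed

text \<open>The elementary integral as a process in \<open>t\<close>: partition points after
  \<open>t\<close> are moved to \<open>t\<close>, so later increments vanish.\<close>

definition stopped_simple_integral ::
  "'i \<Rightarrow> nat \<Rightarrow> (nat \<Rightarrow> real) \<Rightarrow> (nat \<Rightarrow> 'a \<Rightarrow> real) \<Rightarrow> real \<Rightarrow> 'a \<Rightarrow> real" where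
  "stopped_simple_integral j n \<tau> \<xi> t \<omega> =
    (\<Sum>i<n. \<xi> i \<omega> * (X j (min (\<tau> (Suc i)) t) \<omega> - X j (min (\<tau> i) t) \<omega>))"

lemma stopped_simple_integral_end:
  "simple_data M F T n \<tau> \<xi> \<Longrightarrow> stopped_simple_integral j n \<tau> \<xi> T = simple_integral (X j) n \<tau> \<xi>"
proof (intro ext)
  fix \<omega> assume sd: "simple_data M F T n \<tau> \<xi>"
  have "min (\<tau> i) T = \<tau> i \<and> min (\<tau> (Suc i)) T = \<tau> (Suc i)" if "i < n" for i
  proof -
    have "\<tau> i \<le> T" "\<tau> (Suc i) \<le> T" using sd that unfolding simple_data_def by simp_all
    then show ?thesis by (simp add: min_absorb1)
  qed
  then show "stopped_simple_integral j n \<tau> \<xi> T \<omega> = simple_integral (X j) n \<tau> \<xi> \<omega>"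
    unfolding stopped_simple_integral_def simple_integral_def by (intro sum.cong) simp_all
qed

text \<open>Either the coefficient is known at time \<open>b\<close>, or its interval begins after
  \<open>b\<close> and the term is 0 on \<open>{0..b}\<close>.\<close>

lemma simple_process_progressive:
  assumes sd: "simple_data M F T n \<tau> \<xi>"
  shows "progressive T (simple_process n \<tau> \<xi>)"
  unfolding simple_process_def
proof (rule progressive_sum, unfold progressive_def, rule ballI)
  fix i b assume i: "i \<in> {..<n}" and b: "b \<in> {0..T}"
  show "(\<lambda>(s, \<omega>). indicator {0..b} s * (\<xi> i \<omega> * indicator {\<tau> i<..\<tau> (Suc i)} s)) \<in> borel_measurable (borel \<Otimes>\<^sub>M F b)"
  proof (cases "\<tau> i \<le> b")
    case True
    have "\<xi> i \<in> borel_measurable (F (\<tau> i))" using sd i unfolding simple_data_def by simp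
    then have [measurable]: "\<xi> i \<in> borel_measurable (F b)"
      using True by (rule filtration_measurable_mono)
    show ?thesis by measurable
  next
    case False
    then have "(\<lambda>(s, \<omega>). indicator {0..b} s * (\<xi> i \<omega> * indicator {\<tau> i<..\<tau> (Suc i)} s)) = (\<lambda>p. 0)"
      by (auto simp: fun_eq_iff indicator_def)
    then show ?thesis by simp
  qed
qed

lemma simple_data_bound:
  assumes "simple_data M F T n \<tau> \<xi>"
  obtains K where "\<And>i. 0 \<le> K i" "\<And>i \<omega>. i < n \<Longrightarrow> \<omega> \<in> space M \<Longrightarrow> \<bar>\<xi> i \<omega>\<bar> \<le> K i"
proof -
  have "\<forall>i. \<exists>K. i < n \<longrightarrow> (\<forall>\<omega>\<in>space M. \<bar>\<xi> i \<omega>\<bar> \<le> K)"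
    using assms unfolding simple_data_def by blast
  from choice[OF this] obtain K where K: "\<forall>i. i < n \<longrightarrow> (\<forall>\<omega>\<in>space M. \<bar>\<xi> i \<omega>\<bar> \<le> K i)" ..
  show thesis
  proof (rule that[of "\<lambda>i. max 0 (K i)"])
    fix i \<omega> assume "i < n" "\<omega> \<in> space M"
    then have "\<bar>\<xi> i \<omega>\<bar> \<le> K i" using K by blast
    then show "\<bar>\<xi> i \<omega>\<bar> \<le> max 0 (K i)" by linarith
  qed simp
qed

lemma energy_simple_process:
  assumes sd: "simple_data M F T n \<tau> \<xi>"
  shows "energy T (simple_process n \<tau> \<xi>) < \<infinity>"
proof -
  obtain K where K: "\<And>i. 0 \<le> K i" "\<And>i \<omega>. i < n \<Longrightarrow> \<omega> \<in> space M \<Longrightarrow> \<bar>\<xi> i \<omega>\<bar> \<le> K i"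
    using simple_data_bound[OF sd] by metis
  define B where "B = (\<Sum>i<n. K i)"
  have B: "\<bar>simple_process n \<tau> \<xi> s \<omega>\<bar> \<le> B" if "\<omega> \<in> space M" for s \<omega>
    unfolding simple_process_def B_def
    using K that by (intro order_trans[OF sum_abs] sum_mono) (auto simp: indicator_def)
  have "energy T (simple_process n \<tau> \<xi>) \<le> (\<integral>\<^sup>+s. indicator {0..T} s * ennreal (B\<^sup>2) \<partial>lborel)"
    unfolding energy_def
  proof (intro nn_integral_mono mult_left_mono)
    fix s
    have "(\<integral>\<^sup>+\<omega>. ennreal ((simple_process n \<tau> \<xi> s \<omega>)\<^sup>2) \<partial>M) \<le> (\<integral>\<^sup>+\<omega>. ennreal (B\<^sup>2) \<partial>M)"
    proof (intro nn_integral_mono ennreal_leI)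
      fix \<omega> assume "\<omega> \<in> space M"
      then show "(simple_process n \<tau> \<xi> s \<omega>)\<^sup>2 \<le> B\<^sup>2" using power_mono[OF B[of \<omega> s] abs_ge_zero, of 2] by simp
    qed
    also have "\<dots> = ennreal (B\<^sup>2)" by (simp add: emeasure_space_1)
    finally show "(\<integral>\<^sup>+\<omega>. ennreal ((simple_process n \<tau> \<xi> s \<omega>)\<^sup>2) \<partial>M) \<le> ennreal (B\<^sup>2)" .
  qed simp
  also have "\<dots> = emeasure lborel {0..T} * ennreal (B\<^sup>2)" by (simp add: nn_integral_multc)
  also have "\<dots> < \<infinity>" by (auto simp: ennreal_mult_less_top emeasure_lborel_Icc_eq)
  finally show ?thesis .
qed

text \<open>A pathwise estimate: on every partition interval, cut off at \<open>t\<close>, the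
  coefficient is constant and the integral of the quotient differs from the increment by at most
  \<open>2 * \<eta>\<close>.\<close>

lemma forward_approximation_simple_bound:
  assumes sd: "simple_data M F T n \<tau> \<xi>" and j: "j \<in> J" and \<omega>: "\<omega> \<in> space M" and t: "0 \<le> t" "t \<le> T" and \<epsilon>: "\<epsilon> > 0"
    and mod: "\<And>u r. 0 \<le> u \<Longrightarrow> u \<le> T \<Longrightarrow> 0 \<le> r \<Longrightarrow> r \<le> \<epsilon> \<Longrightarrow> \<bar>X j (u + r) \<omega> - X j u \<omega>\<bar> \<le> \<eta>"
  shows "\<bar>forward_approximation (X j) (simple_process n \<tau> \<xi>) \<epsilon> t \<omega> - stopped_simple_integral j n \<tau> \<xi> t \<omega>\<bar>
    \<le> (\<Sum>i<n. \<bar>\<xi> i \<omega>\<bar>) * (2 * \<eta>)"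
proof -
  define f where "f s = (X j (s + \<epsilon>) \<omega> - X j s \<omega>) / \<epsilon>" for s
  have x: "continuous_on {0..} (\<lambda>t. X j t \<omega>)" by (rule continuous[OF j \<omega>])
  have f: "continuous_on {0..} f"
    unfolding f_def using \<epsilon> by (intro continuous_intros continuous_on_compose2[OF x] x) auto
  have fi: "integrable lborel (\<lambda>s. indicator {0..t} s * f s)"
    using borel_integrable_atLeastAtMost'[OF continuous_on_subset[OF f], of 0 t]
    by (simp add: set_integrable_def)
  have \<tau>: "0 \<le> \<tau> i" "\<tau> i \<le> \<tau> (Suc i)" "\<tau> (Suc i) \<le> T" if "i < n" for i
    using sd that unfolding simple_data_def by auto
  have "forward_approximation (X j) (simple_process n \<tau> \<xi>) \<epsilon> t \<omega>
      = (\<integral>s. (\<Sum>i<n. \<xi> i \<omega> * indicator {\<tau> i<..\<tau> (Suc i)} s * (indicator {0..t} s * f s)) \<partial>lborel)"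
    unfolding forward_approximation_def set_lebesgue_integral_def simple_process_def f_def
    by (intro Bochner_Integration.integral_cong) (simp_all only: real_scaleR_def sum_distrib_left sum_distrib_right mult_ac)
  also have "\<dots> = (\<Sum>i<n. \<integral>s. \<xi> i \<omega> * indicator {\<tau> i<..\<tau> (Suc i)} s * (indicator {0..t} s * f s) \<partial>lborel)"
  proof (rule Bochner_Integration.integral_sum)
    fix i
    have "integrable lborel (\<lambda>s. \<xi> i \<omega> * (indicator {\<tau> i<..\<tau> (Suc i)} s *\<^sub>R (indicator {0..t} s * f s)))"
      by (intro integrable_mult_right integrable_mult_indicator fi) simp
    then show "integrable lborel (\<lambda>s. \<xi> i \<omega> * indicator {\<tau> i<..\<tau> (Suc i)} s * (indicator {0..t} s * f s))"
      by (simp add: mult.assoc)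
  qed
  also have "\<dots> = (\<Sum>i<n. \<xi> i \<omega> * (LINT s:{min (\<tau> i) t..min (\<tau> (Suc i)) t}|lborel. f s))"
  proof (rule sum.cong[OF refl])
    fix i assume "i \<in> {..<n}"
    then show "(\<integral>s. \<xi> i \<omega> * indicator {\<tau> i<..\<tau> (Suc i)} s * (indicator {0..t} s * f s) \<partial>lborel)
        = \<xi> i \<omega> * (LINT s:{min (\<tau> i) t..min (\<tau> (Suc i)) t}|lborel. f s)"
      using set_integral_Ioc_cap[of "\<tau> i" "\<tau> (Suc i)" t f "\<xi> i \<omega>"] \<tau> t f
      by (simp add: set_lebesgue_integral_def mult_ac)
  qed
  finally have "forward_approximation (X j) (simple_process n \<tau> \<xi>) \<epsilon> t \<omega> - stopped_simple_integral j n \<tau> \<xi> t \<omega>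
      = (\<Sum>i<n. \<xi> i \<omega> * ((LINT s:{min (\<tau> i) t..min (\<tau> (Suc i)) t}|lborel. f s)
          - (X j (min (\<tau> (Suc i)) t) \<omega> - X j (min (\<tau> i) t) \<omega>)))"
    by (simp add: stopped_simple_integral_def sum_subtractf right_diff_distrib)
  also have "\<bar>\<dots>\<bar> \<le> (\<Sum>i<n. \<bar>\<xi> i \<omega>\<bar> * (2 * \<eta>))"
  proof (intro order_trans[OF sum_abs] sum_mono)
    fix i assume "i \<in> {..<n}"
    then have i: "0 \<le> \<tau> i" "\<tau> i \<le> \<tau> (Suc i)" "\<tau> (Suc i) \<le> T" using \<tau> by auto
    have "\<bar>(LINT s:{min (\<tau> i) t..min (\<tau> (Suc i)) t}|lborel. f s)
          - (X j (min (\<tau> (Suc i)) t) \<omega> - X j (min (\<tau> i) t) \<omega>)\<bar> \<le> 2 * \<eta>"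
      unfolding f_def by (rule difference_quotient_integral_bound[OF x _ _ \<epsilon>]) (use i t mod in auto)
    then show "\<bar>\<xi> i \<omega> * ((LINT s:{min (\<tau> i) t..min (\<tau> (Suc i)) t}|lborel. f s)
          - (X j (min (\<tau> (Suc i)) t) \<omega> - X j (min (\<tau> i) t) \<omega>))\<bar> \<le> \<bar>\<xi> i \<omega>\<bar> * (2 * \<eta>)"
      by (simp add: abs_mult mult_left_mono)
  qed
  finally show ?thesis by (simp add: sum_distrib_right)
qed

lemma simple_forward_convergence:
  assumes sd: "simple_data M F T n \<tau> \<xi>" and j: "j \<in> J" and T: "T > 0" and \<eta>: "\<eta> > 0" and \<delta>: "\<delta> > 0"
  shows "\<forall>\<^sub>F \<epsilon> in at_right 0. sup_small T \<eta> \<delta> (\<lambda>t \<omega>. forward_approximation (X j) (simple_process n \<tau> \<xi>) \<epsilon> t \<omega>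
    - stopped_simple_integral j n \<tau> \<xi> t \<omega>)"
proof -
  obtain K where K: "\<And>i. 0 \<le> K i" "\<And>i \<omega>. i < n \<Longrightarrow> \<omega> \<in> space M \<Longrightarrow> \<bar>\<xi> i \<omega>\<bar> \<le> K i"
    using simple_data_bound[OF sd] by metis
  define B where "B = (\<Sum>i<n. K i)"
  have B: "B \<ge> 0" unfolding B_def using K by (intro sum_nonneg) auto
  \<comment> \<open>The error is at most \<open>B * (2 * \<eta>')\<close>; adding 1 in the
    denominator covers \<open>B = 0\<close>.\<close>
  define \<eta>' where "\<eta>' = \<eta> / (2 * B + 1)"
  have \<eta>': "\<eta>' > 0" "B * (2 * \<eta>') \<le> \<eta>"
    using B \<eta> by (auto simp: \<eta>'_def field_simps)
  \<comment> \<open>The horizon is \<open>T + 1\<close> because quotients reach up to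
    \<open>T + \<epsilon>\<close>, and \<epsilon> is kept below 1.\<close>
  have "\<exists>\<rho>>0. \<exists>A\<in>sets M. measure M A < \<delta> \<and> (\<forall>\<omega>\<in>space M - A. \<forall>u\<in>{0..T + 1}. \<forall>u'\<in>{0..T + 1}.
      \<bar>u - u'\<bar> < \<rho> \<longrightarrow> \<bar>X j u \<omega> - X j u' \<omega>\<bar> \<le> \<eta>')"
    by (rule small_modulus_of_continuity[OF j \<eta>'(1) \<delta>])
  then obtain \<rho> A where \<rho>: "\<rho> > 0" and A: "A \<in> sets M" "measure M A < \<delta>"
    and mod: "\<forall>\<omega>\<in>space M - A. \<forall>u\<in>{0..T + 1}. \<forall>u'\<in>{0..T + 1}. \<bar>u - u'\<bar> < \<rho> \<longrightarrow> \<bar>X j u \<omega> - X j u' \<omega>\<bar> \<le> \<eta>'"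
    by blast
  have "sup_small T \<eta> \<delta> (\<lambda>t \<omega>. forward_approximation (X j) (simple_process n \<tau> \<xi>) \<epsilon> t \<omega> - stopped_simple_integral j n \<tau> \<xi> t \<omega>)"
    if \<epsilon>: "0 < \<epsilon>" "\<epsilon> < min \<rho> 1" for \<epsilon>
  proof (rule sup_smallI[OF A])
    fix \<omega> t assume \<omega>: "\<omega> \<in> space M" "\<omega> \<notin> A" and t: "0 \<le> t" "t \<le> T"
    have "\<bar>forward_approximation (X j) (simple_process n \<tau> \<xi>) \<epsilon> t \<omega> - stopped_simple_integral j n \<tau> \<xi> t \<omega>\<bar>
        \<le> (\<Sum>i<n. \<bar>\<xi> i \<omega>\<bar>) * (2 * \<eta>')"
      by (rule forward_approximation_simple_bound[OF sd j \<omega>(1) t \<epsilon>(1)]) (use mod[rule_format, of \<omega>] \<omega> \<epsilon> in auto)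
    also have "\<dots> \<le> B * (2 * \<eta>')"
      unfolding B_def using K \<omega> \<eta>' by (intro mult_right_mono sum_mono) auto
    finally show "\<bar>forward_approximation (X j) (simple_process n \<tau> \<xi>) \<epsilon> t \<omega> - stopped_simple_integral j n \<tau> \<xi> t \<omega>\<bar> \<le> \<eta>"
      using \<eta>'(2) by linarith
  qed
  then show ?thesis
    unfolding eventually_at_right_field
    by (intro exI[of _ "min \<rho> 1"] conjI allI impI) (use \<rho> in simp_all)
qed

end

section \<open>Limits in probability\<close>

context prob_space
begin

lemma sup_small_at_end:
  assumes "sup_small T \<eta> \<delta> f" "0 \<le> T"
  shows "sup_small 0 \<eta> \<delta> (\<lambda>t. f T)"
proof -
  obtain A where A: "A \<in> sets M" "measure M A < \<delta>"
    "\<And>\<omega> t. \<omega> \<in> space M \<Longrightarrow> \<omega> \<notin> A \<Longrightarrow> 0 \<le> t \<Longrightarrow> t \<le> T \<Longrightarrow> \<bar>f t \<omega>\<bar> \<le> \<eta>" by (rule sup_smallE[OF assms(1)], rule that)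
  show ?thesis by (rule sup_smallI[OF A(1,2)]) (rule A(3), use assms(2) in simp_all)
qed

text \<open>Along a fast sequence of parameters the exceptional sets are summable.\<close>

lemma ucp_Cauchy_limit:
  fixes \<Phi> :: "real \<Rightarrow> real \<Rightarrow> 'a \<Rightarrow> real"
  assumes meas: "\<And>\<epsilon> t. 0 < \<epsilon> \<Longrightarrow> 0 \<le> t \<Longrightarrow> t \<le> T \<Longrightarrow> \<Phi> \<epsilon> t \<in> borel_measurable M"
    and Cauchy: "\<And>\<eta> \<delta>. \<eta> > 0 \<Longrightarrow> \<delta> > 0 \<Longrightarrow> \<exists>e>0. \<forall>\<epsilon> \<epsilon>'. 0 < \<epsilon> \<longrightarrow> \<epsilon> < e \<longrightarrow> 0 < \<epsilon>' \<longrightarrow> \<epsilon>' < e \<longrightarrow>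
      sup_small T \<eta> \<delta> (\<lambda>t \<omega>. \<Phi> \<epsilon> t \<omega> - \<Phi> \<epsilon>' t \<omega>)"
  obtains L where "\<And>t. 0 \<le> t \<Longrightarrow> t \<le> T \<Longrightarrow> L t \<in> borel_measurable M"
    and "\<And>\<eta> \<delta>. \<eta> > 0 \<Longrightarrow> \<delta> > 0 \<Longrightarrow> \<forall>\<^sub>F \<epsilon> in at_right 0. sup_small T \<eta> \<delta> (\<lambda>t \<omega>. \<Phi> \<epsilon> t \<omega> - L t \<omega>)"
proof -
  define r :: "nat \<Rightarrow> real" where "r i = (1 / 2) ^ i" for i
  have r: "r i > 0" "r (Suc i) = r i / 2" for i by (auto simp: r_def)
  have "\<forall>i. \<exists>e>0. \<forall>\<epsilon> \<epsilon>'. 0 < \<epsilon> \<longrightarrow> \<epsilon> < e \<longrightarrow> 0 < \<epsilon>' \<longrightarrow> \<epsilon>' < e \<longrightarrow>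
      sup_small T (r i) (r i) (\<lambda>t \<omega>. \<Phi> \<epsilon> t \<omega> - \<Phi> \<epsilon>' t \<omega>)"
    using Cauchy[OF r(1) r(1)] by blast
  from choice[OF this] obtain e where e: "\<And>i. e i > 0"
    "\<And>i \<epsilon> \<epsilon>'. 0 < \<epsilon> \<Longrightarrow> \<epsilon> < e i \<Longrightarrow> 0 < \<epsilon>' \<Longrightarrow> \<epsilon>' < e i \<Longrightarrow> sup_small T (r i) (r i) (\<lambda>t \<omega>. \<Phi> \<epsilon> t \<omega> - \<Phi> \<epsilon>' t \<omega>)"
    by blast
  \<comment> \<open>Staying below all of \<open>e 0\<close> to \<open>e i\<close> makes both
    \<open>q i\<close> and \<open>q (Suc i)\<close> admissible in the \<open>i\<close>-th Cauchy
    estimate, the bound \<open>r i\<close> sends them to 0, and halving makes the comparison with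
    \<open>e\<close> strict.\<close>
  define q where "q i = Min (insert (r i) (e ` {..i})) / 2" for i
  have q0: "q i > 0" for i
    unfolding q_def using r(1) e(1) by (simp add: Min_gr_iff)
  have qe: "q i < e k" if "k \<le> i" for i k
  proof -
    have "Min (insert (r i) (e ` {..i})) \<le> e k" using that by (intro Min_le) auto
    then show ?thesis using q0[of i] e(1)[of k] unfolding q_def by linarith
  qed
  have qr: "q i \<le> r i" for i
  proof -
    have "Min (insert (r i) (e ` {..i})) \<le> r i" by (intro Min_le) auto
    then show ?thesis using q0[of i] unfolding q_def by linarith
  qed
  have "\<forall>i. \<exists>A. A \<in> sets M \<and> measure M A < r i \<and>
      (\<forall>\<omega> t. \<omega> \<in> space M \<longrightarrow> \<omega> \<notin> A \<longrightarrow> 0 \<le> t \<longrightarrow> t \<le> T \<longrightarrow> \<bar>\<Phi> (q i) t \<omega> - \<Phi> (q (Suc i)) t \<omega>\<bar> \<le> r i)"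
  proof
    fix i
    have "sup_small T (r i) (r i) (\<lambda>t \<omega>. \<Phi> (q i) t \<omega> - \<Phi> (q (Suc i)) t \<omega>)"
      by (rule e(2)) (use q0 qe in auto)
    then show "\<exists>A. A \<in> sets M \<and> measure M A < r i \<and>
      (\<forall>\<omega> t. \<omega> \<in> space M \<longrightarrow> \<omega> \<notin> A \<longrightarrow> 0 \<le> t \<longrightarrow> t \<le> T \<longrightarrow> \<bar>\<Phi> (q i) t \<omega> - \<Phi> (q (Suc i)) t \<omega>\<bar> \<le> r i)"
      by (rule sup_smallE) blast
  qed
  from choice[OF this] obtain A where A: "\<And>i. A i \<in> sets M" "\<And>i. measure M (A i) < r i"
    "\<And>i \<omega> t. \<omega> \<in> space M \<Longrightarrow> \<omega> \<notin> A i \<Longrightarrow> 0 \<le> t \<Longrightarrow> t \<le> T \<Longrightarrow> \<bar>\<Phi> (q i) t \<omega> - \<Phi> (q (Suc i)) t \<omega>\<bar> \<le> r i"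
    by blast
  \<comment> \<open>Off \<open>B m\<close> every step from index \<open>m\<close> on is small at all
    times simultaneously; the probability of \<open>B m\<close> is bounded by a geometric
    tail.\<close>
  define B where "B m = (\<Union>i. A (i + m))" for m
  have B: "B m \<in> sets M" for m unfolding B_def using A(1) by auto
  have Bm: "measure M (B m) \<le> 2 * r m" for m
  proof -
    have geo: "(\<lambda>i. r (i + m)) sums (2 * r m)"
      using sums_mult2[OF geometric_sums[of "1 / 2 :: real"], of "r m"] by (simp add: r_def power_add)
    have "summable (\<lambda>i. measure M (A (i + m)))"
      using A(2) by (intro summable_comparison_test'[OF sums_summable[OF geo]]) (auto intro: less_imp_le)
    then have "measure M (B m) \<le> (\<Sum>i. measure M (A (i + m)))"
      unfolding B_def using A(1) by (intro finite_measure_subadditive_countably) auto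
    also have "\<dots> \<le> (\<Sum>i. r (i + m))"
      using \<open>summable (\<lambda>i. measure M (A (i + m)))\<close> sums_summable[OF geo] A(2)
      by (intro suminf_le) (auto intro: less_imp_le)
    finally show ?thesis using sums_unique[OF geo] by simp
  qed
  \<comment> \<open>\<open>lim\<close> is a total function, so measurability of \<open>L t\<close>
    does not wait for convergence, which holds off each \<open>B m\<close>.\<close>
  define L where "L t \<omega> = lim (\<lambda>i. \<Phi> (q i) t \<omega>)" for t \<omega>
  have Lm: "L t \<in> borel_measurable M" if "0 \<le> t" "t \<le> T" for t
    unfolding L_def[abs_def] by (rule borel_measurable_lim_metric) (use meas q0 that in auto)
  have close: "\<bar>\<Phi> (q m) t \<omega> - L t \<omega>\<bar> \<le> 2 * r m" if \<omega>: "\<omega> \<in> space M" "\<omega> \<notin> B m" and t: "0 \<le> t" "t \<le> T" for m t \<omega>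
  proof -
    define x where "x i = \<Phi> (q (i + m)) t \<omega>" for i
    have step: "\<bar>x i - x (Suc i)\<bar> \<le> r (i + m)" for i
      unfolding x_def using A(3)[of \<omega> "i + m" t] \<omega> t unfolding B_def by auto
    \<comment> \<open>The geometric sum is kept in closed form as a difference, so that the
      induction telescopes.\<close>
    have diff: "\<bar>x i - x (i + k)\<bar> \<le> 2 * r (i + m) - 2 * r (i + k + m)" for i k
    proof (induction k)
      case (Suc k)
      have "\<bar>x (i + k) - x (i + Suc k)\<bar> \<le> r (i + k + m)" using step[of "i + k"] by simp
      moreover have "r (i + Suc k + m) = r (i + k + m) / 2" using r(2)[of "i + k + m"] by simp
      ultimately show ?case using Suc by linarith
    qed simp
    have "Cauchy x"
    proof (rule metric_CauchyI)
      fix d :: real assume d: "d > 0"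
      obtain n where n: "(1 / 2 :: real) ^ n < d / 2" using real_arch_pow_inv[of "d / 2" "1 / 2"] d by auto
      have *: "dist (x i) (x (i + k)) < d" if "i \<ge> n" for i k
      proof -
        have "r (i + m) \<le> r n" unfolding r_def using that by (intro power_decreasing) auto
        then show ?thesis using diff[of i k] r(1)[of "i + k + m"] n unfolding dist_real_def r_def by linarith
      qed
      have "dist (x i) (x k) < d" if "i \<ge> n" "k \<ge> n" for i k
        using *[of i "k - i"] *[of k "i - k"] that by (cases "i \<le> k") (auto simp: dist_commute)
      then show "\<exists>n. \<forall>i\<ge>n. \<forall>k\<ge>n. dist (x i) (x k) < d" by blast
    qed
    then have "convergent x" by (rule Cauchy_convergent)
    then have "x \<longlonglongrightarrow> lim x" by (simp add: convergent_LIMSEQ_iff)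
    then have "(\<lambda>i. \<Phi> (q i) t \<omega>) \<longlonglongrightarrow> lim x" unfolding x_def by (rule LIMSEQ_offset)
    then have "L t \<omega> = lim x" unfolding L_def by (rule limI)
    moreover have "\<bar>x 0 - lim x\<bar> \<le> 2 * r m"
    proof (rule LIMSEQ_le_const2)
      show "(\<lambda>i. \<bar>x 0 - x i\<bar>) \<longlonglongrightarrow> \<bar>x 0 - lim x\<bar>" by (intro tendsto_intros \<open>x \<longlonglongrightarrow> lim x\<close>)
      show "\<exists>N. \<forall>i\<ge>N. \<bar>x 0 - x i\<bar> \<le> 2 * r m"
      proof (intro exI allI impI)
        fix i :: nat
        show "\<bar>x 0 - x i\<bar> \<le> 2 * r m" using diff[of 0 i] r(1)[of "i + m"] by simp
      qed
    qed
    ultimately show ?thesis by (simp add: x_def)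
  qed
  have "\<forall>\<^sub>F \<epsilon> in at_right 0. sup_small T \<eta> \<delta> (\<lambda>t \<omega>. \<Phi> \<epsilon> t \<omega> - L t \<omega>)" if \<eta>: "\<eta> > 0" and \<delta>: "\<delta> > 0" for \<eta> \<delta>
  proof -
    obtain d where d: "d > 0" "\<And>\<epsilon> \<epsilon>'. 0 < \<epsilon> \<Longrightarrow> \<epsilon> < d \<Longrightarrow> 0 < \<epsilon>' \<Longrightarrow> \<epsilon>' < d \<Longrightarrow>
        sup_small T (\<eta> / 2) (\<delta> / 2) (\<lambda>t \<omega>. \<Phi> \<epsilon> t \<omega> - \<Phi> \<epsilon>' t \<omega>)"
      using Cauchy[of "\<eta> / 2" "\<delta> / 2"] \<eta> \<delta> by auto
    have "min d (min (\<eta> / 4) (\<delta> / 4)) > 0" using d \<eta> \<delta> by auto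
    then obtain m where m: "r m < min d (min (\<eta> / 4) (\<delta> / 4))"
      unfolding r_def using real_arch_pow_inv[of _ "1 / 2 :: real"] by (auto simp del: min_less_iff_conj)
    have L: "sup_small T (\<eta> / 2) (\<delta> / 2) (\<lambda>t \<omega>. \<Phi> (q m) t \<omega> - L t \<omega>)"
    proof (rule sup_smallI[OF B[of m]])
      show "measure M (B m) < \<delta> / 2" using Bm[of m] m by linarith
      fix \<omega> t assume "\<omega> \<in> space M" "\<omega> \<notin> B m" "0 \<le> t" "t \<le> T"
      from close[OF this] show "\<bar>\<Phi> (q m) t \<omega> - L t \<omega>\<bar> \<le> \<eta> / 2" using m by linarith
    qed
    \<comment> \<open>An arbitrary small \<epsilon> is linked to \<open>L\<close> through the single
      parameter \<open>q m\<close>.\<close>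
    have "sup_small T \<eta> \<delta> (\<lambda>t \<omega>. \<Phi> \<epsilon> t \<omega> - L t \<omega>)" if "0 < \<epsilon>" "\<epsilon> < d" for \<epsilon>
    proof -
      have "q m < d" using qr[of m] m by linarith
      have "sup_small T (\<eta> / 2 + \<eta> / 2) (\<delta> / 2 + \<delta> / 2) (\<lambda>t \<omega>. \<Phi> \<epsilon> t \<omega> - L t \<omega>)"
        by (rule sup_small_triangle[OF d(2)[OF that q0 \<open>q m < d\<close>] L]) (intro AE_I2 ballI, linarith)
      then show ?thesis by simp
    qed
    then show ?thesis
      unfolding eventually_at_right_field using d(1) by (intro exI[of _ d] conjI allI impI) auto
  qed
  with Lm show thesis by (rule that)
qed

text \<open>The time horizon \<open>0\<close> turns \<open>sup_small\<close> into a bound for a single random variable.\<close>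

definition limit_in_probability :: "(real \<Rightarrow> 'a \<Rightarrow> real) \<Rightarrow> ('a \<Rightarrow> real) \<Rightarrow> bool" where
  "limit_in_probability f g \<longleftrightarrow>
    (\<forall>\<eta>>0. \<forall>\<delta>>0. \<forall>\<^sub>F \<epsilon> in at_right 0. sup_small 0 \<eta> \<delta> (\<lambda>t \<omega>. f \<epsilon> \<omega> - g \<omega>))"

text \<open>An almost sure comparison as hypothesis covers sums and differences alike, including
  those where linearity of the path integral fails on a null set depending on \<epsilon>.\<close>

lemma limit_in_probability_combine:
  assumes f: "limit_in_probability f a" and g: "limit_in_probability g b"
    and h: "\<forall>\<^sub>F \<epsilon> in at_right 0. AE \<omega> in M. \<bar>h \<epsilon> \<omega> - c \<omega>\<bar> \<le> \<bar>f \<epsilon> \<omega> - a \<omega>\<bar> + \<bar>g \<epsilon> \<omega> - b \<omega>\<bar>"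
  shows "limit_in_probability h c"
  unfolding limit_in_probability_def
proof (intro allI impI)
  fix \<eta> \<delta> :: real assume "\<eta> > 0" "\<delta> > 0"
  then have "\<forall>\<^sub>F \<epsilon> in at_right 0. sup_small 0 (\<eta> / 2) (\<delta> / 2) (\<lambda>t \<omega>. f \<epsilon> \<omega> - a \<omega>)"
    "\<forall>\<^sub>F \<epsilon> in at_right 0. sup_small 0 (\<eta> / 2) (\<delta> / 2) (\<lambda>t \<omega>. g \<epsilon> \<omega> - b \<omega>)"
    using f g unfolding limit_in_probability_def by auto
  then show "\<forall>\<^sub>F \<epsilon> in at_right 0. sup_small 0 \<eta> \<delta> (\<lambda>t \<omega>. h \<epsilon> \<omega> - c \<omega>)"
    using h
  proof eventually_elim
    case (elim \<epsilon>)
    have "AE \<omega> in M. \<forall>t\<in>{0..0::real}. \<bar>h \<epsilon> \<omega> - c \<omega>\<bar> \<le> \<bar>f \<epsilon> \<omega> - a \<omega>\<bar> + \<bar>g \<epsilon> \<omega> - b \<omega>\<bar>"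
      using elim(3) by eventually_elim simp
    from sup_small_triangle[OF elim(1,2) this] show ?case by simp
  qed
qed

lemma limit_in_probability_const: "limit_in_probability (\<lambda>\<epsilon>. c) c"
proof -
  have "sup_small 0 \<eta> \<delta> (\<lambda>t \<omega>. c \<omega> - c \<omega>)" if "\<eta> > 0" "\<delta> > 0" for \<eta> \<delta>
    by (rule sup_smallI[of "{}"]) (use that in auto)
  then show ?thesis unfolding limit_in_probability_def by auto
qed

lemma limit_in_probability_sum:
  assumes "finite K" "\<And>j. j \<in> K \<Longrightarrow> limit_in_probability (f j) (a j)"
  shows "limit_in_probability (\<lambda>\<epsilon> \<omega>. \<Sum>j\<in>K. f j \<epsilon> \<omega>) (\<lambda>\<omega>. \<Sum>j\<in>K. a j \<omega>)"
  using assms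
proof (induction K rule: finite_induct)
  case empty
  show ?case using limit_in_probability_const[of "\<lambda>\<omega>. 0"] by simp
next
  case (insert j K)
  have "limit_in_probability (f j) (a j)" "limit_in_probability (\<lambda>\<epsilon> \<omega>. \<Sum>j\<in>K. f j \<epsilon> \<omega>) (\<lambda>\<omega>. \<Sum>j\<in>K. a j \<omega>)"
    using insert by auto
  then show ?case
    by (rule limit_in_probability_combine)
      (use insert.hyps in \<open>auto intro!: always_eventually simp: abs_if\<close>)
qed

text \<open>Parameters are chosen with summable exceptional probabilities, so Borel-Cantelli gives
  almost sure convergence along them, and Fatou's lemma passes the bound to the limit.\<close>

lemma limit_in_probability_square_le:
  assumes lim: "limit_in_probability f g"
    and f: "\<And>\<epsilon>. \<epsilon> > 0 \<Longrightarrow> f \<epsilon> \<in> borel_measurable M" and g: "g \<in> borel_measurable M"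
    and C: "\<And>\<epsilon>. \<epsilon> > 0 \<Longrightarrow> (\<integral>\<^sup>+\<omega>. ennreal ((f \<epsilon> \<omega>)\<^sup>2) \<partial>M) \<le> C"
  shows "(\<integral>\<^sup>+\<omega>. ennreal ((g \<omega>)\<^sup>2) \<partial>M) \<le> C"
proof -
  define r :: "nat \<Rightarrow> real" where "r i = (1 / 2) ^ i" for i
  have r: "r i > 0" for i by (auto simp: r_def)
  have "\<forall>i. \<exists>\<epsilon>>0. sup_small 0 (r i) (r i) (\<lambda>t \<omega>. f \<epsilon> \<omega> - g \<omega>)"
  proof
    fix i
    have "\<forall>\<^sub>F \<epsilon> in at_right 0. sup_small 0 (r i) (r i) (\<lambda>t \<omega>. f \<epsilon> \<omega> - g \<omega>)"
      using lim r unfolding limit_in_probability_def by blast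
    then obtain b where b: "b > 0" "\<And>y. y > 0 \<Longrightarrow> y < b \<Longrightarrow> sup_small 0 (r i) (r i) (\<lambda>t \<omega>. f y \<omega> - g \<omega>)"
      unfolding eventually_at_right_field by blast
    show "\<exists>\<epsilon>>0. sup_small 0 (r i) (r i) (\<lambda>t \<omega>. f \<epsilon> \<omega> - g \<omega>)"
      using b(1) b(2)[of "b / 2"] by (intro exI[of _ "b / 2"]) auto
  qed
  from choice[OF this] obtain \<epsilon> where \<epsilon>: "\<And>i. \<epsilon> i > 0"
    "\<And>i. sup_small 0 (r i) (r i) (\<lambda>t \<omega>. f (\<epsilon> i) \<omega> - g \<omega>)" by blast
  have "\<forall>i. \<exists>A. A \<in> sets M \<and> measure M A < r i \<and> (\<forall>\<omega>. \<omega> \<in> space M \<longrightarrow> \<omega> \<notin> A \<longrightarrow> \<bar>f (\<epsilon> i) \<omega> - g \<omega>\<bar> \<le> r i)"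
  proof
    fix i
    obtain A where A: "A \<in> sets M" "measure M A < r i"
      "\<And>\<omega> t::real. \<omega> \<in> space M \<Longrightarrow> \<omega> \<notin> A \<Longrightarrow> 0 \<le> t \<Longrightarrow> t \<le> 0 \<Longrightarrow> \<bar>f (\<epsilon> i) \<omega> - g \<omega>\<bar> \<le> r i"
      by (rule sup_smallE[OF \<epsilon>(2)[of i]], rule that)
    have "\<forall>\<omega>. \<omega> \<in> space M \<longrightarrow> \<omega> \<notin> A \<longrightarrow> \<bar>f (\<epsilon> i) \<omega> - g \<omega>\<bar> \<le> r i" using A(3)[of _ 0] by blast
    with A(1,2) show "\<exists>A. A \<in> sets M \<and> measure M A < r i \<and> (\<forall>\<omega>. \<omega> \<in> space M \<longrightarrow> \<omega> \<notin> A \<longrightarrow> \<bar>f (\<epsilon> i) \<omega> - g \<omega>\<bar> \<le> r i)"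
      by blast
  qed
  from choice[OF this] obtain A where A: "\<And>i. A i \<in> sets M" "\<And>i. measure M (A i) < r i"
    "\<And>i \<omega>. \<omega> \<in> space M \<Longrightarrow> \<omega> \<notin> A i \<Longrightarrow> \<bar>f (\<epsilon> i) \<omega> - g \<omega>\<bar> \<le> r i" by blast
  have "summable r" unfolding r_def[abs_def] by (rule summable_geometric) simp
  then have "summable (\<lambda>i. measure M (A i))"
    by (rule summable_comparison_test'[of _ 0]) (simp add: A(2) less_imp_le)
  then have "AE \<omega> in M. \<forall>\<^sub>F i in sequentially. \<omega> \<in> space M - A i"
    by (intro borel_cantelli_AE1 A(1)) (auto simp: emeasure_eq_measure)
  then have "AE \<omega> in M. (\<lambda>i. f (\<epsilon> i) \<omega>) \<longlonglongrightarrow> g \<omega>"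
  proof eventually_elim
    case (elim \<omega>)
    have "(\<lambda>i. f (\<epsilon> i) \<omega> - g \<omega>) \<longlonglongrightarrow> 0"
    proof (rule Lim_null_comparison)
      show "\<forall>\<^sub>F i in sequentially. norm (f (\<epsilon> i) \<omega> - g \<omega>) \<le> r i"
        using elim by eventually_elim (use A(3) in auto)
      show "r \<longlonglongrightarrow> 0" unfolding r_def[abs_def] by (rule LIMSEQ_realpow_zero) auto
    qed
    then show ?case by (rule LIM_zero_cancel)
  qed
  then have "(\<integral>\<^sup>+\<omega>. ennreal ((g \<omega>)\<^sup>2) \<partial>M) = (\<integral>\<^sup>+\<omega>. liminf (\<lambda>i. ennreal ((f (\<epsilon> i) \<omega>)\<^sup>2)) \<partial>M)"
  proof (intro nn_integral_cong_AE, eventually_elim)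
    case (elim \<omega>)
    then have "(\<lambda>i. ennreal ((f (\<epsilon> i) \<omega>)\<^sup>2)) \<longlonglongrightarrow> ennreal ((g \<omega>)\<^sup>2)"
      by (intro tendsto_ennrealI tendsto_power)
    then show ?case using lim_imp_Liminf[OF sequentially_bot] by metis
  qed
  also have "\<dots> \<le> liminf (\<lambda>i. \<integral>\<^sup>+\<omega>. ennreal ((f (\<epsilon> i) \<omega>)\<^sup>2) \<partial>M)"
    using f[OF \<epsilon>(1)] by (intro nn_integral_liminf) measurable
  also have "\<dots> \<le> liminf (\<lambda>i. C)" using C[OF \<epsilon>(1)] by (intro Liminf_mono always_eventually) auto
  also have "\<dots> = C" by (rule Liminf_const) simp
  finally show ?thesis .
qed

end

context orthonormal_family
begin

section \<open>Forward limits by density of simple processes\<close>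

context
  fixes T :: real assumes T: "T > 0"
begin

text \<open>The constant 144: the maximal inequality at level \<eta>/6 bounds the supremum by
  \<eta>/2 off a set of measure at most \<open>2 * energy / (\<eta> / 6)\<^sup>2\<close>, and this
  is below \<delta>/2 for an energy below \<open>\<delta> * \<eta>\<^sup>2 / 144\<close>. The other
  halves go to the convergence for the simple process.\<close>

lemma forward_approximation_near_simple:
  assumes j: "j \<in> J" and Y: "progressive T Y" "energy T Y < \<infinity>" and sd: "simple_data M F T n \<tau> \<xi>"
    and \<eta>: "\<eta> > 0" and \<delta>: "\<delta> > 0"
    and E: "energy T (\<lambda>s \<omega>. Y s \<omega> - simple_process n \<tau> \<xi> s \<omega>) < ennreal (\<delta> * \<eta>\<^sup>2 / 144)"
  shows "\<forall>\<^sub>F \<epsilon> in at_right 0. sup_small T \<eta> \<delta> (\<lambda>t \<omega>. forward_approximation (X j) Y \<epsilon> t \<omega> - stopped_simple_integral j n \<tau> \<xi> t \<omega>)"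
proof -
  define Z where "Z s \<omega> = Y s \<omega> - simple_process n \<tau> \<xi> s \<omega>" for s \<omega>
  have S: "progressive T (simple_process n \<tau> \<xi>)" "energy T (simple_process n \<tau> \<xi>) < \<infinity>"
    using simple_process_progressive[OF sd] energy_simple_process[OF sd] by auto
  have Z: "progressive T Z" unfolding Z_def[abs_def] by (rule progressive_diff[OF Y(1) S(1)])
  have EZ: "energy T Z < ennreal (\<delta> * \<eta>\<^sup>2 / 144)" using E by (simp add: Z_def[abs_def])
  then have EZ': "energy T Z < \<infinity>" by (rule less_trans) simp
  have "enn2real (energy T Z) < \<delta> * \<eta>\<^sup>2 / 144"
  proof -
    have "ennreal (enn2real (energy T Z)) < ennreal (\<delta> * \<eta>\<^sup>2 / 144)" using EZ EZ' by simp
    then show ?thesis by (subst (asm) ennreal_less_iff) simp_all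
  qed
  have small: "sup_small T (\<eta> / 2) (\<delta> / 2) (forward_approximation (X j) Z \<epsilon>)" if \<epsilon>: "\<epsilon> > 0" for \<epsilon>
  proof -
    obtain A where A: "A \<in> sets M" "{\<omega>\<in>space M. \<exists>t\<in>{0..T}. \<bar>forward_approximation (X j) Z \<epsilon> t \<omega>\<bar> > 3 * (\<eta> / 6)} \<subseteq> A"
      "measure M A \<le> 2 * enn2real (energy T Z) / (\<eta> / 6)\<^sup>2"
      using forward_approximation_maximal_inequality[OF T j Z EZ' \<epsilon>, of "\<eta> / 6"] \<eta> by auto
    have "2 * enn2real (energy T Z) / (\<eta> / 6)\<^sup>2 < 2 * (\<delta> * \<eta>\<^sup>2 / 144) / (\<eta> / 6)\<^sup>2"
      using \<open>enn2real (energy T Z) < \<delta> * \<eta>\<^sup>2 / 144\<close> \<eta> by (intro divide_strict_right_mono mult_strict_left_mono) auto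
    also have "\<dots> = \<delta> / 2" using \<eta> by (simp add: power2_eq_square field_simps)
    finally show ?thesis unfolding sup_small_def using A by (intro bexI[of _ A]) auto
  qed
  have "\<forall>\<^sub>F \<epsilon> in at_right 0. sup_small T (\<eta> / 2) (\<delta> / 2) (\<lambda>t \<omega>. forward_approximation (X j) (simple_process n \<tau> \<xi>) \<epsilon> t \<omega>
    - stopped_simple_integral j n \<tau> \<xi> t \<omega>)"
    by (rule simple_forward_convergence[OF sd j T]) (use \<eta> \<delta> in auto)
  moreover have "\<forall>\<^sub>F \<epsilon> in at_right (0::real). \<epsilon> > 0" by (rule eventually_at_right_less)
  ultimately show ?thesis
  proof eventually_elim
    case (elim \<epsilon>)
    have "AE \<omega> in M. \<forall>t\<in>{0..T}. \<bar>forward_approximation (X j) Y \<epsilon> t \<omega> - stopped_simple_integral j n \<tau> \<xi> t \<omega>\<bar>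
      \<le> \<bar>forward_approximation (X j) Z \<epsilon> t \<omega>\<bar> + \<bar>forward_approximation (X j) (simple_process n \<tau> \<xi>) \<epsilon> t \<omega>
        - stopped_simple_integral j n \<tau> \<xi> t \<omega>\<bar>"
      using AE_forward_approximation_diff[OF T j Y S elim(2)]
    proof eventually_elim
      case (elim \<omega>)
      show ?case
      proof
        fix t assume "t \<in> {0..T}"
        with elim have "forward_approximation (X j) Z \<epsilon> t \<omega> =
          forward_approximation (X j) Y \<epsilon> t \<omega> - forward_approximation (X j) (simple_process n \<tau> \<xi>) \<epsilon> t \<omega>"
          by (simp add: Z_def[abs_def])
        then show "\<bar>forward_approximation (X j) Y \<epsilon> t \<omega> - stopped_simple_integral j n \<tau> \<xi> t \<omega>\<bar>
          \<le> \<bar>forward_approximation (X j) Z \<epsilon> t \<omega>\<bar> + \<bar>forward_approximation (X j) (simple_process n \<tau> \<xi>) \<epsilon> t \<omega>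
            - stopped_simple_integral j n \<tau> \<xi> t \<omega>\<bar>" by linarith
      qed
    qed
    from sup_small_triangle[OF small[OF elim(2)] elim(1) this] show ?case by simp
  qed
qed

text \<open>The approximations for two small parameters are both close to the stopped integral of
  one simple process, hence to each other, so the Cauchy criterion holds before the limit is
  known.\<close>

lemma forward_limit_exists:
  assumes j: "j \<in> J" and Y: "progressive T Y" "energy T Y < \<infinity>"
    and approx: "\<And>\<delta>. \<delta> > 0 \<Longrightarrow> \<exists>n \<tau> \<xi>. simple_data M F T n \<tau> \<xi> \<and>
      energy T (\<lambda>s \<omega>. Y s \<omega> - simple_process n \<tau> \<xi> s \<omega>) < ennreal \<delta>"
  obtains L where "\<And>t. 0 \<le> t \<Longrightarrow> t \<le> T \<Longrightarrow> L t \<in> borel_measurable M"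
    and "\<And>\<eta> \<delta>. \<eta> > 0 \<Longrightarrow> \<delta> > 0 \<Longrightarrow>
      \<forall>\<^sub>F \<epsilon> in at_right 0. sup_small T \<eta> \<delta> (\<lambda>t \<omega>. forward_approximation (X j) Y \<epsilon> t \<omega> - L t \<omega>)"
proof (rule ucp_Cauchy_limit[of T "forward_approximation (X j) Y"])
  show "forward_approximation (X j) Y \<epsilon> t \<in> borel_measurable M" if "0 < \<epsilon>" "0 \<le> t" "t \<le> T" for \<epsilon> t
    by (rule forward_approximation_measurable[OF T j Y(1) that(1,3)])
  fix \<eta> \<delta> :: real assume \<eta>: "\<eta> > 0" and \<delta>: "\<delta> > 0"
  have "\<delta> / 2 * (\<eta> / 2)\<^sup>2 / 144 > 0" using \<eta> \<delta> by simp
  from approx[OF this] obtain n \<tau> \<xi> where sd: "simple_data M F T n \<tau> \<xi>"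
    and E: "energy T (\<lambda>s \<omega>. Y s \<omega> - simple_process n \<tau> \<xi> s \<omega>) < ennreal (\<delta> / 2 * (\<eta> / 2)\<^sup>2 / 144)" by blast
  have "\<forall>\<^sub>F \<epsilon> in at_right 0. sup_small T (\<eta> / 2) (\<delta> / 2) (\<lambda>t \<omega>. forward_approximation (X j) Y \<epsilon> t \<omega> - stopped_simple_integral j n \<tau> \<xi> t \<omega>)"
    by (rule forward_approximation_near_simple[OF j Y sd _ _ E]) (use \<eta> \<delta> in auto)
  then obtain e where e: "e > 0" "\<And>\<epsilon>. 0 < \<epsilon> \<Longrightarrow> \<epsilon> < e \<Longrightarrow>
      sup_small T (\<eta> / 2) (\<delta> / 2) (\<lambda>t \<omega>. forward_approximation (X j) Y \<epsilon> t \<omega> - stopped_simple_integral j n \<tau> \<xi> t \<omega>)"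
    unfolding eventually_at_right_field by blast
  show "\<exists>e>0. \<forall>\<epsilon> \<epsilon>'. 0 < \<epsilon> \<longrightarrow> \<epsilon> < e \<longrightarrow> 0 < \<epsilon>' \<longrightarrow> \<epsilon>' < e \<longrightarrow>
      sup_small T \<eta> \<delta> (\<lambda>t \<omega>. forward_approximation (X j) Y \<epsilon> t \<omega> - forward_approximation (X j) Y \<epsilon>' t \<omega>)"
  proof (intro exI[of _ e] conjI allI impI e(1))
    fix \<epsilon> \<epsilon>' assume "0 < \<epsilon>" "\<epsilon> < e" "0 < \<epsilon>'" "\<epsilon>' < e"
    have "sup_small T (\<eta> / 2 + \<eta> / 2) (\<delta> / 2 + \<delta> / 2) (\<lambda>t \<omega>. forward_approximation (X j) Y \<epsilon> t \<omega> - forward_approximation (X j) Y \<epsilon>' t \<omega>)"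
      by (rule sup_small_triangle[OF e(2)[OF \<open>0 < \<epsilon>\<close> \<open>\<epsilon> < e\<close>] e(2)[OF \<open>0 < \<epsilon>'\<close> \<open>\<epsilon>' < e\<close>]]) (intro AE_I2 ballI, linarith)
    then show "sup_small T \<eta> \<delta> (\<lambda>t \<omega>. forward_approximation (X j) Y \<epsilon> t \<omega> - forward_approximation (X j) Y \<epsilon>' t \<omega>)" by simp
  qed
qed (rule that)

lemma limit_in_probability_at_end:
  assumes "\<And>\<eta> \<delta>. \<eta> > 0 \<Longrightarrow> \<delta> > 0 \<Longrightarrow> \<forall>\<^sub>F \<epsilon> in at_right 0. sup_small T \<eta> \<delta> (\<lambda>t \<omega>. f \<epsilon> t \<omega> - L t \<omega>)"
  shows "limit_in_probability (\<lambda>\<epsilon>. f \<epsilon> T) (L T)"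
  unfolding limit_in_probability_def
proof (intro allI impI)
  fix \<eta> \<delta> :: real assume "\<eta> > 0" "\<delta> > 0"
  from assms[OF this] show "\<forall>\<^sub>F \<epsilon> in at_right 0. sup_small 0 \<eta> \<delta> (\<lambda>t \<omega>. f \<epsilon> T \<omega> - L T \<omega>)"
    by eventually_elim (use sup_small_at_end[of T] T in auto)
qed

text \<open>Forward approximation is linear, so \<open>c\<close> minus the simple integral is the
  forward limit for the difference of the integrands, and the uniform \<open>L\<^sup>2\<close> bound
  applies to it. This plays the role of the Ito isometry.\<close>

lemma forward_limit_simple_distance:
  assumes j: "j \<in> J" and Y: "progressive T Y" "energy T Y < \<infinity>" and sd: "simple_data M F T n \<tau> \<xi>"
    and c: "limit_in_probability (\<lambda>\<epsilon>. forward_approximation (X j) Y \<epsilon> T) c" "c \<in> borel_measurable M"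
    and E: "energy T (\<lambda>s \<omega>. Y s \<omega> - simple_process n \<tau> \<xi> s \<omega>) < \<infinity>"
  shows "(\<integral>\<^sup>+\<omega>. ennreal ((c \<omega> - simple_integral (X j) n \<tau> \<xi> \<omega>)\<^sup>2) \<partial>M)
    \<le> 2 * energy T (\<lambda>s \<omega>. Y s \<omega> - simple_process n \<tau> \<xi> s \<omega>)"
proof -
  define Z where "Z s \<omega> = Y s \<omega> - simple_process n \<tau> \<xi> s \<omega>" for s \<omega>
  have S: "progressive T (simple_process n \<tau> \<xi>)" "energy T (simple_process n \<tau> \<xi>) < \<infinity>"
    using simple_process_progressive[OF sd] energy_simple_process[OF sd] by auto
  have Z: "progressive T Z" unfolding Z_def[abs_def] by (rule progressive_diff[OF Y(1) S(1)])
  have EZ: "energy T Z < \<infinity>" using E by (simp add: Z_def[abs_def])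
  have "limit_in_probability (\<lambda>\<epsilon>. forward_approximation (X j) (simple_process n \<tau> \<xi>) \<epsilon> T) (stopped_simple_integral j n \<tau> \<xi> T)"
    by (rule limit_in_probability_at_end) (rule simple_forward_convergence[OF sd j T])
  then have Slim: "limit_in_probability (\<lambda>\<epsilon>. forward_approximation (X j) (simple_process n \<tau> \<xi>) \<epsilon> T) (simple_integral (X j) n \<tau> \<xi>)"
    unfolding stopped_simple_integral_end[OF sd] .
  have lim: "limit_in_probability (\<lambda>\<epsilon>. forward_approximation (X j) Z \<epsilon> T) (\<lambda>\<omega>. c \<omega> - simple_integral (X j) n \<tau> \<xi> \<omega>)"
  proof (rule limit_in_probability_combine[OF c(1) Slim])
    have "\<forall>\<^sub>F \<epsilon> in at_right (0::real). \<epsilon> > 0" by (rule eventually_at_right_less)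
    then show "\<forall>\<^sub>F \<epsilon> in at_right 0. AE \<omega> in M. \<bar>forward_approximation (X j) Z \<epsilon> T \<omega> - (c \<omega> - simple_integral (X j) n \<tau> \<xi> \<omega>)\<bar>
      \<le> \<bar>forward_approximation (X j) Y \<epsilon> T \<omega> - c \<omega>\<bar> + \<bar>forward_approximation (X j) (simple_process n \<tau> \<xi>) \<epsilon> T \<omega> - simple_integral (X j) n \<tau> \<xi> \<omega>\<bar>"
    proof eventually_elim
      case (elim \<epsilon>)
      show ?case
        using AE_forward_approximation_diff[OF T j Y S elim]
      proof eventually_elim
        case (elim \<omega>)
        have "T \<in> {0..T}" using T by simp
        with elim have "forward_approximation (X j) Z \<epsilon> T \<omega> =
          forward_approximation (X j) Y \<epsilon> T \<omega> - forward_approximation (X j) (simple_process n \<tau> \<xi>) \<epsilon> T \<omega>"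
          unfolding Z_def[abs_def] by (rule bspec)
        then show ?case by linarith
      qed
    qed
  qed
  have [measurable]: "simple_integral (X j) n \<tau> \<xi> \<in> borel_measurable M"
  proof -
    have "(\<lambda>\<omega>. \<xi> i \<omega> * (X j (\<tau> (Suc i)) \<omega> - X j (\<tau> i) \<omega>)) \<in> borel_measurable M" if "i < n" for i
    proof (intro borel_measurable_times borel_measurable_diff)
      have "\<xi> i \<in> borel_measurable (F (\<tau> i))" "0 \<le> \<tau> i" "0 \<le> \<tau> (Suc i)"
        using sd that unfolding simple_data_def by simp_all
      then show "\<xi> i \<in> borel_measurable M" "X j (\<tau> (Suc i)) \<in> borel_measurable M" "X j (\<tau> i) \<in> borel_measurable M"
        using filtration_measurable adapted[OF j] by blast+
    qed
    then show ?thesis unfolding simple_integral_def[abs_def] by (intro borel_measurable_sum) simp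
  qed
  show ?thesis
    unfolding Z_def[abs_def, symmetric]
  proof (rule limit_in_probability_square_le[OF lim])
    show "forward_approximation (X j) Z \<epsilon> T \<in> borel_measurable M" if "\<epsilon> > 0" for \<epsilon>
      by (rule forward_approximation_measurable[OF T j Z that order_refl])
    show "(\<integral>\<^sup>+\<omega>. ennreal ((forward_approximation (X j) Z \<epsilon> T \<omega>)\<^sup>2) \<partial>M) \<le> 2 * energy T Z" if "\<epsilon> > 0" for \<epsilon>
      using forward_approximation_sum_square[OF T, of "{j}" "\<lambda>_. Z" \<epsilon>] j Z EZ that by simp
  qed (use c(2) in measurable)
qed

text \<open>Used for the coordinates between two indices, this controls the tails of the
  series.\<close>

lemma forward_limit_sum_square:
  assumes K: "finite K" "K \<subseteq> J" and Y: "\<And>j. j \<in> K \<Longrightarrow> progressive T (Y j)" "\<And>j. j \<in> K \<Longrightarrow> energy T (Y j) < \<infinity>"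
    and c: "\<And>j. j \<in> K \<Longrightarrow> limit_in_probability (\<lambda>\<epsilon>. forward_approximation (X j) (Y j) \<epsilon> T) (c j)"
      "\<And>j. j \<in> K \<Longrightarrow> c j \<in> borel_measurable M"
  shows "(\<integral>\<^sup>+\<omega>. ennreal ((\<Sum>j\<in>K. c j \<omega>)\<^sup>2) \<partial>M) \<le> 2 * (\<Sum>j\<in>K. energy T (Y j))"
proof (rule limit_in_probability_square_le)
  show "limit_in_probability (\<lambda>\<epsilon> \<omega>. \<Sum>j\<in>K. forward_approximation (X j) (Y j) \<epsilon> T \<omega>) (\<lambda>\<omega>. \<Sum>j\<in>K. c j \<omega>)"
    by (rule limit_in_probability_sum[OF K(1) c(1)])
  show "(\<lambda>\<omega>. \<Sum>j\<in>K. forward_approximation (X j) (Y j) \<epsilon> T \<omega>) \<in> borel_measurable M" if "\<epsilon> > 0" for \<epsilon>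
    using K(2) Y(1) that by (intro borel_measurable_sum forward_approximation_measurable[OF T]) auto
  show "(\<integral>\<^sup>+\<omega>. ennreal ((\<Sum>j\<in>K. forward_approximation (X j) (Y j) \<epsilon> T \<omega>)\<^sup>2) \<partial>M) \<le> 2 * (\<Sum>j\<in>K. energy T (Y j))" if "\<epsilon> > 0" for \<epsilon>
    by (rule forward_approximation_sum_square[OF T K Y(1)]) (use Y(2) K(1) that in auto)
qed (use c(2) in auto)

end

end

section \<open>Approximation of predictable processes\<close>

text \<open>Matches \<open>distance2_sum_le\<close>: squared distances obey a triangle inequality
  with factors 2.\<close>

lemma ennreal_quarter_bound: "x < ennreal (\<delta> / 4) \<Longrightarrow> y < ennreal (\<delta> / 4) \<Longrightarrow> 0 < \<delta> \<Longrightarrow> 2 * x + 2 * y < ennreal \<delta>"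
proof -
  assume "x < ennreal (\<delta> / 4)" "y < ennreal (\<delta> / 4)" "0 < \<delta>"
  then obtain a b where ab: "x = ennreal a" "0 \<le> a" "y = ennreal b" "0 \<le> b"
    by (cases x; cases y) auto
  then have "a < \<delta> / 4" "b < \<delta> / 4"
    using \<open>x < ennreal (\<delta> / 4)\<close> \<open>y < ennreal (\<delta> / 4)\<close> by (simp_all add: ennreal_less_iff)
  then have "2 * a + 2 * b < \<delta>" by simp
  moreover have eq: "2 * x + 2 * y = ennreal (2 * a + 2 * b)" using ab by (simp add: ennreal_mult)
  ultimately show ?thesis unfolding eq using ab by (subst ennreal_less_iff) auto
qed

lemma sum_indicator_Ioc:
  fixes \<tau> :: "nat \<Rightarrow> real"
  assumes \<tau>: "\<And>i. \<tau> i \<le> \<tau> (Suc i)" and "k \<le> l"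
  shows "(\<Sum>i\<in>{k..<l}. indicator {\<tau> i<..\<tau> (Suc i)} u) = (indicator {\<tau> k<..\<tau> l} u :: real)"
  using assms(2)
proof (induction l rule: dec_induct)
  case (step l)
  have "\<tau> k \<le> \<tau> l" using lift_Suc_mono_le[of \<tau> k l] \<tau> step(1) by blast
  then show ?case using step \<tau>[of l] by (auto simp: indicator_def)
qed simp

context filtered_prob_space
begin

lemma filtration_sets_into_space: "A \<in> sets (F s) \<Longrightarrow> A \<subseteq> space M"
  using sets.sets_into_space[of A "F s"] by simp

lemma filtration_sets_into_sets: "A \<in> sets (F s) \<Longrightarrow> A \<in> sets M"
  using filtration_subalgebra unfolding subalgebra_def by blast

context
  fixes T :: real assumes T: "T > 0"
begin

section \<open>Integration over time and probability\<close>

lemma space_time_measure: "space (time_measure M T) = {0..T} \<times> space M"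
  by (simp add: space_pair_measure space_restrict_space)

lemma nn_integral_time_measure:
  assumes "f \<in> borel_measurable (time_measure M T)"
  shows "(\<integral>\<^sup>+p. f p \<partial>time_measure M T) = (\<integral>\<^sup>+s. indicator {0..T} s * (\<integral>\<^sup>+\<omega>. f (s, \<omega>) \<partial>M) \<partial>lborel)"
proof -
  have "(\<integral>\<^sup>+p. f p \<partial>time_measure M T) = (\<integral>\<^sup>+s. (\<integral>\<^sup>+\<omega>. f (s, \<omega>) \<partial>M) \<partial>restrict_space lborel {0..T})"
    by (rule nn_integral_fst[symmetric]) (rule assms)
  also have "\<dots> = (\<integral>\<^sup>+s. (\<integral>\<^sup>+\<omega>. f (s, \<omega>) \<partial>M) * indicator {0..T} s \<partial>lborel)"
    by (rule nn_integral_restrict_space) simp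
  finally show ?thesis by (simp add: mult.commute)
qed

lemma finite_time_measure: "finite_measure (time_measure M T)"
proof
  have "emeasure (time_measure M T) (space (time_measure M T)) = (\<integral>\<^sup>+p. 1 \<partial>time_measure M T)" by simp
  also have "\<dots> = (\<integral>\<^sup>+s. indicator {0..T} s \<partial>lborel)"
    by (subst nn_integral_time_measure) (simp_all add: emeasure_space_1)
  also have "\<dots> < \<infinity>" using T by simp
  finally show "emeasure (time_measure M T) (space (time_measure M T)) \<noteq> \<infinity>" by simp
qed

lemma energy_eq_nn_integral:
  assumes "(\<lambda>(s, \<omega>). Y s \<omega>) \<in> borel_measurable (time_measure M T)"
  shows "energy T Y = (\<integral>\<^sup>+p. ennreal ((case p of (s, \<omega>) \<Rightarrow> Y s \<omega>)\<^sup>2) \<partial>time_measure M T)"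
  using assms by (subst nn_integral_time_measure) (simp_all add: energy_def)

section \<open>The predictable sigma-algebra\<close>

definition predictable_rectangles :: "(real \<times> 'a) set set" where
  "predictable_rectangles = {{s<..t} \<times> A | s t A. 0 \<le> s \<and> s < t \<and> t \<le> T \<and> A \<in> sets (F s)}"

lemma predictable_rectanglesI:
  "0 \<le> s \<Longrightarrow> s < t \<Longrightarrow> t \<le> T \<Longrightarrow> A \<in> sets (F s) \<Longrightarrow> {s<..t} \<times> A \<in> predictable_rectangles"
  unfolding predictable_rectangles_def by blast

lemma predictable_rectanglesE:
  assumes "R \<in> predictable_rectangles"
  obtains s t A where "R = {s<..t} \<times> A" "0 \<le> s" "s < t" "t \<le> T" "A \<in> sets (F s)"
  using assms unfolding predictable_rectangles_def by blast

lemma predictable_rectangles_Pow: "predictable_rectangles \<subseteq> Pow ({0..T} \<times> space M)"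
  by (auto elim!: predictable_rectanglesE dest: filtration_sets_into_space)

lemma predictable_sigma_eq: "predictable_sigma M F T = sigma ({0..T} \<times> space M) predictable_rectangles"
  unfolding predictable_sigma_def predictable_rectangles_def ..

lemma sets_predictable_sigma: "sets (predictable_sigma M F T) = sigma_sets ({0..T} \<times> space M) predictable_rectangles"
  unfolding predictable_sigma_eq by (rule sets_measure_of[OF predictable_rectangles_Pow])

lemma space_predictable_sigma: "space (predictable_sigma M F T) = {0..T} \<times> space M"
  unfolding predictable_sigma_eq by (rule space_measure_of[OF predictable_rectangles_Pow])

lemma rectangle_time_measurable:
  assumes "0 \<le> s" "t \<le> T" "A \<in> sets M"
  shows "{s<..t} \<times> A \<in> sets (time_measure M T)"
proof (rule pair_measureI[OF _ assms(3)])
  have "{s<..t} \<subseteq> {0..T}" using assms by auto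
  then show "{s<..t} \<in> sets (restrict_space lborel {0..T})"
    by (auto simp: sets_restrict_space)
qed

lemma predictable_measurable_time_measure:
  assumes "f \<in> measurable (predictable_sigma M F T) N"
  shows "f \<in> measurable (time_measure M T) N"
proof (rule measurable_from_subalg[OF _ assms])
  have "sets (predictable_sigma M F T) \<subseteq> sets (time_measure M T)"
    unfolding sets_predictable_sigma space_time_measure[symmetric]
    by (intro sets.sigma_sets_subset subsetI)
      (auto elim!: predictable_rectanglesE intro!: rectangle_time_measurable filtration_sets_into_sets)
  then show "subalgebra (time_measure M T) (predictable_sigma M F T)"
    unfolding subalgebra_def space_predictable_sigma space_time_measure by simp
qed

text \<open>It suffices to trace the generating rectangles on \<open>{0..b}\<close>: if
  \<open>s \<le> b\<close> the event is known at time \<open>b\<close>, otherwise the trace is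
  empty.\<close>

lemma predictable_imp_progressive:
  assumes Y: "(\<lambda>(s, \<omega>). Y s \<omega>) \<in> borel_measurable (predictable_sigma M F T)"
  shows "progressive T Y"
  unfolding progressive_def
proof
  fix b assume b: "b \<in> {0..T}"
  define \<Omega> where "\<Omega> = {0..b} \<times> space M"
  have \<Omega>: "\<Omega> \<in> sets (borel \<Otimes>\<^sub>M F b)"
    unfolding \<Omega>_def using sets.top[of "F b"] by (intro pair_measureI) auto
  have "(\<lambda>p. p) \<in> measurable (restrict_space (borel \<Otimes>\<^sub>M F b) \<Omega>) (predictable_sigma M F T)"
    unfolding predictable_sigma_eq
  proof (rule measurable_measure_of[OF predictable_rectangles_Pow])
    show "(\<lambda>p. p) \<in> space (restrict_space (borel \<Otimes>\<^sub>M F b) \<Omega>) \<rightarrow> {0..T} \<times> space M"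
      using b by (auto simp: space_restrict_space \<Omega>_def)
    fix R assume "R \<in> predictable_rectangles"
    then obtain s t A where R: "R = {s<..t} \<times> A" "0 \<le> s" "s < t" "t \<le> T" "A \<in> sets (F s)"
      by (rule predictable_rectanglesE)
    have "R \<inter> \<Omega> \<in> sets (borel \<Otimes>\<^sub>M F b)"
    proof (cases "s \<le> b")
      case True
      have "A \<in> sets (F b)" using R(5) filtration_mono[OF True] by blast
      then have "({s<..t} \<inter> {0..b}) \<times> A \<in> sets (borel \<Otimes>\<^sub>M F b)" by (intro pair_measureI) auto
      moreover have "R \<inter> \<Omega> = ({s<..t} \<inter> {0..b}) \<times> A"
        using R(1) filtration_sets_into_space[OF R(5)] by (auto simp: \<Omega>_def)
      ultimately show ?thesis by simp
    next
      case False
      then have "R \<inter> \<Omega> = {}" using R(1) by (auto simp: \<Omega>_def)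
      then show ?thesis by simp
    qed
    then have "R \<inter> \<Omega> \<in> sets (restrict_space (borel \<Otimes>\<^sub>M F b) \<Omega>)"
      using \<Omega> by (subst sets_restrict_space_iff) auto
    moreover have "(\<lambda>p. p) -` R \<inter> space (restrict_space (borel \<Otimes>\<^sub>M F b) \<Omega>) = R \<inter> \<Omega>"
      by (auto simp: space_restrict_space space_pair_measure \<Omega>_def)
    ultimately show "(\<lambda>p. p) -` R \<inter> space (restrict_space (borel \<Otimes>\<^sub>M F b) \<Omega>) \<in> sets (restrict_space (borel \<Otimes>\<^sub>M F b) \<Omega>)"
      by simp
  qed
  from measurable_compose[OF this Y]
  have "(\<lambda>p. indicator \<Omega> p *\<^sub>R (case p of (s, \<omega>) \<Rightarrow> Y s \<omega>)) \<in> borel_measurable (borel \<Otimes>\<^sub>M F b)"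
    using \<Omega> by (subst (asm) borel_measurable_restrict_space_iff) auto
  then show "(\<lambda>(s, \<omega>). indicator {0..b} s * Y s \<omega>) \<in> borel_measurable (borel \<Otimes>\<^sub>M F b)"
    by (rule measurable_cong[THEN iffD1, rotated])
      (auto simp: space_pair_measure \<Omega>_def indicator_def)
qed

text \<open>Approximation is required on every sufficiently fine uniform grid, so that the approximable
  processes form a vector space without any merging of partitions.\<close>

definition grid :: "nat \<Rightarrow> nat \<Rightarrow> real" where
  "grid N i = T / real (Suc N) * real i"

definition grid_data :: "nat \<Rightarrow> (nat \<Rightarrow> 'a \<Rightarrow> real) \<Rightarrow> bool" where
  "grid_data N \<xi> \<longleftrightarrow> simple_data M F T (Suc N) (grid N) \<xi>"

definition grid_process :: "nat \<Rightarrow> (nat \<Rightarrow> 'a \<Rightarrow> real) \<Rightarrow> real \<times> 'a \<Rightarrow> real" where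
  "grid_process N \<xi> p = simple_process (Suc N) (grid N) \<xi> (fst p) (snd p)"

definition distance2 :: "(real \<times> 'a \<Rightarrow> real) \<Rightarrow> (real \<times> 'a \<Rightarrow> real) \<Rightarrow> ennreal" where
  "distance2 f g = (\<integral>\<^sup>+p. ennreal ((f p - g p)\<^sup>2) \<partial>time_measure M T)"

definition approximable :: "(real \<times> 'a \<Rightarrow> real) \<Rightarrow> bool" where
  "approximable f \<longleftrightarrow> f \<in> borel_measurable (time_measure M T) \<and>
    (\<forall>\<delta>>0. \<exists>N0. \<forall>N\<ge>N0. \<exists>\<xi>. grid_data N \<xi> \<and> distance2 f (grid_process N \<xi>) < ennreal \<delta>)"

lemma grid_bounds: "i \<le> Suc N \<Longrightarrow> 0 \<le> grid N i \<and> grid N i \<le> T" "grid N i \<le> grid N (Suc i)"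
proof -
  assume "i \<le> Suc N"
  then have "T / real (Suc N) * real i \<le> T / real (Suc N) * real (Suc N)"
    using T by (intro mult_left_mono) auto
  also have "\<dots> = T" by simp
  finally show "0 \<le> grid N i \<and> grid N i \<le> T" using T by (simp add: grid_def)
next
  show "grid N i \<le> grid N (Suc i)" unfolding grid_def using T by (intro mult_left_mono) auto
qed

lemma grid_dataI:
  assumes "\<And>i. i < Suc N \<Longrightarrow> \<xi> i \<in> borel_measurable (F (grid N i))"
    and "\<And>i. i < Suc N \<Longrightarrow> \<exists>K. \<forall>\<omega>\<in>space M. \<bar>\<xi> i \<omega>\<bar> \<le> K"
  shows "grid_data N \<xi>"
  unfolding grid_data_def simple_data_def using assms grid_bounds by auto

lemma grid_dataD:
  assumes "grid_data N \<xi>" "i < Suc N"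
  shows "\<xi> i \<in> borel_measurable (F (grid N i))" "\<exists>K. \<forall>\<omega>\<in>space M. \<bar>\<xi> i \<omega>\<bar> \<le> K"
  using assms unfolding grid_data_def simple_data_def by auto

lemma time_projection: "fst \<in> borel_measurable (time_measure M T)"
proof -
  have "(\<lambda>s. s) \<in> borel_measurable (restrict_space lborel {0..T})" by (intro measurable_restrict_space1) simp
  then show ?thesis by (rule measurable_compose[OF measurable_fst])
qed

lemma simple_process_measurable:
  assumes "simple_data M F T n \<tau> \<xi>"
  shows "(\<lambda>(s, \<omega>). simple_process n \<tau> \<xi> s \<omega>) \<in> borel_measurable (time_measure M T)"
proof -
  have "(\<lambda>p. \<xi> i (snd p) * indicator {\<tau> i<..\<tau> (Suc i)} (fst p)) \<in> borel_measurable (time_measure M T)" if "i < n" for i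
  proof -
    have "\<xi> i \<in> borel_measurable (F (\<tau> i))" using assms that unfolding simple_data_def by simp
    then have \<xi>: "\<xi> i \<in> borel_measurable M" by (rule filtration_measurable)
    show ?thesis
      by (intro borel_measurable_times measurable_compose[OF measurable_snd \<xi>]
          measurable_compose[OF time_projection borel_measurable_indicator]) simp
  qed
  then have "(\<lambda>p. \<Sum>i<n. \<xi> i (snd p) * indicator {\<tau> i<..\<tau> (Suc i)} (fst p)) \<in> borel_measurable (time_measure M T)"
    by (intro borel_measurable_sum) simp
  then show ?thesis by (simp add: simple_process_def case_prod_beta')
qed

lemma grid_process_measurable: "grid_data N \<xi> \<Longrightarrow> grid_process N \<xi> \<in> borel_measurable (time_measure M T)"
  using simple_process_measurable unfolding grid_data_def grid_process_def[abs_def] by (simp add: case_prod_beta')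

section \<open>Closure properties of approximable processes\<close>

text \<open>The pointwise hypothesis in absolute values serves both for passing through an
  intermediate function and for adding two approximations.\<close>

lemma distance2_sum_le:
  assumes "a \<in> borel_measurable (time_measure M T)" "b \<in> borel_measurable (time_measure M T)"
    "c \<in> borel_measurable (time_measure M T)" "d \<in> borel_measurable (time_measure M T)"
    and "\<And>p. p \<in> space (time_measure M T) \<Longrightarrow> \<bar>f p - g p\<bar> \<le> \<bar>a p - b p\<bar> + \<bar>c p - d p\<bar>"
  shows "distance2 f g \<le> 2 * distance2 a b + 2 * distance2 c d"
proof -
  have "distance2 f g \<le> (\<integral>\<^sup>+p. 2 * ennreal ((a p - b p)\<^sup>2) + 2 * ennreal ((c p - d p)\<^sup>2) \<partial>time_measure M T)"
    unfolding distance2_def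
  proof (rule nn_integral_mono)
    fix p assume "p \<in> space (time_measure M T)"
    from assms(5)[OF this] have "\<bar>f p - g p\<bar>\<^sup>2 \<le> (\<bar>a p - b p\<bar> + \<bar>c p - d p\<bar>)\<^sup>2" by (intro power_mono) auto
    also have "\<dots> \<le> 2 * (a p - b p)\<^sup>2 + 2 * (c p - d p)\<^sup>2"
      using sum_squares_bound[of "\<bar>a p - b p\<bar>" "\<bar>c p - d p\<bar>"] by (simp add: power2_sum)
    finally have "ennreal ((f p - g p)\<^sup>2) \<le> ennreal (2 * (a p - b p)\<^sup>2 + 2 * (c p - d p)\<^sup>2)"
      by (intro ennreal_leI) simp
    also have "\<dots> = 2 * ennreal ((a p - b p)\<^sup>2) + 2 * ennreal ((c p - d p)\<^sup>2)"
      by (simp add: ennreal_mult)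
    finally show "ennreal ((f p - g p)\<^sup>2) \<le> 2 * ennreal ((a p - b p)\<^sup>2) + 2 * ennreal ((c p - d p)\<^sup>2)" .
  qed
  also have "\<dots> = 2 * distance2 a b + 2 * distance2 c d"
    unfolding distance2_def using assms(1-4) by (simp add: nn_integral_add nn_integral_cmult)
  finally show ?thesis .
qed

text \<open>By the triangle inequality the threshold index of a nearby \<open>g\<close> also serves
  \<open>f\<close>.\<close>

lemma approximable_limit:
  assumes f: "f \<in> borel_measurable (time_measure M T)"
    and g: "\<And>\<delta>. \<delta> > 0 \<Longrightarrow> \<exists>g. approximable g \<and> distance2 f g < ennreal \<delta>"
  shows "approximable f"
  unfolding approximable_def
proof (intro conjI f allI impI)
  fix \<delta> :: real assume \<delta>: "\<delta> > 0"
  then obtain g where g: "approximable g" "distance2 f g < ennreal (\<delta> / 4)" using assms(2)[of "\<delta> / 4"] by auto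
  obtain N0 where N0: "\<And>N. N \<ge> N0 \<Longrightarrow> \<exists>\<xi>. grid_data N \<xi> \<and> distance2 g (grid_process N \<xi>) < ennreal (\<delta> / 4)"
    using g(1) \<delta> unfolding approximable_def by (meson zero_less_divide_iff zero_less_numeral)
  show "\<exists>N0. \<forall>N\<ge>N0. \<exists>\<xi>. grid_data N \<xi> \<and> distance2 f (grid_process N \<xi>) < ennreal \<delta>"
  proof (intro exI[of _ N0] allI impI)
    fix N assume "N \<ge> N0"
    from N0[OF this] obtain \<xi> where \<xi>: "grid_data N \<xi>" "distance2 g (grid_process N \<xi>) < ennreal (\<delta> / 4)" by blast
    have "distance2 f (grid_process N \<xi>) \<le> 2 * distance2 f g + 2 * distance2 g (grid_process N \<xi>)"
      using g(1) f grid_process_measurable[OF \<xi>(1)] unfolding approximable_def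
      by (intro distance2_sum_le) auto
    also have "\<dots> < ennreal \<delta>" by (rule ennreal_quarter_bound[OF g(2) \<xi>(2) \<delta>])
    finally show "\<exists>\<xi>. grid_data N \<xi> \<and> distance2 f (grid_process N \<xi>) < ennreal \<delta>" using \<xi>(1) by blast
  qed
qed

lemma approximable_combine:
  assumes f: "approximable f" and g: "approximable g"
  shows "approximable (\<lambda>p. a * f p + b * g p)"
proof -
  have m: "f \<in> borel_measurable (time_measure M T)" "g \<in> borel_measurable (time_measure M T)"
    using f g unfolding approximable_def by auto
  \<comment> \<open>One scale for both coefficients; it is at least 1, so that dividing by it is
    safe even if both are 0.\<close>
  define c where "c = max 1 (max (a\<^sup>2) (b\<^sup>2))"
  have c: "c \<ge> 1" "a\<^sup>2 \<le> c" "b\<^sup>2 \<le> c" by (auto simp: c_def)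
  have scale: "distance2 (\<lambda>p. a * f p) (\<lambda>p. a * f' p) < ennreal (\<delta> / 4)"
    if "a\<^sup>2 \<le> c" "distance2 f f' < ennreal (\<delta> / (4 * c))" "\<delta> > 0"
      "f \<in> borel_measurable (time_measure M T)" "f' \<in> borel_measurable (time_measure M T)" for a f f' \<delta>
  proof -
    have "distance2 (\<lambda>p. a * f p) (\<lambda>p. a * f' p) = (\<integral>\<^sup>+p. ennreal (a\<^sup>2) * ennreal ((f p - f' p)\<^sup>2) \<partial>time_measure M T)"
      unfolding distance2_def
      by (intro nn_integral_cong) (simp add: ennreal_mult[symmetric] right_diff_distrib[symmetric] power_mult_distrib)
    also have "\<dots> = ennreal (a\<^sup>2) * distance2 f f'"
      unfolding distance2_def using that(4,5) by (intro nn_integral_cmult) simp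
    also have "\<dots> \<le> ennreal c * distance2 f f'" using that(1) by (intro mult_right_mono ennreal_leI) auto
    also have "\<dots> < ennreal c * ennreal (\<delta> / (4 * c))"
      using that(2) c by (intro ennreal_mult_strict_left_mono) auto
    also have "\<dots> = ennreal (\<delta> / 4)" using c that(3) by (simp add: ennreal_mult[symmetric])
    finally show ?thesis .
  qed
  show ?thesis
    unfolding approximable_def
  proof (intro conjI allI impI)
    show "(\<lambda>p. a * f p + b * g p) \<in> borel_measurable (time_measure M T)" using m by simp
    fix \<delta> :: real assume \<delta>: "\<delta> > 0"
    then have "\<delta> / (4 * c) > 0" using c by simp
    then obtain N1 N2 where N1: "\<And>N. N \<ge> N1 \<Longrightarrow> \<exists>\<xi>. grid_data N \<xi> \<and> distance2 f (grid_process N \<xi>) < ennreal (\<delta> / (4 * c))"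
      and N2: "\<And>N. N \<ge> N2 \<Longrightarrow> \<exists>\<xi>. grid_data N \<xi> \<and> distance2 g (grid_process N \<xi>) < ennreal (\<delta> / (4 * c))"
      using f g unfolding approximable_def by meson
    show "\<exists>N0. \<forall>N\<ge>N0. \<exists>\<xi>. grid_data N \<xi> \<and> distance2 (\<lambda>p. a * f p + b * g p) (grid_process N \<xi>) < ennreal \<delta>"
    proof (intro exI[of _ "max N1 N2"] allI impI)
      fix N assume N: "N \<ge> max N1 N2"
      obtain \<xi> where \<xi>: "grid_data N \<xi>" "distance2 f (grid_process N \<xi>) < ennreal (\<delta> / (4 * c))" using N1[of N] N by auto
      obtain \<xi>' where \<xi>': "grid_data N \<xi>'" "distance2 g (grid_process N \<xi>') < ennreal (\<delta> / (4 * c))" using N2[of N] N by auto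
      define \<zeta> where "\<zeta> i \<omega> = a * \<xi> i \<omega> + b * \<xi>' i \<omega>" for i \<omega>
      have \<zeta>: "grid_data N \<zeta>"
      proof (rule grid_dataI)
        fix i assume i: "i < Suc N"
        show "\<zeta> i \<in> borel_measurable (F (grid N i))"
          unfolding \<zeta>_def[abs_def] using grid_dataD(1)[OF \<xi>(1) i] grid_dataD(1)[OF \<xi>'(1) i] by simp
        obtain K K' where K: "\<forall>\<omega>\<in>space M. \<bar>\<xi> i \<omega>\<bar> \<le> K" "\<forall>\<omega>\<in>space M. \<bar>\<xi>' i \<omega>\<bar> \<le> K'"
          using grid_dataD(2)[OF \<xi>(1) i] grid_dataD(2)[OF \<xi>'(1) i] by auto
        have "\<bar>\<zeta> i \<omega>\<bar> \<le> \<bar>a\<bar> * K + \<bar>b\<bar> * K'" if "\<omega> \<in> space M" for \<omega>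
          unfolding \<zeta>_def using K that
          by (intro order_trans[OF abs_triangle_ineq] add_mono) (auto simp: abs_mult intro!: mult_left_mono)
        then show "\<exists>K. \<forall>\<omega>\<in>space M. \<bar>\<zeta> i \<omega>\<bar> \<le> K" by blast
      qed
      have eq: "grid_process N \<zeta> p = a * grid_process N \<xi> p + b * grid_process N \<xi>' p" for p
        unfolding grid_process_def simple_process_def \<zeta>_def
        by (simp only: sum_distrib_left sum.distrib[symmetric]) (intro sum.cong refl, simp add: algebra_simps)
      have "distance2 (\<lambda>p. a * f p + b * g p) (grid_process N \<zeta>)
          \<le> 2 * distance2 (\<lambda>p. a * f p) (\<lambda>p. a * grid_process N \<xi> p) + 2 * distance2 (\<lambda>p. b * g p) (\<lambda>p. b * grid_process N \<xi>' p)"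
        using m grid_process_measurable[OF \<xi>(1)] grid_process_measurable[OF \<xi>'(1)]
        by (intro distance2_sum_le) (auto simp: eq)
      also have "\<dots> < ennreal \<delta>"
        by (intro ennreal_quarter_bound scale) (use c \<delta> \<xi> \<xi>' m grid_process_measurable in auto)
      finally show "\<exists>\<xi>. grid_data N \<xi> \<and> distance2 (\<lambda>p. a * f p + b * g p) (grid_process N \<xi>) < ennreal \<delta>"
        using \<zeta> by blast
    qed
  qed
qed

lemma approximable_cong:
  assumes "approximable g" "\<And>p. p \<in> space (time_measure M T) \<Longrightarrow> f p = g p"
  shows "approximable f"
proof -
  have "f \<in> borel_measurable (time_measure M T)"
    using assms measurable_cong[of "time_measure M T" f g borel] unfolding approximable_def by blast
  moreover have "distance2 f h = distance2 g h" for h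
    unfolding distance2_def by (intro nn_integral_cong) (simp add: assms(2))
  ultimately show ?thesis using assms(1) unfolding approximable_def by simp
qed

section \<open>Indicators of predictable sets\<close>

lemma nn_integral_strip:
  assumes "B \<in> sets borel"
  shows "(\<integral>\<^sup>+p. indicator B (fst p) \<partial>time_measure M T) \<le> emeasure lborel B"
proof -
  have "(\<integral>\<^sup>+p. indicator B (fst p) \<partial>time_measure M T) = (\<integral>\<^sup>+s. indicator {0..T} s * indicator B s \<partial>lborel)"
    using measurable_compose[OF time_projection borel_measurable_indicator[OF assms]]
    by (subst nn_integral_time_measure) (simp_all add: emeasure_space_1)
  also have "\<dots> \<le> (\<integral>\<^sup>+s. indicator B s \<partial>lborel)" by (intro nn_integral_mono) (auto simp: indicator_def)
  also have "\<dots> = emeasure lborel B" using assms by simp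
  finally show ?thesis .
qed

text \<open>The left end is rounded up and the right end down to the grid. Rounding up at the left
  is what keeps the coefficient adapted: \<open>A\<close> is known at every grid point used. The
  error sits on two strips, each shorter than the mesh.\<close>

lemma approximable_rectangle:
  assumes R: "R \<in> predictable_rectangles"
  shows "approximable (indicator R)"
proof -
  obtain s t A where R: "R = {s<..t} \<times> A" and st: "0 \<le> s" "s < t" "t \<le> T" and A: "A \<in> sets (F s)"
    using R by (rule predictable_rectanglesE)
  show ?thesis
    unfolding approximable_def
  proof (intro conjI allI impI)
    have "R \<in> sets (time_measure M T)" unfolding R using st A by (intro rectangle_time_measurable filtration_sets_into_sets) auto
    then show "indicator R \<in> borel_measurable (time_measure M T)" by simp
    fix \<delta> :: real assume \<delta>: "\<delta> > 0"
    have "min (\<delta> / 4) ((t - s) / 2) / T > 0" using \<delta> st T by simp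
    then obtain N0 where N0: "inverse (real (Suc N0)) < min (\<delta> / 4) ((t - s) / 2) / T" using reals_Archimedean by blast
    show "\<exists>N0. \<forall>N\<ge>N0. \<exists>\<xi>. grid_data N \<xi> \<and> distance2 (indicator R) (grid_process N \<xi>) < ennreal \<delta>"
    proof (intro exI[of _ N0] allI impI)
      fix N assume N: "N \<ge> N0"
      define w where "w = T / real (Suc N)"
      have w: "w > 0" using T by (simp add: w_def)
      have "inverse (real (Suc N)) \<le> inverse (real (Suc N0))" using N by (intro le_imp_inverse_le) auto
      then have "inverse (real (Suc N)) < min (\<delta> / 4) ((t - s) / 2) / T" using N0 by linarith
      then have "T * inverse (real (Suc N)) < min (\<delta> / 4) ((t - s) / 2)" using T by (simp add: field_simps)
      \<comment> \<open>The first bound makes the two strips small, the second keeps the rounded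
        ends in the right order.\<close>
      then have w': "w < \<delta> / 4" "w < (t - s) / 2" by (auto simp: w_def inverse_eq_divide)
      define k where "k = nat \<lceil>s / w\<rceil>"
      define l where "l = nat \<lfloor>t / w\<rfloor>"
      have "0 \<le> s / w" "0 \<le> t / w" using st w by auto
      then have "s / w \<le> real k" "real k < s / w + 1" "real l \<le> t / w" "t / w < real l + 1"
        unfolding k_def l_def by linarith+
      then have kl: "s \<le> w * real k" "w * real k < s + w" "w * real l \<le> t" "t - w < w * real l"
        using w by (auto simp: field_simps)
      moreover have "s + w < t - w" using w'(2) by (simp add: field_simps)
      ultimately have "w * real k < w * real l" by linarith
      then have "k \<le> l" using w by (simp add: mult_less_cancel_left_pos)
      have grid: "grid N i = w * real i" for i by (simp add: grid_def w_def)
      have "w * real l \<le> w * real (Suc N)" using kl(3) st(3) by (simp add: w_def)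
      then have lN: "l \<le> Suc N" using w by (simp only: mult_le_cancel_left_pos of_nat_le_iff)
      define \<xi> :: "nat \<Rightarrow> 'a \<Rightarrow> real" where "\<xi> i \<omega> = (if k \<le> i \<and> i < l then indicator A \<omega> else 0)" for i \<omega>
      have \<xi>: "grid_data N \<xi>"
      proof (rule grid_dataI)
        fix i
        show "\<xi> i \<in> borel_measurable (F (grid N i))"
        proof (cases "k \<le> i \<and> i < l")
          case True
          have "w * real k \<le> w * real i" using True w by (intro mult_left_mono) auto
          then have "s \<le> grid N i" using kl(1) by (simp add: grid)
          then have "A \<in> sets (F (grid N i))" using A filtration_mono by blast
          then have "indicator A \<in> borel_measurable (F (grid N i))" by (rule borel_measurable_indicator)
          then show ?thesis using True by (simp add: \<xi>_def[abs_def])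
        next
          case False
          then have "\<xi> i = (\<lambda>\<omega>. 0)" by (auto simp: \<xi>_def fun_eq_iff)
          then show ?thesis by simp
        qed
        show "\<exists>K. \<forall>\<omega>\<in>space M. \<bar>\<xi> i \<omega>\<bar> \<le> K" by (intro exI[of _ 1]) (simp add: \<xi>_def indicator_def)
      qed
      have gp: "grid_process N \<xi> p = indicator {w * real k<..w * real l} (fst p) * indicator A (snd p)" for p
      proof -
        have "grid_process N \<xi> p = (\<Sum>i\<in>{k..<l}. indicator A (snd p) * indicator {grid N i<..grid N (Suc i)} (fst p))"
          unfolding grid_process_def simple_process_def
          by (rule sum.mono_neutral_cong_right) (use lN in \<open>auto simp: \<xi>_def\<close>)
        also have "\<dots> = indicator A (snd p) * indicator {grid N k<..grid N l} (fst p)"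
          unfolding sum_distrib_left[symmetric] sum_indicator_Ioc[of "grid N" k l "fst p", OF grid_bounds(2) \<open>k \<le> l\<close>] ..
        finally show ?thesis by (simp add: grid)
      qed
      have "distance2 (indicator R) (grid_process N \<xi>) \<le> (\<integral>\<^sup>+p. indicator ({s<..w * real k} \<union> {w * real l<..t}) (fst p) \<partial>time_measure M T)"
        unfolding distance2_def
      proof (rule nn_integral_mono)
        fix p :: "real \<times> 'a"
        obtain u \<omega> where p: "p = (u, \<omega>)" by fastforce
        show "ennreal ((indicator R p - grid_process N \<xi> p)\<^sup>2) \<le> indicator ({s<..w * real k} \<union> {w * real l<..t}) (fst p)"
          unfolding gp p R using kl by (auto simp: indicator_def)
      qed
      also have "\<dots> \<le> emeasure lborel ({s<..w * real k} \<union> {w * real l<..t})" by (rule nn_integral_strip) simp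
      also have "\<dots> \<le> emeasure lborel {s<..w * real k} + emeasure lborel {w * real l<..t}"
        by (rule emeasure_subadditive) auto
      also have "\<dots> = ennreal ((w * real k - s) + (t - w * real l))" using kl by simp
      also have "\<dots> < ennreal \<delta>" using kl w' \<delta> by (intro ennreal_lessI) linarith+
      finally show "\<exists>\<xi>. grid_data N \<xi> \<and> distance2 (indicator R) (grid_process N \<xi>) < ennreal \<delta>" using \<xi> by blast
    qed
  qed
qed

text \<open>Rectangles do not meet time 0, yet the predictable space contains it. The slice at time
  0 is null, and complements can then be formed with the constant 1.\<close>

lemma approximable_one: "approximable (\<lambda>_. 1)"
proof (rule approximable_limit)
  fix \<delta> :: real assume \<delta>: "\<delta> > 0"
  have "space M \<in> sets (F 0)" using sets.top[of "F 0"] by simp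
  then have R: "{0<..T} \<times> space M \<in> predictable_rectangles" using T by (intro predictable_rectanglesI) auto
  have "distance2 (\<lambda>_. 1) (indicator ({0<..T} \<times> space M)) \<le> (\<integral>\<^sup>+p. indicator {0::real} (fst p) \<partial>time_measure M T)"
    unfolding distance2_def by (intro nn_integral_mono) (auto simp: space_time_measure indicator_def)
  also have "\<dots> \<le> emeasure lborel {0::real}" by (rule nn_integral_strip) simp
  also have "\<dots> < ennreal \<delta>" using \<delta> by simp
  finally show "\<exists>g. approximable g \<and> distance2 (\<lambda>_. 1) g < ennreal \<delta>"
    using approximable_rectangle[OF R] by blast
qed simp

lemma Int_stable_rectangles: "Int_stable predictable_rectangles"
proof (rule Int_stableI)
  fix R R' assume "R \<in> predictable_rectangles" "R' \<in> predictable_rectangles"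
  then obtain s t A s' t' A' where R: "R = {s<..t} \<times> A" "0 \<le> s" "s < t" "t \<le> T" "A \<in> sets (F s)"
    and R': "R' = {s'<..t'} \<times> A'" "0 \<le> s'" "s' < t'" "t' \<le> T" "A' \<in> sets (F s')"
    by (elim predictable_rectanglesE) blast
  show "R \<inter> R' \<in> predictable_rectangles"
  proof (cases "max s s' < min t t'")
    case True
    have "A \<in> sets (F (max s s'))" "A' \<in> sets (F (max s s'))"
      using R(5) R'(5) filtration_mono[of s "max s s'"] filtration_mono[of s' "max s s'"] by auto
    then have "{max s s'<..min t t'} \<times> (A \<inter> A') \<in> predictable_rectangles"
      using R R' True by (intro predictable_rectanglesI) auto
    moreover have "R \<inter> R' = {max s s'<..min t t'} \<times> (A \<inter> A')" using R(1) R'(1) by auto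
    ultimately show ?thesis by simp
  next
    case False
    \<comment> \<open>An empty intersection has to be exhibited as a rectangle: a genuine time
      interval times the empty event.\<close>
    then have "R \<inter> R' = {s<..t} \<times> {}" using R(1) R'(1) by auto
    then show ?thesis using predictable_rectanglesI[OF R(2-4), of "{}"] by simp
  qed
qed

lemma approximable_zero: "approximable (\<lambda>_. 0)"
  using approximable_combine[OF approximable_one approximable_one, of 0 0] by simp

lemma approximable_sum:
  fixes n :: nat
  assumes "\<And>i. i < n \<Longrightarrow> approximable (f i)"
  shows "approximable (\<lambda>p. \<Sum>i<n. f i p)"
  using assms
proof (induction n)
  case (Suc n)
  then have "approximable (\<lambda>p. 1 * (\<Sum>i<n. f i p) + 1 * f n p)" by (intro approximable_combine) auto
  then show ?case by simp
qed (simp add: approximable_zero)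

text \<open>Dynkin's theorem: rectangles are stable under intersection, complements are linear
  combinations with the constant 1, and a disjoint union is a limit of finite sums because the
  measure is finite.\<close>

lemma approximable_indicator:
  assumes "S \<in> sets (predictable_sigma M F T)"
  shows "approximable (indicator S)"
proof (rule sigma_sets_induct_disjoint[OF Int_stable_rectangles predictable_rectangles_Pow
      assms[unfolded sets_predictable_sigma], where P="\<lambda>S. approximable (indicator S)"])
  fix R assume "R \<in> predictable_rectangles"
  then show "approximable (indicator R)" by (rule approximable_rectangle)
next
  show "approximable (indicator {})" by (rule approximable_cong[OF approximable_zero]) simp
next
  fix S :: "(real \<times> 'a) set" assume "approximable (indicator S)"
  from approximable_combine[OF approximable_one this, of 1 "-1"]
  have "approximable (\<lambda>p. 1 * 1 + (-1) * indicator S p)" .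
  then show "approximable (indicator ({0..T} \<times> space M - S))"
    by (rule approximable_cong) (auto simp: space_time_measure indicator_def)
next
  fix S :: "nat \<Rightarrow> (real \<times> 'a) set"
  assume union: "disjoint_family S" "range S \<subseteq> sigma_sets ({0..T} \<times> space M) predictable_rectangles"
    "\<And>i. approximable (indicator (S i))"
  interpret TM: finite_measure "time_measure M T" by (rule finite_time_measure)
  have S: "S i \<in> sets (time_measure M T)" for i
  proof -
    have "S i \<in> sets (predictable_sigma M F T)" using union(2) by (auto simp: sets_predictable_sigma)
    then have "(indicator (S i) :: _ \<Rightarrow> real) \<in> borel_measurable (predictable_sigma M F T)" by simp
    from predictable_measurable_time_measure[OF this]
    have "indicator (S i) -` {1::real} \<inter> space (time_measure M T) \<in> sets (time_measure M T)"
      by (rule measurable_sets) simp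
    moreover have "S i \<subseteq> space (time_measure M T)"
      using sets.sets_into_space[OF \<open>S i \<in> sets (predictable_sigma M F T)\<close>]
      unfolding space_predictable_sigma space_time_measure .
    then have "indicator (S i) -` {1::real} \<inter> space (time_measure M T) = S i" by (auto simp: indicator_def split: if_splits)
    ultimately show ?thesis by simp
  qed
  show "approximable (indicator (\<Union>i. S i))"
  proof (rule approximable_limit)
    show "indicator (\<Union>i. S i) \<in> borel_measurable (time_measure M T)" using S by simp
    fix \<delta> :: real assume \<delta>: "\<delta> > 0"
    define m where "m i = measure (time_measure M T) (S i)" for i
    have "m sums measure (time_measure M T) (\<Union>i. S i)"
      unfolding m_def using S union(1) by (intro TM.finite_measure_UNION) auto
    then have "(\<lambda>n. \<Sum>i<n. m i) \<longlonglongrightarrow> measure (time_measure M T) (\<Union>i. S i)" by (simp add: sums_def)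
    from LIMSEQ_D[OF this \<delta>] obtain n where n: "\<bar>(\<Sum>i<n. m i) - measure (time_measure M T) (\<Union>i. S i)\<bar> < \<delta>" by auto
    have U: "(\<Union>i<n. S i) \<in> sets (time_measure M T)" using S by auto
    have "distance2 (indicator (\<Union>i. S i)) (\<lambda>p. \<Sum>i<n. indicator (S i) p)
        = (\<integral>\<^sup>+p. indicator ((\<Union>i. S i) - (\<Union>i<n. S i)) p \<partial>time_measure M T)"
      unfolding distance2_def
    proof (rule nn_integral_cong)
      fix p
      have "(\<Sum>i<n. indicator (S i) p) = (indicator (\<Union>i<n. S i) p :: real)"
        using union(1) by (intro indicator_UN_disjoint[symmetric]) (auto simp: disjoint_family_on_def)
      then show "ennreal ((indicator (\<Union>i. S i) p - (\<Sum>i<n. indicator (S i) p))\<^sup>2) = indicator ((\<Union>i. S i) - (\<Union>i<n. S i)) p"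
        by (auto simp: indicator_def)
    qed
    also have "\<dots> = emeasure (time_measure M T) ((\<Union>i. S i) - (\<Union>i<n. S i))"
      using S U by (intro nn_integral_indicator) auto
    also have "\<dots> = ennreal (measure (time_measure M T) (\<Union>i. S i) - measure (time_measure M T) (\<Union>i<n. S i))"
      using S U by (subst TM.emeasure_eq_measure) (subst TM.finite_measure_Diff, auto)
    also have "measure (time_measure M T) (\<Union>i<n. S i) = (\<Sum>i<n. m i)"
      unfolding m_def using S union(1)
      by (intro TM.finite_measure_finite_Union) (auto simp: disjoint_family_on_def)
    also have "ennreal (measure (time_measure M T) (\<Union>i. S i) - (\<Sum>i<n. m i)) < ennreal \<delta>"
      using n \<delta> by (intro ennreal_lessI) linarith+
    finally show "\<exists>g. approximable g \<and> distance2 (indicator (\<Union>i. S i)) g < ennreal \<delta>"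
      using approximable_sum[of n "\<lambda>i. indicator (S i)"] union(3) by blast
  qed
qed

section \<open>From indicators to square-integrable processes\<close>

text \<open>Induction over nonnegative measurable functions with square integrability as a side
  condition: it passes to summands and to the members of an increasing sequence by domination, and
  the limit step is dominated convergence with majorant \<open>u\<^sup>2\<close>.\<close>

lemma approximable_nonneg:
  assumes u: "u \<in> borel_measurable (predictable_sigma M F T)" "\<And>p. 0 \<le> u p"
    and fin: "(\<integral>\<^sup>+p. ennreal ((u p)\<^sup>2) \<partial>time_measure M T) < \<infinity>"
  shows "approximable u"
  using u fin
proof (induction rule: borel_measurable_induct_real)
  case (set A)
  then show ?case by (intro approximable_indicator)
next
  case (mult u c)
  show ?case
  proof (cases "c = 0")
    case True
    then show ?thesis using approximable_zero by simp
  next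
    \<comment> \<open>Only for \<open>c\<close> different from 0 does a finite norm of
      \<open>c * u\<close> say that \<open>u\<close> has one.\<close>
    case False
    have um: "u \<in> borel_measurable (time_measure M T)" by (rule predictable_measurable_time_measure[OF mult.hyps(2)])
    have "(\<integral>\<^sup>+p. ennreal ((c * u p)\<^sup>2) \<partial>time_measure M T) = ennreal (c\<^sup>2) * (\<integral>\<^sup>+p. ennreal ((u p)\<^sup>2) \<partial>time_measure M T)"
      using um by (simp add: power_mult_distrib ennreal_mult nn_integral_cmult)
    then have "(\<integral>\<^sup>+p. ennreal ((u p)\<^sup>2) \<partial>time_measure M T) < \<infinity>"
      using mult.prems False by (auto simp: ennreal_mult_less_top)
    from approximable_combine[OF mult.IH[OF this] approximable_zero, of c 0] show ?thesis by simp
  qed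
next
  case (add u v)
  have le: "(\<integral>\<^sup>+p. ennreal ((f p)\<^sup>2) \<partial>time_measure M T) < \<infinity>" if "\<And>p. 0 \<le> f p" "\<And>p. f p \<le> v p + u p" for f
  proof (rule le_less_trans[OF _ add.prems])
    show "(\<integral>\<^sup>+p. ennreal ((f p)\<^sup>2) \<partial>time_measure M T) \<le> (\<integral>\<^sup>+p. ennreal ((v p + u p)\<^sup>2) \<partial>time_measure M T)"
      using that by (intro nn_integral_mono ennreal_leI power_mono) auto
  qed
  have "approximable v" "approximable u"
    using add.IH add.hyps le[of v] le[of u] by auto
  from approximable_combine[OF this, of 1 1] show ?case by simp
next
  case (seq U)
  have Um: "U i \<in> borel_measurable (time_measure M T)" for i
    by (rule predictable_measurable_time_measure[OF seq.hyps(1)])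
  have um: "u \<in> borel_measurable (time_measure M T)" by (rule predictable_measurable_time_measure[OF u(1)])
  have lim: "(\<lambda>i. U i p) \<longlonglongrightarrow> u p" if "p \<in> space (time_measure M T)" for p
    using seq.hyps(4)[OF that[unfolded space_time_measure space_predictable_sigma[symmetric]]] .
  have le: "U i p \<le> u p" if "p \<in> space (time_measure M T)" for i p
  proof (rule incseq_le[OF _ lim[OF that]])
    show "incseq (\<lambda>i. U i p)" using seq.hyps(3) unfolding incseq_def le_fun_def by blast
  qed
  show ?case
  proof (rule approximable_limit[OF um])
    fix \<delta> :: real assume \<delta>: "\<delta> > 0"
    have "(\<lambda>i. \<integral>\<^sup>+p. norm (0 - (u p - U i p)\<^sup>2) \<partial>time_measure M T) \<longlonglongrightarrow> 0"
    proof (rule nn_integral_dominated_convergence_norm[where w="\<lambda>p. (u p)\<^sup>2"])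
      show "AE p in time_measure M T. norm ((u p - U i p)\<^sup>2) \<le> (u p)\<^sup>2" for i
        using le seq.hyps(2)[of i] by (intro AE_I2) (auto intro!: power_mono)
      show "AE p in time_measure M T. (\<lambda>i. (u p - U i p)\<^sup>2) \<longlonglongrightarrow> 0"
      proof (rule AE_I2)
        fix p assume "p \<in> space (time_measure M T)"
        from tendsto_power[OF tendsto_diff[OF tendsto_const lim[OF this]], of "u p" 2]
        show "(\<lambda>i. (u p - U i p)\<^sup>2) \<longlonglongrightarrow> 0" by simp
      qed
    qed (use um Um seq.prems in auto)
    then have "(\<lambda>i. distance2 u (U i)) \<longlonglongrightarrow> 0" by (simp add: distance2_def)
    moreover have "0 < ennreal \<delta>" using \<delta> by simp
    ultimately have "\<forall>\<^sub>F i in sequentially. distance2 u (U i) < ennreal \<delta>" by (rule order_tendstoD)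
    then obtain i where "distance2 u (U i) < ennreal \<delta>" by (auto simp: eventually_sequentially)
    moreover have "approximable (U i)"
    proof (rule seq.IH)
      have "(\<integral>\<^sup>+p. ennreal ((U i p)\<^sup>2) \<partial>time_measure M T) \<le> (\<integral>\<^sup>+p. ennreal ((u p)\<^sup>2) \<partial>time_measure M T)"
        using le seq.hyps(2) by (intro nn_integral_mono ennreal_leI power_mono) auto
      then show "(\<integral>\<^sup>+p. ennreal ((U i p)\<^sup>2) \<partial>time_measure M T) < \<infinity>" using seq.prems by (rule le_less_trans)
    qed
    ultimately show "\<exists>g. approximable g \<and> distance2 u g < ennreal \<delta>" by blast
  qed
qed

text \<open>Positive and negative part are dominated by the process, so both have finite norm, and
  their difference recovers it.\<close>

lemma predictable_L2_imp_approximable: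
  assumes "predictable_L2 M F T Y"
  shows "approximable (\<lambda>(s, \<omega>). Y s \<omega>)"
proof -
  define y where "y = (\<lambda>(s, \<omega>). Y s \<omega>)"
  have y: "y \<in> borel_measurable (predictable_sigma M F T)"
    using assms unfolding predictable_L2_def y_def by simp
  have "integrable (time_measure M T) (\<lambda>p. (y p)\<^sup>2)"
    using assms unfolding predictable_L2_def y_def by (simp add: case_prod_beta')
  then have fin: "(\<integral>\<^sup>+p. ennreal ((y p)\<^sup>2) \<partial>time_measure M T) < \<infinity>" by (simp add: integrable_iff_bounded)
  have le: "(\<integral>\<^sup>+p. ennreal ((f p)\<^sup>2) \<partial>time_measure M T) < \<infinity>" if "\<And>p. \<bar>f p\<bar> \<le> \<bar>y p\<bar>" for f
  proof (rule le_less_trans[OF _ fin])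
    show "(\<integral>\<^sup>+p. ennreal ((f p)\<^sup>2) \<partial>time_measure M T) \<le> (\<integral>\<^sup>+p. ennreal ((y p)\<^sup>2) \<partial>time_measure M T)"
      using that by (intro nn_integral_mono ennreal_leI) (simp add: abs_le_square_iff)
  qed
  have "approximable (\<lambda>p. max 0 (y p))" "approximable (\<lambda>p. max 0 (- y p))"
    using y by (auto intro!: approximable_nonneg le)
  from approximable_combine[OF this, of 1 "-1"] have "approximable (\<lambda>p. 1 * max 0 (y p) + - 1 * max 0 (- y p))" .
  then have "approximable y" by (rule approximable_cong) auto
  then show ?thesis by (simp add: y_def)
qed

lemma predictable_L2_simple_approximation:
  assumes Y: "predictable_L2 M F T Y" and \<delta>: "\<delta> > 0"
  shows "\<exists>n \<tau> \<xi>. simple_data M F T n \<tau> \<xi> \<and> energy T (\<lambda>s \<omega>. Y s \<omega> - simple_process n \<tau> \<xi> s \<omega>) < ennreal \<delta>"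
proof -
  obtain N \<xi> where \<xi>: "grid_data N \<xi>" "distance2 (\<lambda>(s, \<omega>). Y s \<omega>) (grid_process N \<xi>) < ennreal \<delta>"
    using predictable_L2_imp_approximable[OF Y] \<delta> unfolding approximable_def by blast
  have sd: "simple_data M F T (Suc N) (grid N) \<xi>" using \<xi>(1) unfolding grid_data_def .
  have Ym: "(\<lambda>(s, \<omega>). Y s \<omega>) \<in> borel_measurable (time_measure M T)"
    using Y unfolding predictable_L2_def by (intro predictable_measurable_time_measure) simp
  have "energy T (\<lambda>s \<omega>. Y s \<omega> - simple_process (Suc N) (grid N) \<xi> s \<omega>) = distance2 (\<lambda>(s, \<omega>). Y s \<omega>) (grid_process N \<xi>)"
    unfolding distance2_def using borel_measurable_diff[OF Ym simple_process_measurable[OF sd]]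
    by (subst energy_eq_nn_integral) (simp_all add: case_prod_beta' grid_process_def)
  then show ?thesis using sd \<xi>(2) by (intro exI conjI) (assumption, simp)
qed

lemma predictable_L2_energy:
  assumes Y: "predictable_L2 M F T Y"
  shows "energy T Y < \<infinity>" "progressive T Y"
proof -
  have "(\<lambda>(s, \<omega>). Y s \<omega>) \<in> borel_measurable (time_measure M T)"
    using Y unfolding predictable_L2_def by (intro predictable_measurable_time_measure) simp
  from energy_eq_nn_integral[OF this] show "energy T Y < \<infinity>"
    using Y unfolding predictable_L2_def by (simp add: integrable_iff_bounded case_prod_beta')
  show "progressive T Y" using Y unfolding predictable_L2_def by (intro predictable_imp_progressive) simp
qed

text \<open>Translates the convergence demanded by \<open>has_ito_integral\<close>, stated on the
  product space, into the iterated integral in which the estimates are written.\<close>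

lemma L2_tendsto_simple_process_iff:
  assumes Y: "predictable_L2 M F T Y" and sd: "\<And>k. simple_data M F T (n k) (\<tau> k) (\<xi> k)"
  shows "L2_tendsto (time_measure M T) (\<lambda>k (s, \<omega>). simple_process (n k) (\<tau> k) (\<xi> k) s \<omega>) (\<lambda>(s, \<omega>). Y s \<omega>) \<longleftrightarrow>
    (\<lambda>k. energy T (\<lambda>s \<omega>. Y s \<omega> - simple_process (n k) (\<tau> k) (\<xi> k) s \<omega>)) \<longlonglongrightarrow> 0"
proof -
  have Ym: "(\<lambda>(s, \<omega>). Y s \<omega>) \<in> borel_measurable (time_measure M T)"
    using Y unfolding predictable_L2_def by (intro predictable_measurable_time_measure) simp
  have "energy T (\<lambda>s \<omega>. Y s \<omega> - simple_process (n k) (\<tau> k) (\<xi> k) s \<omega>)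
      = (\<integral>\<^sup>+p. ennreal (((case p of (s, \<omega>) \<Rightarrow> simple_process (n k) (\<tau> k) (\<xi> k) s \<omega>) - (case p of (s, \<omega>) \<Rightarrow> Y s \<omega>))\<^sup>2) \<partial>time_measure M T)" for k
    using borel_measurable_diff[OF Ym simple_process_measurable[OF sd[of k]]]
    by (subst energy_eq_nn_integral) (simp_all add: case_prod_beta' power2_commute)
  then show ?thesis
    unfolding L2_tendsto_def using Ym simple_process_measurable[OF sd] by simp
qed

end
end

section \<open>The extended cylindrical Wiener process\<close>

text \<open>The second part is nonnegativity of the variance.\<close>

lemma (in prob_space) square_integrable_imp_integrable:
  fixes f :: "'a \<Rightarrow> real"
  assumes "f \<in> borel_measurable M" "integrable M (\<lambda>\<omega>. (f \<omega>)\<^sup>2)"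
  shows "integrable M f" "(\<integral>\<omega>. f \<omega> \<partial>M)\<^sup>2 \<le> (\<integral>\<omega>. (f \<omega>)\<^sup>2 \<partial>M)"
proof -
  show "integrable M f"
    using integrable_mult_of_squares[OF assms(1) _ assms(2), of "\<lambda>_. 1"] by simp
  from variance_eq[OF this assms(2)] show "(\<integral>\<omega>. f \<omega> \<partial>M)\<^sup>2 \<le> (\<integral>\<omega>. (f \<omega>)\<^sup>2 \<partial>M)"
    using variance_positive[of f] by simp
qed

text \<open>Closes the density arguments below, whose errors are linear in the distance \<eta> of
  the approximation; \<eta> < 1 lets squares of \<eta> be absorbed.\<close>

lemma real_eq_0_if_small:
  fixes a C :: real
  assumes "\<And>\<eta>. 0 < \<eta> \<Longrightarrow> \<eta> < 1 \<Longrightarrow> \<bar>a\<bar> \<le> C * \<eta>"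
  shows "a = 0"
proof (rule ccontr)
  assume "a \<noteq> 0"
  have "0 \<le> C" using assms[of "1 / 2"] by simp
  \<comment> \<open>Adding 1 to \<open>C\<close> covers \<open>C = 0\<close>; the minimum with 1/2
    keeps the witness below 1.\<close>
  define \<eta> where "\<eta> = min (1 / 2) (\<bar>a\<bar> / (2 * (C + 1)))"
  have "0 < \<eta>" "\<eta> < 1" using \<open>a \<noteq> 0\<close> \<open>0 \<le> C\<close> by (auto simp: \<eta>_def)
  have "C * \<eta> \<le> C * (\<bar>a\<bar> / (2 * (C + 1)))" using \<open>0 \<le> C\<close> by (intro mult_left_mono) (auto simp: \<eta>_def)
  also have "\<dots> < \<bar>a\<bar>" using \<open>a \<noteq> 0\<close> \<open>0 \<le> C\<close> by (simp add: field_simps add_nonneg_pos)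
  finally show False using assms[OF \<open>0 < \<eta>\<close> \<open>\<eta> < 1\<close>] by simp
qed

text \<open>The law is an image of the standard normal one, so its moments come by scaling with
  \<open>sqrt c\<close>, the degenerate case included.\<close>

lemma centered_gaussian_moments:
  assumes "0 \<le> c"
  shows "has_bochner_integral (centered_gaussian_law c) (\<lambda>x. x) 0"
    and "has_bochner_integral (centered_gaussian_law c) (\<lambda>x. x\<^sup>2) c"
proof -
  have m: "(\<lambda>x. sqrt c * x) \<in> measurable std_normal_distribution borel" by simp
  have "integrable std_normal_distribution (\<lambda>x. x)" "integrable std_normal_distribution (\<lambda>x. x\<^sup>2)"
    using integrable_std_normal_distribution_moment[of 1] integrable_std_normal_distribution_moment[of 2] by auto
  moreover have "(\<integral>x. x \<partial>std_normal_distribution) = 0" "(\<integral>x. x\<^sup>2 \<partial>std_normal_distribution) = 1"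
    using integral_std_normal_distribution_moment_odd[of 1] std_normal_distribution_even_moments(1)[of 1] by auto
  ultimately have 1: "has_bochner_integral std_normal_distribution (\<lambda>x. x) 0"
    "has_bochner_integral std_normal_distribution (\<lambda>x. x\<^sup>2) 1"
    by (simp_all add: has_bochner_integral_iff)
  have distr: "has_bochner_integral (centered_gaussian_law c) f i"
    if "has_bochner_integral std_normal_distribution (\<lambda>x. f (sqrt c * x)) i" "f \<in> borel_measurable borel" for f :: "real \<Rightarrow> real" and i
    using that(1) integrable_distr_eq[OF m that(2)] integral_distr[OF m that(2)]
    unfolding centered_gaussian_law_def has_bochner_integral_iff by simp
  show "has_bochner_integral (centered_gaussian_law c) (\<lambda>x. x) 0"
    by (rule distr) (use has_bochner_integral_mult_right[OF 1(1), of "sqrt c"] in simp_all)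
  show "has_bochner_integral (centered_gaussian_law c) (\<lambda>x. x\<^sup>2) c"
    by (rule distr) (use has_bochner_integral_mult_right[OF 1(2), of c] assms in \<open>simp_all add: power_mult_distrib\<close>)
qed

section \<open>The filtration and adaptedness of the extended process\<close>

locale completed_wiener = prob_space M for M :: "'a measure" +
  fixes Q :: "'v::real_inner \<Rightarrow> 'v" and B :: "real \<Rightarrow> 'v \<Rightarrow> 'a \<Rightarrow> real"
    and \<iota> :: "'v \<Rightarrow> 'w::{real_inner,complete_space}" and W :: "real \<Rightarrow> 'w \<Rightarrow> 'a \<Rightarrow> real"
  assumes wiener: "cylindrical_wiener M Q B"
    and completion: "is_completion_for Q \<iota>"
    and extension: "isometric_extension M B \<iota> W"
begin

definition generators :: "real \<Rightarrow> 'a set set" where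
  "generators t = {B s h -` A \<inter> space M | s h A. 0 \<le> s \<and> s \<le> t \<and> A \<in> sets borel} \<union> null_sets M"

abbreviation "F \<equiv> generated_filtration M B"

lemma B_measurable: "0 \<le> t \<Longrightarrow> B t h \<in> borel_measurable M"
  using wiener[unfolded cylindrical_wiener_def] by simp

lemma generators_sets: "generators t \<subseteq> sets M"
proof
  fix C assume "C \<in> generators t"
  then consider s h A where "C = B s h -` A \<inter> space M" "0 \<le> s" "A \<in> sets borel" | "C \<in> null_sets M"
    unfolding generators_def by auto
  then show "C \<in> sets M"
  proof cases
    case 1
    show ?thesis unfolding 1(1) by (rule measurable_sets[OF B_measurable[OF 1(2)] 1(3)])
  qed auto
qed

lemma generators_Pow: "generators t \<subseteq> Pow (space M)"
  by (rule subset_trans[OF generators_sets sets.space_closed])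

lemma sets_F: "sets (F t) = sigma_sets (space M) (generators t)"
  unfolding generated_filtration_def generators_def[symmetric] by (rule sets_measure_of[OF generators_Pow])

lemma space_F: "space (F t) = space M"
  unfolding generated_filtration_def generators_def[symmetric] by (rule space_measure_of[OF generators_Pow])

sublocale filtered_prob_space M F
proof
  fix s t :: real
  show "subalgebra M (F t)"
    unfolding subalgebra_def sets_F space_F
    by (intro conjI refl sets.sigma_sets_subset generators_sets)
  assume "s \<le> t"
  have "generators s \<subseteq> generators t"
    unfolding generators_def
  proof (intro Un_mono order_refl subsetI)
    fix C assume "C \<in> {B u h -` A \<inter> space M | u h A. 0 \<le> u \<and> u \<le> s \<and> A \<in> sets borel}"
    then obtain u h A where "C = B u h -` A \<inter> space M" "0 \<le> u" "u \<le> s" "A \<in> sets borel" by blast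
    moreover have "u \<le> t" using \<open>u \<le> s\<close> \<open>s \<le> t\<close> by simp
    ultimately show "C \<in> {B u h -` A \<inter> space M | u h A. 0 \<le> u \<and> u \<le> t \<and> A \<in> sets borel}" by blast
  qed
  then show "sets (F s) \<subseteq> sets (F t)" unfolding sets_F by (rule sigma_sets_mono')
qed

lemma null_sets_F: "N \<in> null_sets M \<Longrightarrow> N \<in> sets (F t)"
  unfolding sets_F generators_def by (intro sigma_sets.Basic UnI2)

text \<open>The filtration contains every null set. Off the null set \<open>N\<close> the two
  preimages agree, and the part of the preimage under \<open>f\<close> inside \<open>N\<close> is
  itself a null set.\<close>

lemma measurable_F_AE:
  assumes f: "f \<in> borel_measurable M" and g: "g \<in> borel_measurable (F t)" and eq: "AE \<omega> in M. f \<omega> = g \<omega>"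
  shows "f \<in> borel_measurable (F t)"
proof (rule measurableI)
  fix A :: "'b set" assume A: "A \<in> sets borel"
  obtain N where N: "{\<omega>\<in>space M. f \<omega> \<noteq> g \<omega>} \<subseteq> N" "emeasure M N = 0" "N \<in> sets M" by (rule AE_E[OF eq])
  have fA: "f -` A \<inter> space M \<in> sets M" using f A by (rule measurable_sets)
  have eq: "f -` A \<inter> space M = ((g -` A \<inter> space (F t)) - N) \<union> ((f -` A \<inter> space M) \<inter> N)"
  proof (rule set_eqI)
    fix \<omega>
    have "f \<omega> = g \<omega>" if "\<omega> \<in> space M" "\<omega> \<notin> N" using N(1) that by blast
    then show "\<omega> \<in> f -` A \<inter> space M \<longleftrightarrow> \<omega> \<in> ((g -` A \<inter> space (F t)) - N) \<union> ((f -` A \<inter> space M) \<inter> N)"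
      by (cases "\<omega> \<in> N"; cases "\<omega> \<in> space M") (simp_all add: space_F)
  qed
  have "(f -` A \<inter> space M) \<inter> N \<in> sets (F t)"
    using null_set_Int1[OF null_setsI[OF N(2,3)] fA] by (intro null_sets_F) (simp only: Int_commute)
  moreover have "N \<in> sets (F t)" by (intro null_sets_F null_setsI N)
  moreover have "g -` A \<inter> space (F t) \<in> sets (F t)" using g A by (rule measurable_sets)
  ultimately show "f -` A \<inter> space (F t) \<in> sets (F t)"
    unfolding space_F by (subst eq) (intro sets.Un sets.Diff, simp_all only: space_F)
qed simp

lemma W_measurable: "0 \<le> t \<Longrightarrow> W t x \<in> borel_measurable M"
  using extension[unfolded isometric_extension_def] by simp

lemma W_square: "0 \<le> t \<Longrightarrow> has_bochner_integral M (\<lambda>\<omega>. (W t x \<omega>)\<^sup>2) (t * (norm x)\<^sup>2)"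
  using extension[unfolded isometric_extension_def] by simp

lemma W_embed: "0 \<le> t \<Longrightarrow> AE \<omega> in M. W t (\<iota> h) \<omega> = B t h \<omega>"
  using extension[unfolded isometric_extension_def] by simp

lemma W_add: "0 \<le> t \<Longrightarrow> AE \<omega> in M. W t (x + y) \<omega> = W t x \<omega> + W t y \<omega>"
  using extension[unfolded isometric_extension_def] by simp

lemma W_scale: "0 \<le> t \<Longrightarrow> AE \<omega> in M. W t (a *\<^sub>R x) \<omega> = a * W t x \<omega>"
  using extension[unfolded isometric_extension_def] by simp

lemma W_continuous: "AE \<omega> in M. continuous_on {0..} (\<lambda>t. W t x \<omega>)"
  using extension[unfolded isometric_extension_def] by simp

lemma W_diff:
  assumes "0 \<le> t"
  shows "AE \<omega> in M. W t (x - y) \<omega> = W t x \<omega> - W t y \<omega>"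
  using W_add[OF assms, of x "(-1) *\<^sub>R y"] W_scale[OF assms, of "-1" y] by eventually_elim simp

lemma embed_dense: "\<eta> > 0 \<Longrightarrow> \<exists>h. norm (x - \<iota> h) < \<eta>"
proof -
  assume "\<eta> > 0"
  moreover have "x \<in> closure (range \<iota>)" using completion unfolding is_completion_for_def by simp
  ultimately obtain y where "y \<in> range \<iota>" "dist y x < \<eta>" unfolding closure_approachable by blast
  then show ?thesis by (auto simp: dist_norm norm_minus_commute)
qed

lemma norm_embed: "(norm (\<iota> h))\<^sup>2 = inner (Q h) h"
  using completion unfolding is_completion_for_def by (simp add: power2_norm_eq_inner)

text \<open>By the isometry, \<open>W\<close> at embedded vectors tending to \<open>x\<close>
  converges in \<open>L\<^sup>2\<close>, hence almost surely along a subsequence. There it equals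
  \<open>B\<close>, which is adapted, and changes on null sets keep measurability for
  \<open>F t\<close>.\<close>

lemma W_adapted:
  assumes t: "0 \<le> t"
  shows "W t x \<in> borel_measurable (F t)"
proof -
  have "\<forall>n. \<exists>h. norm (x - \<iota> h) < inverse (real (Suc n))" using embed_dense by simp
  from choice[OF this] obtain h where h: "\<And>n. norm (x - \<iota> (h n)) < inverse (real (Suc n))" by blast
  \<comment> \<open>Squares are used because the isometry gives precisely their
    \<open>L\<^sup>1\<close> norms.\<close>
  define Z where "Z n \<omega> = (W t (x - \<iota> (h n)) \<omega>)\<^sup>2" for n \<omega>
  have Z: "has_bochner_integral M (Z n) (t * (norm (x - \<iota> (h n)))\<^sup>2)" for n
    unfolding Z_def[abs_def] by (rule W_square[OF t])
  have "(\<lambda>n. norm (x - \<iota> (h n))) \<longlonglongrightarrow> 0"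
    by (rule tendsto_sandwich[OF _ _ tendsto_const LIMSEQ_inverse_real_of_nat])
      (use h in \<open>auto intro!: always_eventually less_imp_le simp del: of_nat_Suc\<close>)
  then have "(\<lambda>n. t * (norm (x - \<iota> (h n)))\<^sup>2) \<longlonglongrightarrow> t * 0\<^sup>2" by (intro tendsto_intros)
  moreover have "(LINT \<omega>|M. norm (Z n \<omega>)) = t * (norm (x - \<iota> (h n)))\<^sup>2" for n
  proof -
    have "norm (Z n \<omega>) = Z n \<omega>" for \<omega> by (simp add: Z_def)
    then show ?thesis using Z[of n] by (simp only: has_bochner_integral_iff)
  qed
  ultimately have "(\<lambda>n. LINT \<omega>|M. norm (Z n \<omega>)) \<longlonglongrightarrow> 0" by simp
  from tendsto_L1_AE_subseq[OF _ this] obtain r where r: "strict_mono r" "AE \<omega> in M. (\<lambda>n. Z (r n) \<omega>) \<longlonglongrightarrow> 0"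
    using Z by (auto simp: has_bochner_integral_iff)
  define g where "g \<omega> = lim (\<lambda>n. B t (h (r n)) \<omega>)" for \<omega>
  have "B t h' \<in> borel_measurable (F t)" for h'
    using wiener[unfolded cylindrical_wiener_def] t by (simp add: brownian_motion_def)
  then have g: "g \<in> borel_measurable (F t)"
    unfolding g_def[abs_def] by (intro borel_measurable_lim_metric)
  have "AE \<omega> in M. \<forall>n. W t (x - \<iota> (h (r n))) \<omega> = W t x \<omega> - W t (\<iota> (h (r n))) \<omega>"
    unfolding AE_all_countable by (intro allI W_diff t)
  moreover have "AE \<omega> in M. \<forall>n. W t (\<iota> (h (r n))) \<omega> = B t (h (r n)) \<omega>"
    unfolding AE_all_countable by (intro allI W_embed t)
  ultimately have "AE \<omega> in M. W t x \<omega> = g \<omega>"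
    using r(2)
  proof eventually_elim
    case (elim \<omega>)
    have "(\<lambda>n. (W t x \<omega> - B t (h (r n)) \<omega>)\<^sup>2) \<longlonglongrightarrow> 0" using elim by (simp add: Z_def)
    then have "(\<lambda>n. sqrt ((W t x \<omega> - B t (h (r n)) \<omega>)\<^sup>2)) \<longlonglongrightarrow> sqrt 0" by (intro tendsto_real_sqrt)
    then have "(\<lambda>n. W t x \<omega> - B t (h (r n)) \<omega>) \<longlonglongrightarrow> 0" by (simp add: tendsto_rabs_zero_iff)
    from tendsto_diff[OF tendsto_const this, of "W t x \<omega>"]
    have "(\<lambda>n. B t (h (r n)) \<omega>) \<longlonglongrightarrow> W t x \<omega>" by simp
    then show ?case unfolding g_def by (rule limI[symmetric])
  qed
  with W_measurable[OF t] g show ?thesis by (rule measurable_F_AE)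
qed

section \<open>Conditional moments of increments\<close>

definition increment :: "real \<Rightarrow> real \<Rightarrow> 'w \<Rightarrow> 'a \<Rightarrow> real" where
  "increment s t x \<omega> = W t x \<omega> - W s x \<omega>"

context
  fixes s t :: real assumes st: "0 \<le> s" "s \<le> t"
begin

lemma t_nonneg: "0 \<le> t" using st by simp

lemma increment_measurable [measurable]: "increment s t x \<in> borel_measurable M"
  unfolding increment_def[abs_def] using W_measurable st by simp

text \<open>A crude bound from \<open>(a - b)\<^sup>2 \<le> 2 * a\<^sup>2 + 2 * b\<^sup>2\<close>.
  It serves as a continuity estimate in \<open>x\<close>, with which density then yields the exact
  variance.\<close>

lemma increment_square_integrable: "integrable M (\<lambda>\<omega>. (increment s t x \<omega>)\<^sup>2)"
  and increment_square_bound: "(\<integral>\<omega>. (increment s t x \<omega>)\<^sup>2 \<partial>M) \<le> 2 * (s + t) * (norm x)\<^sup>2"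
proof -
  have h: "has_bochner_integral M (\<lambda>\<omega>. 2 * (W t x \<omega>)\<^sup>2 + 2 * (W s x \<omega>)\<^sup>2) (2 * (t * (norm x)\<^sup>2) + 2 * (s * (norm x)\<^sup>2))"
    by (intro has_bochner_integral_add has_bochner_integral_mult_right W_square t_nonneg st)
  have le: "(increment s t x \<omega>)\<^sup>2 \<le> 2 * (W t x \<omega>)\<^sup>2 + 2 * (W s x \<omega>)\<^sup>2" for \<omega>
    using sum_squares_bound[of "W t x \<omega>" "- W s x \<omega>"] by (simp add: increment_def power2_diff)
  show i: "integrable M (\<lambda>\<omega>. (increment s t x \<omega>)\<^sup>2)"
  proof (rule Bochner_Integration.integrable_bound[OF integrable.intros[OF h]])
    show "AE \<omega> in M. norm ((increment s t x \<omega>)\<^sup>2) \<le> norm (2 * (W t x \<omega>)\<^sup>2 + 2 * (W s x \<omega>)\<^sup>2)"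
    proof (rule AE_I2)
      fix \<omega>
      show "norm ((increment s t x \<omega>)\<^sup>2) \<le> norm (2 * (W t x \<omega>)\<^sup>2 + 2 * (W s x \<omega>)\<^sup>2)"
        using le[of \<omega>] by simp
    qed
  qed measurable
  have "(\<integral>\<omega>. (increment s t x \<omega>)\<^sup>2 \<partial>M) \<le> (\<integral>\<omega>. 2 * (W t x \<omega>)\<^sup>2 + 2 * (W s x \<omega>)\<^sup>2 \<partial>M)"
    by (rule integral_mono[OF i integrable.intros[OF h] le])
  also have "\<dots> = 2 * (t * (norm x)\<^sup>2) + 2 * (s * (norm x)\<^sup>2)"
    using h by (rule has_bochner_integral_integral_eq)
  finally show "(\<integral>\<omega>. (increment s t x \<omega>)\<^sup>2 \<partial>M) \<le> 2 * (s + t) * (norm x)\<^sup>2" by (simp add: algebra_simps)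
qed

lemma increment_add: "AE \<omega> in M. increment s t (x + y) \<omega> = increment s t x \<omega> + increment s t y \<omega>"
  using W_add[OF t_nonneg, of x y] W_add[OF st(1), of x y] by eventually_elim (simp add: increment_def)

lemma increment_diff: "AE \<omega> in M. increment s t (x - y) \<omega> = increment s t x \<omega> - increment s t y \<omega>"
  using W_diff[OF t_nonneg, of x y] W_diff[OF st(1), of x y] by eventually_elim (simp add: increment_def)

text \<open>Here \<open>W\<close> coincides almost surely with \<open>B\<close>, whose increment is
  independent of \<open>F s\<close>; the integral factors and the normal law supplies the
  moments.\<close>

lemma embedded_increment_moments:
  assumes A: "A \<in> sets (F s)"
  shows "(\<integral>\<omega>. indicator A \<omega> * increment s t (\<iota> h) \<omega> \<partial>M) = 0"
    and "(\<integral>\<omega>. indicator A \<omega> * (increment s t (\<iota> h) \<omega>)\<^sup>2 \<partial>M) = measure M A * ((t - s) * (norm (\<iota> h))\<^sup>2)"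
proof -
  define D where "D \<omega> = B t h \<omega> - B s h \<omega>" for \<omega>
  have D[measurable]: "D \<in> borel_measurable M" unfolding D_def[abs_def] using B_measurable st by simp
  have AM[measurable]: "A \<in> sets M" by (rule filtration_sets_into_sets[OF A])
  have eq: "AE \<omega> in M. increment s t (\<iota> h) \<omega> = D \<omega>"
    using W_embed[OF t_nonneg, of h] W_embed[OF st(1), of h] by eventually_elim (simp add: increment_def D_def)
  have bm: "brownian_motion M F (inner (Q h) h) (\<lambda>t. B t h)"
    using wiener[unfolded cylindrical_wiener_def] by simp
  have "\<forall>s t. 0 \<le> s \<longrightarrow> s \<le> t \<longrightarrow>
      distr M borel (\<lambda>\<omega>. B t h \<omega> - B s h \<omega>) = centered_gaussian_law ((t - s) * inner (Q h) h) \<and>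
      indep_set (sets (F s)) (sets (vimage_algebra (space M) (\<lambda>\<omega>. B t h \<omega> - B s h \<omega>) borel))"
    using bm unfolding brownian_motion_def by (elim conjE)
  from this[rule_format, OF st] have law: "distr M borel D = centered_gaussian_law ((t - s) * inner (Q h) h)"
    and ind: "indep_set (sets (F s)) (sets (vimage_algebra (space M) D borel))"
    unfolding D_def[abs_def] by simp_all
  have c: "0 \<le> (t - s) * inner (Q h) h" using st by (simp add: norm_embed[symmetric])
  have Di: "integrable M D" "(\<integral>\<omega>. D \<omega> \<partial>M) = 0"
    using centered_gaussian_moments(1)[OF c] unfolding law[symmetric] has_bochner_integral_iff
    by (simp_all add: integrable_distr_eq integral_distr)
  have D2: "integrable M (\<lambda>\<omega>. (D \<omega>)\<^sup>2)" "(\<integral>\<omega>. (D \<omega>)\<^sup>2 \<partial>M) = (t - s) * inner (Q h) h"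
    using centered_gaussian_moments(2)[OF c] unfolding law[symmetric] has_bochner_integral_iff
    by (simp_all add: integrable_distr_eq integral_distr)
  \<comment> \<open>Independence is given for two sigma-algebras; the one generated by the indicator
    of \<open>A\<close> lies inside \<open>F s\<close>.\<close>
  have iv: "indep_var borel (indicator A :: 'a \<Rightarrow> real) borel D"
    unfolding indep_var_eq
  proof (intro conjI)
    show "indep_set (sigma_sets (space M) {indicator A -` C \<inter> space M |C. C \<in> sets (borel :: real measure)})
       (sigma_sets (space M) {D -` C \<inter> space M |C. C \<in> sets borel})"
      using ind unfolding indep_set_def
    proof (rule indep_sets_mono_sets)
      fix i :: bool
      have "(indicator A :: 'a \<Rightarrow> real) \<in> borel_measurable (F s)" using A by simp
      then have "{indicator A -` C \<inter> space M |C. C \<in> sets (borel :: real measure)} \<subseteq> sets (F s)"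
        using measurable_sets[of "indicator A :: 'a \<Rightarrow> real" "F s" borel] by (auto simp: space_F)
      then have "sigma_sets (space M) {indicator A -` C \<inter> space M |C. C \<in> sets (borel :: real measure)} \<subseteq> sets (F s)"
        using sets.sigma_sets_subset[of _ "F s"] by (simp add: space_F)
      moreover have "sigma_sets (space M) {D -` C \<inter> space M |C. C \<in> sets borel} \<subseteq> sets (vimage_algebra (space M) D borel)"
        by (simp add: sets_vimage_algebra)
      ultimately show "(case i of True \<Rightarrow> sigma_sets (space M) {indicator A -` C \<inter> space M |C. C \<in> sets (borel :: real measure)}
          | False \<Rightarrow> sigma_sets (space M) {D -` C \<inter> space M |C. C \<in> sets borel})
        \<subseteq> (case i of True \<Rightarrow> sets (F s) | False \<Rightarrow> sets (vimage_algebra (space M) D borel))"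
        by (cases i) auto
    qed
  qed auto
  have iA: "integrable M (indicator A :: 'a \<Rightarrow> real)" by (simp add: emeasure_eq_measure)
  have "(\<integral>\<omega>. indicator A \<omega> * increment s t (\<iota> h) \<omega> \<partial>M) = (\<integral>\<omega>. indicator A \<omega> * D \<omega> \<partial>M)"
    using eq by (intro integral_cong_AE) auto
  also have "\<dots> = (\<integral>\<omega>. indicator A \<omega> \<partial>M) * (\<integral>\<omega>. D \<omega> \<partial>M)"
    by (rule indep_var_lebesgue_integral[OF iv iA Di(1)])
  finally show "(\<integral>\<omega>. indicator A \<omega> * increment s t (\<iota> h) \<omega> \<partial>M) = 0" by (simp add: Di(2))
  have "indep_var borel ((\<lambda>x. x) \<circ> (indicator A :: 'a \<Rightarrow> real)) borel ((\<lambda>x. x\<^sup>2) \<circ> D)"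
    by (rule indep_var_compose[OF iv]) auto
  then have iv2: "indep_var borel (indicator A :: 'a \<Rightarrow> real) borel (\<lambda>\<omega>. (D \<omega>)\<^sup>2)" by (simp add: comp_def)
  have "(\<integral>\<omega>. indicator A \<omega> * (increment s t (\<iota> h) \<omega>)\<^sup>2 \<partial>M) = (\<integral>\<omega>. indicator A \<omega> * (D \<omega>)\<^sup>2 \<partial>M)"
    using eq by (intro integral_cong_AE) auto
  also have "\<dots> = (\<integral>\<omega>. indicator A \<omega> \<partial>M) * (\<integral>\<omega>. (D \<omega>)\<^sup>2 \<partial>M)"
    by (rule indep_var_lebesgue_integral[OF iv2 iA D2(1)])
  finally show "(\<integral>\<omega>. indicator A \<omega> * (increment s t (\<iota> h) \<omega>)\<^sup>2 \<partial>M) = measure M A * ((t - s) * (norm (\<iota> h))\<^sup>2)"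
    by (simp add: D2(2) norm_embed)
qed

lemma indicator_square_integrable:
  assumes "A \<in> sets M"
  shows "integrable M (\<lambda>\<omega>. (indicator A \<omega> * increment s t x \<omega>)\<^sup>2)"
    and "(\<integral>\<omega>. (indicator A \<omega> * increment s t x \<omega>)\<^sup>2 \<partial>M) \<le> 2 * (s + t) * (norm x)\<^sup>2"
proof -
  show i: "integrable M (\<lambda>\<omega>. (indicator A \<omega> * increment s t x \<omega>)\<^sup>2)"
    by (rule Bochner_Integration.integrable_bound[OF increment_square_integrable])
      (use assms in \<open>auto simp: indicator_def\<close>)
  have "(\<integral>\<omega>. (indicator A \<omega> * increment s t x \<omega>)\<^sup>2 \<partial>M) \<le> (\<integral>\<omega>. (increment s t x \<omega>)\<^sup>2 \<partial>M)"
    by (intro integral_mono i increment_square_integrable) (auto simp: indicator_def)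
  with increment_square_bound show "(\<integral>\<omega>. (indicator A \<omega> * increment s t x \<omega>)\<^sup>2 \<partial>M) \<le> 2 * (s + t) * (norm x)\<^sup>2"
    by (rule order_trans[rotated])
qed

text \<open>The mean vanishes at embedded vectors, and the remaining vector
  \<open>x - \<iota> h\<close> contributes at most the \<open>L\<^sup>2\<close> norm of its
  increment.\<close>

lemma increment_indicator_mean:
  assumes A: "A \<in> sets (F s)"
  shows "(\<integral>\<omega>. indicator A \<omega> * increment s t x \<omega> \<partial>M) = 0"
proof -
  have AM[measurable]: "A \<in> sets M" by (rule filtration_sets_into_sets[OF A])
  have int: "integrable M (\<lambda>\<omega>. indicator A \<omega> * increment s t y \<omega>)" for y
    by (rule square_integrable_imp_integrable(1)) (auto intro: indicator_square_integrable AM)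
  have "(\<integral>\<omega>. indicator A \<omega> * increment s t x \<omega> \<partial>M)\<^sup>2 = 0"
  proof (rule real_eq_0_if_small)
    fix \<eta> :: real assume \<eta>: "0 < \<eta>" "\<eta> < 1"
    obtain h where h: "norm (x - \<iota> h) < \<eta>" using embed_dense[OF \<eta>(1)] by blast
    have "(\<integral>\<omega>. indicator A \<omega> * increment s t (x - \<iota> h) \<omega> \<partial>M)
        = (\<integral>\<omega>. indicator A \<omega> * increment s t x \<omega> - indicator A \<omega> * increment s t (\<iota> h) \<omega> \<partial>M)"
      using increment_diff[of x "\<iota> h"] by (intro integral_cong_AE) (auto simp: right_diff_distrib)
    also have "\<dots> = (\<integral>\<omega>. indicator A \<omega> * increment s t x \<omega> \<partial>M)"
      using int embedded_increment_moments(1)[OF A] by simp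
    finally have "(\<integral>\<omega>. indicator A \<omega> * increment s t x \<omega> \<partial>M)\<^sup>2 = (\<integral>\<omega>. indicator A \<omega> * increment s t (x - \<iota> h) \<omega> \<partial>M)\<^sup>2" by simp
    also have "\<dots> \<le> (\<integral>\<omega>. (indicator A \<omega> * increment s t (x - \<iota> h) \<omega>)\<^sup>2 \<partial>M)"
      by (rule square_integrable_imp_integrable(2)) (auto intro: indicator_square_integrable AM)
    also have "\<dots> \<le> 2 * (s + t) * (norm (x - \<iota> h))\<^sup>2" by (rule indicator_square_integrable(2)[OF AM])
    also have "\<dots> \<le> 2 * (s + t) * \<eta>"
    proof (rule mult_left_mono)
      have "(norm (x - \<iota> h))\<^sup>2 \<le> \<eta> * 1" unfolding power2_eq_square using h \<eta> by (intro mult_mono) auto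
      then show "(norm (x - \<iota> h))\<^sup>2 \<le> \<eta>" by simp
    qed (use st in simp)
    finally show "\<bar>(\<integral>\<omega>. indicator A \<omega> * increment s t x \<omega> \<partial>M)\<^sup>2\<bar> \<le> 2 * (s + t) * \<eta>" by simp
  qed
  then show ?thesis by simp
qed

text \<open>Density for a quadratic expression: \<open>x\<close> is split into an embedded
  \<open>y\<close> and a remainder \<open>z\<close> of norm at most \<eta>. The square of the part
  from \<open>z\<close>, the cross term and the change from \<open>norm x\<close> to
  \<open>norm y\<close> are each bounded by a multiple of \<eta>.\<close>

lemma increment_indicator_square:
  assumes A: "A \<in> sets (F s)"
  shows "(\<integral>\<omega>. indicator A \<omega> * (increment s t x \<omega>)\<^sup>2 \<partial>M) = measure M A * ((t - s) * (norm x)\<^sup>2)"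
proof -
  define K where "K = 2 * (s + t)"
  have K: "0 \<le> K" using st by (simp add: K_def)
  have AM[measurable]: "A \<in> sets M" by (rule filtration_sets_into_sets[OF A])
  define I where "I y \<omega> = indicator A \<omega> * increment s t y \<omega>" for y \<omega>
  have Im[measurable]: "I y \<in> borel_measurable M" for y unfolding I_def[abs_def] by measurable
  have Ii: "integrable M (\<lambda>\<omega>. (I y \<omega>)\<^sup>2)" and Ib: "(\<integral>\<omega>. (I y \<omega>)\<^sup>2 \<partial>M) \<le> K * (norm y)\<^sup>2" for y
    unfolding I_def K_def by (rule indicator_square_integrable[OF AM])+
  have I2: "indicator A \<omega> * (increment s t y \<omega>)\<^sup>2 = (I y \<omega>)\<^sup>2" for y \<omega>
    by (simp add: I_def indicator_def)
  \<comment> \<open>The sum of the coefficients of \<eta> in \<open>b1\<close>, \<open>b2\<close>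
    and \<open>b3\<close>.\<close>
  define C where "C = K * (norm x + 1)\<^sup>2 + K + K + (t - s) * (2 * norm x + 1)"
  have "(\<integral>\<omega>. (I x \<omega>)\<^sup>2 \<partial>M) - measure M A * ((t - s) * (norm x)\<^sup>2) = 0"
  proof (rule real_eq_0_if_small)
    fix \<eta> :: real assume \<eta>: "0 < \<eta>" "\<eta> < 1"
    obtain h where h: "norm (x - \<iota> h) < \<eta>" using embed_dense[OF \<eta>(1)] by blast
    define y where "y = \<iota> h"
    define z where "z = x - y"
    have z: "norm z \<le> \<eta>" using h by (simp add: z_def y_def)
    have y: "norm y \<le> norm x + \<eta>" using norm_triangle_ineq2[of y x] z by (simp add: z_def norm_minus_commute)
    have yz: "integrable M (\<lambda>\<omega>. I y \<omega> * I z \<omega>)" by (intro integrable_mult_of_squares Im Ii)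
    have "AE \<omega> in M. I x \<omega> = I y \<omega> + I z \<omega>"
      using increment_diff[of x y] by eventually_elim (simp add: I_def z_def right_diff_distrib)
    then have "(\<integral>\<omega>. (I x \<omega>)\<^sup>2 \<partial>M) = (\<integral>\<omega>. (I y \<omega>)\<^sup>2 + ((I z \<omega>)\<^sup>2 + 2 * (I y \<omega> * I z \<omega>)) \<partial>M)"
      by (intro integral_cong_AE) (auto simp: power2_sum algebra_simps)
    also have "\<dots> = (\<integral>\<omega>. (I y \<omega>)\<^sup>2 \<partial>M) + (\<integral>\<omega>. (I z \<omega>)\<^sup>2 \<partial>M) + 2 * (\<integral>\<omega>. I y \<omega> * I z \<omega> \<partial>M)"
      using Ii yz by simp
    also have "(\<integral>\<omega>. (I y \<omega>)\<^sup>2 \<partial>M) = measure M A * ((t - s) * (norm y)\<^sup>2)"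
      using embedded_increment_moments(2)[OF A, of h] by (simp add: I2 y_def)
    finally have eq: "(\<integral>\<omega>. (I x \<omega>)\<^sup>2 \<partial>M) - measure M A * ((t - s) * (norm x)\<^sup>2)
        = measure M A * ((t - s) * ((norm y)\<^sup>2 - (norm x)\<^sup>2)) + (\<integral>\<omega>. (I z \<omega>)\<^sup>2 \<partial>M) + 2 * (\<integral>\<omega>. I y \<omega> * I z \<omega> \<partial>M)"
      by (simp add: algebra_simps)
    have z2: "(norm z)\<^sup>2 \<le> \<eta> * \<eta>" unfolding power2_eq_square using z \<eta> by (intro mult_mono) auto
    have "\<eta> * \<eta> \<le> \<eta> * 1" using \<eta> by (intro mult_left_mono) auto
    have b1: "\<bar>\<integral>\<omega>. (I z \<omega>)\<^sup>2 \<partial>M\<bar> \<le> K * \<eta>"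
    proof -
      have "(norm z)\<^sup>2 \<le> \<eta>" using z2 \<open>\<eta> * \<eta> \<le> \<eta> * 1\<close> by simp
      then have "K * (norm z)\<^sup>2 \<le> K * \<eta>" using K by (rule mult_left_mono)
      moreover have "0 \<le> (\<integral>\<omega>. (I z \<omega>)\<^sup>2 \<partial>M)" by simp
      ultimately show ?thesis using Ib[of z] by simp
    qed
    have b2: "\<bar>2 * (\<integral>\<omega>. I y \<omega> * I z \<omega> \<partial>M)\<bar> \<le> \<eta> * (K * (norm x + 1)\<^sup>2) + K * \<eta>"
    proof -
      have "\<bar>2 * (\<integral>\<omega>. I y \<omega> * I z \<omega> \<partial>M)\<bar> = \<bar>\<integral>\<omega>. 2 * (I y \<omega> * I z \<omega>) \<partial>M\<bar>" by simp
      also have "\<dots> \<le> (\<integral>\<omega>. \<bar>2 * (I y \<omega> * I z \<omega>)\<bar> \<partial>M)" by (rule integral_abs_bound)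
      \<comment> \<open>Weighted inequality of arithmetic and geometric means: weight \<eta> on
        \<open>y\<close> and \<open>inverse \<eta>\<close> on \<open>z\<close> make both parts
        linear in \<eta>, since the square of \<open>norm z\<close> is at most
        \<open>\<eta> * \<eta>\<close>.\<close>
      also have "\<dots> \<le> (\<integral>\<omega>. \<eta> * (I y \<omega>)\<^sup>2 + inverse \<eta> * (I z \<omega>)\<^sup>2 \<partial>M)"
      proof (rule integral_mono)
        show "\<bar>2 * (I y \<omega> * I z \<omega>)\<bar> \<le> \<eta> * (I y \<omega>)\<^sup>2 + inverse \<eta> * (I z \<omega>)\<^sup>2" for \<omega>
        proof -
          have "0 \<le> (\<eta> * \<bar>I y \<omega>\<bar> - \<bar>I z \<omega>\<bar>)\<^sup>2" by simp
          then have "2 * (\<eta> * \<bar>I y \<omega>\<bar> * \<bar>I z \<omega>\<bar>) \<le> \<eta>\<^sup>2 * (I y \<omega>)\<^sup>2 + (I z \<omega>)\<^sup>2"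
            by (simp add: power2_diff power_mult_distrib)
          then have "inverse \<eta> * (2 * (\<eta> * \<bar>I y \<omega>\<bar> * \<bar>I z \<omega>\<bar>)) \<le> inverse \<eta> * (\<eta>\<^sup>2 * (I y \<omega>)\<^sup>2 + (I z \<omega>)\<^sup>2)"
            using \<eta> by (intro mult_left_mono) auto
          then show ?thesis using \<eta> by (simp add: field_simps power2_eq_square abs_mult)
        qed
      qed (use yz Ii in auto)
      also have "\<dots> = \<eta> * (\<integral>\<omega>. (I y \<omega>)\<^sup>2 \<partial>M) + inverse \<eta> * (\<integral>\<omega>. (I z \<omega>)\<^sup>2 \<partial>M)" using Ii by simp
      also have "\<dots> \<le> \<eta> * (K * (norm x + 1)\<^sup>2) + inverse \<eta> * (K * (\<eta> * \<eta>))"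
      proof (intro add_mono mult_left_mono)
        have "(norm y)\<^sup>2 \<le> (norm x + 1)\<^sup>2" using y \<eta> by (intro power_mono) auto
        then show "(\<integral>\<omega>. (I y \<omega>)\<^sup>2 \<partial>M) \<le> K * (norm x + 1)\<^sup>2"
          using Ib[of y] K by (meson mult_left_mono order_trans)
        show "(\<integral>\<omega>. (I z \<omega>)\<^sup>2 \<partial>M) \<le> K * (\<eta> * \<eta>)"
          using Ib[of z] z2 K by (meson mult_left_mono order_trans)
      qed (use \<eta> in auto)
      also have "inverse \<eta> * (K * (\<eta> * \<eta>)) = K * \<eta>" using \<eta> by simp
      finally show ?thesis .
    qed
    have b3: "\<bar>measure M A * ((t - s) * ((norm y)\<^sup>2 - (norm x)\<^sup>2))\<bar> \<le> (t - s) * (2 * norm x + 1) * \<eta>"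
    proof -
      have "\<bar>norm y - norm x\<bar> \<le> \<eta>" using norm_triangle_ineq3[of y x] z by (simp add: z_def norm_minus_commute)
      moreover have "norm y + norm x \<le> 2 * norm x + 1" using y \<eta> by simp
      ultimately have "\<bar>norm y - norm x\<bar> * (norm y + norm x) \<le> \<eta> * (2 * norm x + 1)"
        using \<eta> by (intro mult_mono) auto
      moreover have "(norm y)\<^sup>2 - (norm x)\<^sup>2 = (norm y - norm x) * (norm y + norm x)"
        by (simp add: power2_eq_square algebra_simps)
      ultimately have "\<bar>(norm y)\<^sup>2 - (norm x)\<^sup>2\<bar> \<le> \<eta> * (2 * norm x + 1)" by (simp add: abs_mult)
      then have "(t - s) * \<bar>(norm y)\<^sup>2 - (norm x)\<^sup>2\<bar> \<le> (t - s) * (\<eta> * (2 * norm x + 1))"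
        using st by (intro mult_left_mono) auto
      moreover have "measure M A * ((t - s) * \<bar>(norm y)\<^sup>2 - (norm x)\<^sup>2\<bar>) \<le> 1 * ((t - s) * \<bar>(norm y)\<^sup>2 - (norm x)\<^sup>2\<bar>)"
        using st by (intro mult_right_mono prob_le_1) auto
      ultimately show ?thesis using st by (simp add: abs_mult mult_ac)
    qed
    have "C * \<eta> = \<eta> * (K * (norm x + 1)\<^sup>2) + K * \<eta> + K * \<eta> + (t - s) * (2 * norm x + 1) * \<eta>"
      by (simp add: C_def algebra_simps)
    then show "\<bar>(\<integral>\<omega>. (I x \<omega>)\<^sup>2 \<partial>M) - measure M A * ((t - s) * (norm x)\<^sup>2)\<bar> \<le> C * \<eta>"
      unfolding eq using b1 b2 b3 by linarith
  qed
  then show ?thesis by (simp add: I2)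
qed

text \<open>Polarization of the variance formula along \<open>x + y\<close>.\<close>

lemma increment_indicator_covariance:
  assumes A: "A \<in> sets (F s)"
  shows "(\<integral>\<omega>. indicator A \<omega> * (increment s t x \<omega> * increment s t y \<omega>) \<partial>M) = measure M A * ((t - s) * inner x y)"
proof -
  have AM[measurable]: "A \<in> sets M" by (rule filtration_sets_into_sets[OF A])
  have i2: "integrable M (\<lambda>\<omega>. indicator A \<omega> * (increment s t z \<omega>)\<^sup>2)" for z
    by (rule Bochner_Integration.integrable_bound[OF increment_square_integrable]) (auto simp: indicator_def)
  have xy: "integrable M (\<lambda>\<omega>. indicator A \<omega> * (increment s t x \<omega> * increment s t y \<omega>))"
    by (rule Bochner_Integration.integrable_bound[OF integrable_mult_of_squares[of "increment s t x" M "increment s t y"]])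
      (auto simp: indicator_def increment_square_integrable)
  have "(\<integral>\<omega>. indicator A \<omega> * (increment s t (x + y) \<omega>)\<^sup>2 \<partial>M) =
      (\<integral>\<omega>. indicator A \<omega> * (increment s t x \<omega>)\<^sup>2 + (indicator A \<omega> * (increment s t y \<omega>)\<^sup>2
        + 2 * (indicator A \<omega> * (increment s t x \<omega> * increment s t y \<omega>))) \<partial>M)"
    using increment_add[of x y] by (intro integral_cong_AE) (auto simp: power2_sum algebra_simps)
  also have "\<dots> = (\<integral>\<omega>. indicator A \<omega> * (increment s t x \<omega>)\<^sup>2 \<partial>M) + (\<integral>\<omega>. indicator A \<omega> * (increment s t y \<omega>)\<^sup>2 \<partial>M)
      + 2 * (\<integral>\<omega>. indicator A \<omega> * (increment s t x \<omega> * increment s t y \<omega>) \<partial>M)"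
    using i2 xy by simp
  finally have "measure M A * ((t - s) * (norm (x + y))\<^sup>2) = measure M A * ((t - s) * (norm x)\<^sup>2)
      + measure M A * ((t - s) * (norm y)\<^sup>2) + 2 * (\<integral>\<omega>. indicator A \<omega> * (increment s t x \<omega> * increment s t y \<omega>) \<partial>M)"
    by (simp add: increment_indicator_square[OF A])
  then show ?thesis
    by (simp add: power2_norm_eq_inner inner_add_left inner_add_right inner_commute algebra_simps)
qed

end

end

section \<open>From events to integrable weights\<close>

context completed_wiener
begin

text \<open>The conditional expectation of the squared increment is the constant \<open>c\<close>.
  Its extended nonnegative version lets the weight be pulled out before the product is known to be
  integrable, and finiteness is then the conclusion.\<close>

lemma increment_weighted_square:
  assumes st: "0 \<le> s" "s \<le> t" and Z: "Z \<in> borel_measurable (F s)" "integrable M Z"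
  shows "integrable M (\<lambda>\<omega>. Z \<omega> * (increment s t x \<omega>)\<^sup>2)"
proof (rule integrableI_bounded)
  interpret S: finite_measure_subalgebra M "F s"
    by unfold_locales (rule filtration_subalgebra)
  note [measurable] = increment_measurable[OF st] filtration_measurable[OF Z(1)]
  define c where "c = (t - s) * (norm x)\<^sup>2"
  have c: "0 \<le> c" using st by (simp add: c_def)
  have "AE \<omega> in M. ennreal c = nn_cond_exp M (F s) (\<lambda>\<omega>. ennreal ((increment s t x \<omega>)\<^sup>2)) \<omega>"
  proof (rule S.nn_cond_exp_charact)
    fix A assume A: "A \<in> sets (F s)"
    have AM[measurable]: "A \<in> sets M" by (rule filtration_sets_into_sets[OF A])
    have i: "integrable M (\<lambda>\<omega>. indicator A \<omega> * (increment s t x \<omega>)\<^sup>2)"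
      by (rule Bochner_Integration.integrable_bound[OF increment_square_integrable[OF st]]) (auto simp: indicator_def)
    have "(\<integral>\<^sup>+\<omega>\<in>A. ennreal ((increment s t x \<omega>)\<^sup>2) \<partial>M) = (\<integral>\<^sup>+\<omega>. ennreal (indicator A \<omega> * (increment s t x \<omega>)\<^sup>2) \<partial>M)"
      by (intro nn_integral_cong) (auto simp: indicator_def)
    also have "\<dots> = ennreal (\<integral>\<omega>. indicator A \<omega> * (increment s t x \<omega>)\<^sup>2 \<partial>M)"
      by (rule nn_integral_eq_integral[OF i]) simp
    also have "\<dots> = ennreal c * emeasure M A"
      using increment_indicator_square[OF st A, of x] c
      by (simp add: emeasure_eq_measure ennreal_mult[symmetric] c_def mult.commute)
    also have "\<dots> = (\<integral>\<^sup>+\<omega>\<in>A. ennreal c \<partial>M)" by (simp add: nn_integral_cmult_indicator)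
    finally show "(\<integral>\<^sup>+\<omega>\<in>A. ennreal ((increment s t x \<omega>)\<^sup>2) \<partial>M) = (\<integral>\<^sup>+\<omega>\<in>A. ennreal c \<partial>M)" .
  qed simp_all
  then have "AE \<omega> in M. ennreal \<bar>Z \<omega>\<bar> * ennreal c
      = ennreal \<bar>Z \<omega>\<bar> * nn_cond_exp M (F s) (\<lambda>\<omega>. ennreal ((increment s t x \<omega>)\<^sup>2)) \<omega>"
    by eventually_elim simp
  then have "(\<integral>\<^sup>+\<omega>. ennreal \<bar>Z \<omega>\<bar> * ennreal c \<partial>M)
      = (\<integral>\<^sup>+\<omega>. ennreal \<bar>Z \<omega>\<bar> * nn_cond_exp M (F s) (\<lambda>\<omega>. ennreal ((increment s t x \<omega>)\<^sup>2)) \<omega> \<partial>M)"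
    by (rule nn_integral_cong_AE)
  also have "\<dots> = (\<integral>\<^sup>+\<omega>. ennreal \<bar>Z \<omega>\<bar> * ennreal ((increment s t x \<omega>)\<^sup>2) \<partial>M)"
    by (rule S.nn_cond_exp_intg) (use Z(1) in simp_all)
  finally have "(\<integral>\<^sup>+\<omega>. ennreal (norm (Z \<omega> * (increment s t x \<omega>)\<^sup>2)) \<partial>M) = (\<integral>\<^sup>+\<omega>. ennreal \<bar>Z \<omega>\<bar> * ennreal c \<partial>M)"
    by (simp add: abs_mult ennreal_mult)
  also have "\<dots> = (\<integral>\<^sup>+\<omega>. ennreal \<bar>Z \<omega>\<bar> \<partial>M) * ennreal c" by (simp add: nn_integral_multc)
  also have "\<dots> < \<infinity>" using Z(2) by (simp add: integrable_iff_bounded ennreal_mult_less_top)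
  finally show "(\<integral>\<^sup>+\<omega>. ennreal (norm (Z \<omega> * (increment s t x \<omega>)\<^sup>2)) \<partial>M) < \<infinity>" .
  show "(\<lambda>\<omega>. Z \<omega> * (increment s t x \<omega>)\<^sup>2) \<in> borel_measurable M" by measurable
qed

text \<open>Pulling out the weight requires an integrable product; this follows from
  \<open>\<bar>d\<bar> \<le> 1 + d\<^sup>2\<close> for the increment \<open>d\<close> and from the
  weighted square.\<close>

lemma increment_weighted_mean:
  assumes st: "0 \<le> s" "s \<le> t" and Z: "Z \<in> borel_measurable (F s)" "integrable M Z"
  shows "has_bochner_integral M (\<lambda>\<omega>. Z \<omega> * increment s t x \<omega>) 0"
proof -
  interpret S: finite_measure_subalgebra M "F s"
    by unfold_locales (rule filtration_subalgebra)
  note [measurable] = increment_measurable[OF st] filtration_measurable[OF Z(1)]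
  have i: "integrable M (increment s t x)"
    by (rule square_integrable_imp_integrable(1)[OF _ increment_square_integrable[OF st]]) simp
  have Zi: "integrable M (\<lambda>\<omega>. Z \<omega> * increment s t x \<omega>)"
  proof (rule Bochner_Integration.integrable_bound)
    show "integrable M (\<lambda>\<omega>. \<bar>Z \<omega>\<bar> + \<bar>Z \<omega> * (increment s t x \<omega>)\<^sup>2\<bar>)"
      using increment_weighted_square[OF st Z, of x] Z(2) by (intro Bochner_Integration.integrable_add integrable_abs)
    show "AE \<omega> in M. norm (Z \<omega> * increment s t x \<omega>) \<le> norm (\<bar>Z \<omega>\<bar> + \<bar>Z \<omega> * (increment s t x \<omega>)\<^sup>2\<bar>)"
    proof (rule AE_I2)
      fix \<omega>
      have "2 * \<bar>increment s t x \<omega>\<bar> \<le> 1 + (increment s t x \<omega>)\<^sup>2"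
        using sum_squares_bound[of 1 "\<bar>increment s t x \<omega>\<bar>"] by simp
      then have "\<bar>increment s t x \<omega>\<bar> \<le> 1 + (increment s t x \<omega>)\<^sup>2" by simp
      then have "\<bar>Z \<omega>\<bar> * \<bar>increment s t x \<omega>\<bar> \<le> \<bar>Z \<omega>\<bar> * (1 + (increment s t x \<omega>)\<^sup>2)" by (intro mult_left_mono) auto
      then show "norm (Z \<omega> * increment s t x \<omega>) \<le> norm (\<bar>Z \<omega>\<bar> + \<bar>Z \<omega> * (increment s t x \<omega>)\<^sup>2\<bar>)"
        by (simp add: abs_mult distrib_left)
    qed
  qed measurable
  have "AE \<omega> in M. real_cond_exp M (F s) (increment s t x) \<omega> = 0"
  proof (rule S.real_cond_exp_charact)
    fix A assume "A \<in> sets (F s)"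
    then show "(\<integral>\<omega>\<in>A. increment s t x \<omega> \<partial>M) = (\<integral>\<omega>\<in>A. 0 \<partial>M)"
      using increment_indicator_mean[OF st] by (simp add: set_lebesgue_integral_def)
  qed (use i in simp_all)
  then have "AE \<omega> in M. Z \<omega> * real_cond_exp M (F s) (increment s t x) \<omega> = 0"
    by eventually_elim simp
  then have "(\<integral>\<omega>. Z \<omega> * real_cond_exp M (F s) (increment s t x) \<omega> \<partial>M) = 0"
    by (rule integral_eq_zero_AE)
  then have "(\<integral>\<omega>. Z \<omega> * increment s t x \<omega> \<partial>M) = 0"
    using S.real_cond_exp_intg(2)[OF Zi Z(1)] by simp
  with Zi show ?thesis by (simp add: has_bochner_integral_iff)
qed

text \<open>As for the mean, with the product of two increments dominated by the sum of their
  squares.\<close>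

lemma increment_weighted_covariance:
  assumes st: "0 \<le> s" "s \<le> t" and Z: "Z \<in> borel_measurable (F s)" "integrable M Z"
  shows "has_bochner_integral M (\<lambda>\<omega>. Z \<omega> * (increment s t x \<omega> * increment s t y \<omega>)) ((t - s) * inner x y * (\<integral>\<omega>. Z \<omega> \<partial>M))"
proof -
  interpret S: finite_measure_subalgebra M "F s"
    by unfold_locales (rule filtration_subalgebra)
  note [measurable] = increment_measurable[OF st] filtration_measurable[OF Z(1)]
  have i: "integrable M (\<lambda>\<omega>. increment s t x \<omega> * increment s t y \<omega>)"
    by (intro integrable_mult_of_squares increment_square_integrable[OF st]) simp_all
  have Zi: "integrable M (\<lambda>\<omega>. Z \<omega> * (increment s t x \<omega> * increment s t y \<omega>))"
  proof (rule Bochner_Integration.integrable_bound)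
    show "integrable M (\<lambda>\<omega>. \<bar>Z \<omega> * (increment s t x \<omega>)\<^sup>2\<bar> + \<bar>Z \<omega> * (increment s t y \<omega>)\<^sup>2\<bar>)"
      by (intro Bochner_Integration.integrable_add integrable_abs increment_weighted_square[OF st Z])
    show "AE \<omega> in M. norm (Z \<omega> * (increment s t x \<omega> * increment s t y \<omega>))
        \<le> norm (\<bar>Z \<omega> * (increment s t x \<omega>)\<^sup>2\<bar> + \<bar>Z \<omega> * (increment s t y \<omega>)\<^sup>2\<bar>)"
    proof (rule AE_I2)
      fix \<omega>
      have "2 * (\<bar>increment s t x \<omega>\<bar> * \<bar>increment s t y \<omega>\<bar>) \<le> (increment s t x \<omega>)\<^sup>2 + (increment s t y \<omega>)\<^sup>2"
        using sum_squares_bound[of "\<bar>increment s t x \<omega>\<bar>" "\<bar>increment s t y \<omega>\<bar>"] by simp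
      moreover have "0 \<le> \<bar>increment s t x \<omega>\<bar> * \<bar>increment s t y \<omega>\<bar>" by simp
      ultimately have "\<bar>increment s t x \<omega>\<bar> * \<bar>increment s t y \<omega>\<bar> \<le> (increment s t x \<omega>)\<^sup>2 + (increment s t y \<omega>)\<^sup>2"
        by linarith
      then have "\<bar>Z \<omega>\<bar> * (\<bar>increment s t x \<omega>\<bar> * \<bar>increment s t y \<omega>\<bar>) \<le> \<bar>Z \<omega>\<bar> * ((increment s t x \<omega>)\<^sup>2 + (increment s t y \<omega>)\<^sup>2)"
        by (intro mult_left_mono) auto
      then show "norm (Z \<omega> * (increment s t x \<omega> * increment s t y \<omega>))
          \<le> norm (\<bar>Z \<omega> * (increment s t x \<omega>)\<^sup>2\<bar> + \<bar>Z \<omega> * (increment s t y \<omega>)\<^sup>2\<bar>)"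
        by (simp add: abs_mult distrib_left)
    qed
  qed measurable
  have "AE \<omega> in M. real_cond_exp M (F s) (\<lambda>\<omega>. increment s t x \<omega> * increment s t y \<omega>) \<omega> = (t - s) * inner x y"
  proof (rule S.real_cond_exp_charact)
    fix A assume A: "A \<in> sets (F s)"
    have "A \<in> sets M" by (rule filtration_sets_into_sets[OF A])
    then show "(\<integral>\<omega>\<in>A. increment s t x \<omega> * increment s t y \<omega> \<partial>M) = (\<integral>\<omega>\<in>A. (t - s) * inner x y \<partial>M)"
      using increment_indicator_covariance[OF st A, of x y] by (simp add: set_lebesgue_integral_def)
  qed (use i in simp_all)
  then have "AE \<omega> in M. Z \<omega> * real_cond_exp M (F s) (\<lambda>\<omega>. increment s t x \<omega> * increment s t y \<omega>) \<omega>
      = Z \<omega> * ((t - s) * inner x y)"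
    by eventually_elim simp
  then have "(\<integral>\<omega>. Z \<omega> * real_cond_exp M (F s) (\<lambda>\<omega>. increment s t x \<omega> * increment s t y \<omega>) \<omega> \<partial>M)
      = (\<integral>\<omega>. Z \<omega> * ((t - s) * inner x y) \<partial>M)"
    by (rule Bochner_Integration.integral_cong_AE[rotated 2]) (use borel_measurable_cond_exp2 in simp_all)
  then have "(\<integral>\<omega>. Z \<omega> * (increment s t x \<omega> * increment s t y \<omega>) \<partial>M) = (t - s) * inner x y * (\<integral>\<omega>. Z \<omega> \<partial>M)"
    using S.real_cond_exp_intg(2)[OF Zi Z(1)] by (simp add: mult.commute)
  with Zi show ?thesis by (simp add: has_bochner_integral_iff)
qed

section \<open>Continuous coordinate processes\<close>

text \<open>A coordinate is set to 0 on a null set containing all its discontinuous paths. This set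
  belongs to every \<open>F t\<close>, so adaptedness survives, and moments do not change. One null
  set serves all times, as pathwise integrals require.\<close>

lemma continuous_modification:
  fixes v :: "'i \<Rightarrow> 'w"
  assumes orth: "\<And>i j. i \<in> J \<Longrightarrow> j \<in> J \<Longrightarrow> inner (v i) (v j) = (if i = j then 1 else 0)"
  obtains X where "orthonormal_family M F X J" "\<And>j. AE \<omega> in M. \<forall>t. X j t \<omega> = W t (v j) \<omega>"
proof -
  have "\<forall>j. \<exists>N. N \<in> null_sets M \<and> {\<omega>\<in>space M. \<not> continuous_on {0..} (\<lambda>t. W t (v j) \<omega>)} \<subseteq> N"
  proof
    fix j
    obtain N where "{\<omega>\<in>space M. \<not> continuous_on {0..} (\<lambda>t. W t (v j) \<omega>)} \<subseteq> N" "emeasure M N = 0" "N \<in> sets M"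
      by (rule AE_E[OF W_continuous[of "v j"]])
    then show "\<exists>N. N \<in> null_sets M \<and> {\<omega>\<in>space M. \<not> continuous_on {0..} (\<lambda>t. W t (v j) \<omega>)} \<subseteq> N"
      by (intro exI[of _ N] conjI null_setsI)
  qed
  from choice[OF this] obtain N where N: "\<And>j. N j \<in> null_sets M"
    "\<And>j. {\<omega>\<in>space M. \<not> continuous_on {0..} (\<lambda>t. W t (v j) \<omega>)} \<subseteq> N j" by blast
  define X where "X j t \<omega> = (if \<omega> \<in> N j then 0 else W t (v j) \<omega>)" for j t \<omega>
  have XW: "AE \<omega> in M. \<forall>t. X j t \<omega> = W t (v j) \<omega>" for j
    using AE_not_in[OF N(1)[of j]] by eventually_elim (simp add: X_def)
  have N_sets: "N j \<in> sets (F t)" for j t by (rule null_sets_F[OF N(1)])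
  have inc: "AE \<omega> in M. X j t \<omega> - X j s \<omega> = increment s t (v j) \<omega>" for j s t
    using XW[of j] by eventually_elim (simp add: increment_def)
  have Xm: "X j u \<in> borel_measurable (F u)" if "0 \<le> u" for j u
  proof -
    have "N j \<inter> space (F u) \<in> sets (F u)" by (intro sets.Int N_sets sets.top)
    then show ?thesis
      unfolding X_def[abs_def] by (intro measurable_If_set W_adapted that measurable_const) simp_all
  qed
  have XM: "X j u \<in> borel_measurable M" if "0 \<le> u" for j u
    by (rule filtration_measurable[OF Xm[OF that]])
  have "orthonormal_family M F X J"
  proof unfold_locales
    fix j and t :: real assume "j \<in> J" "0 \<le> t"
    then show "X j t \<in> borel_measurable (F t)" by (intro Xm)
  next
    fix j \<omega> assume "j \<in> J" "\<omega> \<in> space M"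
    show "continuous_on {0..} (\<lambda>t. X j t \<omega>)"
    proof (cases "\<omega> \<in> N j")
      case False
      then have "continuous_on {0..} (\<lambda>t. W t (v j) \<omega>)" using N(2)[of j] \<open>\<omega> \<in> space M\<close> by blast
      then show ?thesis using False by (simp add: X_def)
    qed (simp add: X_def)
  next
    fix j and s t :: real and Z :: "'a \<Rightarrow> real" assume j: "j \<in> J" and st: "0 \<le> s" "s \<le> t" and Z: "Z \<in> borel_measurable (F s)" "integrable M Z"
    note [measurable] = filtration_measurable[OF Z(1)] increment_measurable[OF st]
    have [measurable]: "X j s \<in> borel_measurable M" "X j t \<in> borel_measurable M" using st by (auto intro: XM)
    have "AE \<omega> in M. Z \<omega> * (X j t \<omega> - X j s \<omega>) = Z \<omega> * increment s t (v j) \<omega>"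
      using inc[of j t s] by eventually_elim simp
    then show "has_bochner_integral M (\<lambda>\<omega>. Z \<omega> * (X j t \<omega> - X j s \<omega>)) 0"
      using increment_weighted_mean[OF st Z, of "v j"]
      by (subst has_bochner_integral_cong_AE) simp_all
  next
    fix i j and s t :: real and Z :: "'a \<Rightarrow> real" assume ij: "i \<in> J" "j \<in> J" and st: "0 \<le> s" "s \<le> t" and Z: "Z \<in> borel_measurable (F s)" "integrable M Z"
    note [measurable] = filtration_measurable[OF Z(1)] increment_measurable[OF st]
    have [measurable]: "X j s \<in> borel_measurable M" "X j t \<in> borel_measurable M" for j using st by (auto intro: XM)
    have eq: "AE \<omega> in M. Z \<omega> * ((X i t \<omega> - X i s \<omega>) * (X j t \<omega> - X j s \<omega>)) = Z \<omega> * (increment s t (v i) \<omega> * increment s t (v j) \<omega>)"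
      using inc[of i t s] inc[of j t s] by eventually_elim simp
    have "has_bochner_integral M (\<lambda>\<omega>. Z \<omega> * (increment s t (v i) \<omega> * increment s t (v j) \<omega>))
        (if i = j then (t - s) * (\<integral>\<omega>. Z \<omega> \<partial>M) else 0)"
      using increment_weighted_covariance[OF st Z, of "v i" "v j"] orth[OF ij] by (cases "i = j") simp_all
    then show "has_bochner_integral M (\<lambda>\<omega>. Z \<omega> * ((X i t \<omega> - X i s \<omega>) * (X j t \<omega> - X j s \<omega>)))
        (if i = j then (t - s) * (\<integral>\<omega>. Z \<omega> \<partial>M) else 0)"
      using eq by (subst has_bochner_integral_cong_AE) simp_all
  qed
  then show thesis using XW by (rule that)
qed

end

section \<open>Bessel's inequality and convergence of random variables\<close>

text \<open>The squared norm of \<open>x - p\<close> is nonnegative for the projection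
  \<open>p\<close>, and \<open>inner x p\<close> equals \<open>inner p p\<close>.\<close>

lemma Bessel_inequality:
  fixes x :: "'w::real_inner"
  assumes K: "finite K" and orth: "\<And>i j. i \<in> K \<Longrightarrow> j \<in> K \<Longrightarrow> inner (v i) (v j) = (if i = j then 1 else 0)"
  shows "(\<Sum>j\<in>K. (inner x (v j))\<^sup>2) \<le> (norm x)\<^sup>2"
proof -
  define p where "p = (\<Sum>j\<in>K. inner x (v j) *\<^sub>R v j)"
  have "inner p p = (\<Sum>i\<in>K. \<Sum>j\<in>K. inner x (v i) * (inner x (v j) * inner (v j) (v i)))"
    unfolding p_def by (simp add: inner_sum_left inner_sum_right sum_distrib_left)
  also have "\<dots> = (\<Sum>i\<in>K. \<Sum>j\<in>K. if j = i then (inner x (v i))\<^sup>2 else 0)"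
    by (intro sum.cong refl) (simp add: orth power2_eq_square)
  also have "\<dots> = (\<Sum>j\<in>K. (inner x (v j))\<^sup>2)" using K by (simp add: sum.delta)
  finally have pp: "inner p p = (\<Sum>j\<in>K. (inner x (v j))\<^sup>2)" .
  have xp: "inner x p = (\<Sum>j\<in>K. (inner x (v j))\<^sup>2)"
    unfolding p_def by (simp add: inner_sum_right power2_eq_square)
  have "0 \<le> inner (x - p) (x - p)" by simp
  also have "\<dots> = inner x x - 2 * inner x p + inner p p"
    by (simp add: inner_diff_left inner_diff_right inner_commute)
  finally show ?thesis unfolding xp pp by (simp add: power2_norm_eq_inner)
qed

context prob_space
begin

lemma L2_tendsto_unique:
  assumes f: "L2_tendsto M f a" and g: "L2_tendsto M f b"
  shows "AE \<omega> in M. a \<omega> = b \<omega>"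
proof -
  have [measurable]: "f n \<in> borel_measurable M" "a \<in> borel_measurable M" "b \<in> borel_measurable M" for n
    using f g unfolding L2_tendsto_def by simp_all
  have "(\<integral>\<^sup>+\<omega>. ennreal ((a \<omega> - b \<omega>)\<^sup>2) \<partial>M) \<le> 0"
  proof (rule LIMSEQ_le_const)
    have "(\<lambda>n. 2 * (\<integral>\<^sup>+\<omega>. ennreal ((f n \<omega> - a \<omega>)\<^sup>2) \<partial>M) + 2 * (\<integral>\<^sup>+\<omega>. ennreal ((f n \<omega> - b \<omega>)\<^sup>2) \<partial>M)) \<longlonglongrightarrow> 2 * 0 + 2 * 0"
      using f g unfolding L2_tendsto_def by (intro tendsto_add ennreal_tendsto_cmult) simp_all
    then show "(\<lambda>n. 2 * (\<integral>\<^sup>+\<omega>. ennreal ((f n \<omega> - a \<omega>)\<^sup>2) \<partial>M) + 2 * (\<integral>\<^sup>+\<omega>. ennreal ((f n \<omega> - b \<omega>)\<^sup>2) \<partial>M)) \<longlonglongrightarrow> 0" by simp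
    have "(\<integral>\<^sup>+\<omega>. ennreal ((a \<omega> - b \<omega>)\<^sup>2) \<partial>M) \<le> 2 * (\<integral>\<^sup>+\<omega>. ennreal ((f n \<omega> - a \<omega>)\<^sup>2) \<partial>M) + 2 * (\<integral>\<^sup>+\<omega>. ennreal ((f n \<omega> - b \<omega>)\<^sup>2) \<partial>M)" for n
    proof -
      have "(\<integral>\<^sup>+\<omega>. ennreal ((a \<omega> - b \<omega>)\<^sup>2) \<partial>M) \<le> (\<integral>\<^sup>+\<omega>. 2 * ennreal ((f n \<omega> - a \<omega>)\<^sup>2) + 2 * ennreal ((f n \<omega> - b \<omega>)\<^sup>2) \<partial>M)"
      proof (rule nn_integral_mono)
        fix \<omega>
        have "(a \<omega> - b \<omega>)\<^sup>2 \<le> 2 * (f n \<omega> - a \<omega>)\<^sup>2 + 2 * (f n \<omega> - b \<omega>)\<^sup>2"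
        proof -
          have "0 \<le> ((f n \<omega> - a \<omega>) + (f n \<omega> - b \<omega>))\<^sup>2" by simp
          then show ?thesis by (simp add: power2_eq_square algebra_simps)
        qed
        then have "ennreal ((a \<omega> - b \<omega>)\<^sup>2) \<le> ennreal (2 * (f n \<omega> - a \<omega>)\<^sup>2 + 2 * (f n \<omega> - b \<omega>)\<^sup>2)" by (rule ennreal_leI)
        then show "ennreal ((a \<omega> - b \<omega>)\<^sup>2) \<le> 2 * ennreal ((f n \<omega> - a \<omega>)\<^sup>2) + 2 * ennreal ((f n \<omega> - b \<omega>)\<^sup>2)"
          by (simp add: ennreal_mult)
      qed
      also have "\<dots> = 2 * (\<integral>\<^sup>+\<omega>. ennreal ((f n \<omega> - a \<omega>)\<^sup>2) \<partial>M) + 2 * (\<integral>\<^sup>+\<omega>. ennreal ((f n \<omega> - b \<omega>)\<^sup>2) \<partial>M)"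
        by (simp add: nn_integral_add nn_integral_cmult)
      finally show ?thesis .
    qed
    then show "\<exists>N. \<forall>n\<ge>N. (\<integral>\<^sup>+\<omega>. ennreal ((a \<omega> - b \<omega>)\<^sup>2) \<partial>M) \<le> 2 * (\<integral>\<^sup>+\<omega>. ennreal ((f n \<omega> - a \<omega>)\<^sup>2) \<partial>M) + 2 * (\<integral>\<^sup>+\<omega>. ennreal ((f n \<omega> - b \<omega>)\<^sup>2) \<partial>M)"
      by blast
  qed
  then have "AE \<omega> in M. ennreal ((a \<omega> - b \<omega>)\<^sup>2) = 0"
    by (subst nn_integral_0_iff_AE[symmetric]) simp_all
  then show ?thesis by eventually_elim (simp add: ennreal_eq_0_iff)
qed

text \<open>Chebyshev's inequality.\<close>

lemma L2_tendsto_imp_tendsto_in_probability: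
  assumes "L2_tendsto M f a"
  shows "tendsto_in_probability M f a"
  unfolding tendsto_in_probability_def
proof (intro conjI allI impI)
  show m[measurable]: "f n \<in> borel_measurable M" "a \<in> borel_measurable M" for n
    using assms unfolding L2_tendsto_def by simp_all
  fix \<eta> :: real assume \<eta>: "\<eta> > 0"
  have le: "emeasure M {\<omega>\<in>space M. \<bar>f n \<omega> - a \<omega>\<bar> > \<eta>} \<le> ennreal (1 / \<eta>\<^sup>2) * (\<integral>\<^sup>+\<omega>. ennreal ((f n \<omega> - a \<omega>)\<^sup>2) \<partial>M)" for n
  proof -
    have "emeasure M {\<omega>\<in>space M. \<bar>f n \<omega> - a \<omega>\<bar> > \<eta>} \<le> emeasure M {\<omega>\<in>space M. 1 \<le> ennreal (1 / \<eta>\<^sup>2) * ennreal ((f n \<omega> - a \<omega>)\<^sup>2)}"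
    proof (rule emeasure_mono)
      show "{\<omega>\<in>space M. \<bar>f n \<omega> - a \<omega>\<bar> > \<eta>} \<subseteq> {\<omega>\<in>space M. 1 \<le> ennreal (1 / \<eta>\<^sup>2) * ennreal ((f n \<omega> - a \<omega>)\<^sup>2)}"
      proof safe
        fix \<omega> assume "\<eta> < \<bar>f n \<omega> - a \<omega>\<bar>"
        then have "\<eta>\<^sup>2 \<le> \<bar>f n \<omega> - a \<omega>\<bar>\<^sup>2" using \<eta> by (intro power_mono) auto
        then have "1 \<le> 1 / \<eta>\<^sup>2 * (f n \<omega> - a \<omega>)\<^sup>2" using \<eta> by (simp add: field_simps)
        then have "ennreal 1 \<le> ennreal (1 / \<eta>\<^sup>2 * (f n \<omega> - a \<omega>)\<^sup>2)" by (rule ennreal_leI)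
        also have "\<dots> = ennreal (1 / \<eta>\<^sup>2) * ennreal ((f n \<omega> - a \<omega>)\<^sup>2)" by (rule ennreal_mult) simp_all
        finally show "1 \<le> ennreal (1 / \<eta>\<^sup>2) * ennreal ((f n \<omega> - a \<omega>)\<^sup>2)" by (simp only: ennreal_1)
      qed
    qed measurable
    also have "\<dots> \<le> ennreal (1 / \<eta>\<^sup>2) * (\<integral>\<^sup>+\<omega>. ennreal ((f n \<omega> - a \<omega>)\<^sup>2) * indicator (space M) \<omega> \<partial>M)"
      by (rule nn_integral_Markov_inequality) auto
    also have "(\<integral>\<^sup>+\<omega>. ennreal ((f n \<omega> - a \<omega>)\<^sup>2) * indicator (space M) \<omega> \<partial>M) = (\<integral>\<^sup>+\<omega>. ennreal ((f n \<omega> - a \<omega>)\<^sup>2) \<partial>M)"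
      by (intro nn_integral_cong) simp
    finally show ?thesis .
  qed
  have "(\<lambda>n. ennreal (1 / \<eta>\<^sup>2) * (\<integral>\<^sup>+\<omega>. ennreal ((f n \<omega> - a \<omega>)\<^sup>2) \<partial>M)) \<longlonglongrightarrow> ennreal (1 / \<eta>\<^sup>2) * 0"
    using assms unfolding L2_tendsto_def by (intro ennreal_tendsto_cmult) simp_all
  then have lim: "(\<lambda>n. ennreal (1 / \<eta>\<^sup>2) * (\<integral>\<^sup>+\<omega>. ennreal ((f n \<omega> - a \<omega>)\<^sup>2) \<partial>M)) \<longlonglongrightarrow> 0" by simp
  have "(\<lambda>n. emeasure M {\<omega>\<in>space M. \<bar>f n \<omega> - a \<omega>\<bar> > \<eta>}) \<longlonglongrightarrow> 0"
    by (rule tendsto_sandwich[OF _ _ tendsto_const lim]) (intro always_eventually allI zero_le le)+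
  then have "(\<lambda>n. enn2real (emeasure M {\<omega>\<in>space M. \<bar>f n \<omega> - a \<omega>\<bar> > \<eta>})) \<longlonglongrightarrow> enn2real 0"
    by (intro tendsto_enn2real) simp_all
  then show "(\<lambda>n. measure M {\<omega>\<in>space M. \<bar>f n \<omega> - a \<omega>\<bar> > \<eta>}) \<longlonglongrightarrow> 0"
    unfolding measure_def enn2real_0 .
qed

text \<open>The two sequences may consist of different versions: forward and Ito integrals agree
  only almost surely, for each index separately.\<close>

lemma tendsto_in_probability_unique:
  assumes f: "tendsto_in_probability M f a" and g: "tendsto_in_probability M g b"
    and fg: "\<And>n. AE \<omega> in M. f n \<omega> = g n \<omega>"
  shows "AE \<omega> in M. a \<omega> = b \<omega>"
proof -
  have [measurable]: "f n \<in> borel_measurable M" "g n \<in> borel_measurable M" "a \<in> borel_measurable M" "b \<in> borel_measurable M" for n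
    using f g unfolding tendsto_in_probability_def by simp_all
  have small: "AE \<omega> in M. \<bar>a \<omega> - b \<omega>\<bar> \<le> 2 * \<eta>" if \<eta>: "\<eta> > 0" for \<eta>
  proof -
    have "measure M {\<omega>\<in>space M. \<bar>a \<omega> - b \<omega>\<bar> > 2 * \<eta>} \<le> 0"
    proof (rule LIMSEQ_le_const)
      have "(\<lambda>n. measure M {\<omega>\<in>space M. \<bar>f n \<omega> - a \<omega>\<bar> > \<eta>} + measure M {\<omega>\<in>space M. \<bar>g n \<omega> - b \<omega>\<bar> > \<eta>}) \<longlonglongrightarrow> 0 + 0"
        using f g \<eta> unfolding tendsto_in_probability_def by (intro tendsto_add) simp_all
      then show "(\<lambda>n. measure M {\<omega>\<in>space M. \<bar>f n \<omega> - a \<omega>\<bar> > \<eta>} + measure M {\<omega>\<in>space M. \<bar>g n \<omega> - b \<omega>\<bar> > \<eta>}) \<longlonglongrightarrow> 0" by simp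
      have "measure M {\<omega>\<in>space M. \<bar>a \<omega> - b \<omega>\<bar> > 2 * \<eta>} \<le> measure M {\<omega>\<in>space M. \<bar>f n \<omega> - a \<omega>\<bar> > \<eta>} + measure M {\<omega>\<in>space M. \<bar>g n \<omega> - b \<omega>\<bar> > \<eta>}" for n
      proof -
        have "measure M {\<omega>\<in>space M. \<bar>a \<omega> - b \<omega>\<bar> > 2 * \<eta>} \<le> measure M ({\<omega>\<in>space M. \<bar>f n \<omega> - a \<omega>\<bar> > \<eta>} \<union> {\<omega>\<in>space M. \<bar>g n \<omega> - b \<omega>\<bar> > \<eta>})"
        proof (rule finite_measure_mono_AE)
          show "AE \<omega> in M. \<omega> \<in> {\<omega>\<in>space M. \<bar>a \<omega> - b \<omega>\<bar> > 2 * \<eta>} \<longrightarrow> \<omega> \<in> {\<omega>\<in>space M. \<bar>f n \<omega> - a \<omega>\<bar> > \<eta>} \<union> {\<omega>\<in>space M. \<bar>g n \<omega> - b \<omega>\<bar> > \<eta>}"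
            using fg[of n]
          proof eventually_elim
            case (elim \<omega>)
            have "\<bar>a \<omega> - b \<omega>\<bar> \<le> \<bar>f n \<omega> - a \<omega>\<bar> + \<bar>g n \<omega> - b \<omega>\<bar>" using elim by linarith
            then show ?case by auto
          qed
        qed measurable
        also have "\<dots> \<le> measure M {\<omega>\<in>space M. \<bar>f n \<omega> - a \<omega>\<bar> > \<eta>} + measure M {\<omega>\<in>space M. \<bar>g n \<omega> - b \<omega>\<bar> > \<eta>}"
          by (rule measure_Un_le) measurable
        finally show ?thesis .
      qed
      then show "\<exists>N. \<forall>n\<ge>N. measure M {\<omega>\<in>space M. \<bar>a \<omega> - b \<omega>\<bar> > 2 * \<eta>} \<le> measure M {\<omega>\<in>space M. \<bar>f n \<omega> - a \<omega>\<bar> > \<eta>} + measure M {\<omega>\<in>space M. \<bar>g n \<omega> - b \<omega>\<bar> > \<eta>}"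
        by blast
    qed
    then have "measure M {\<omega>\<in>space M. \<bar>a \<omega> - b \<omega>\<bar> > 2 * \<eta>} = 0" using measure_nonneg by (rule antisym)
    then have "emeasure M {\<omega>\<in>space M. \<not> \<bar>a \<omega> - b \<omega>\<bar> \<le> 2 * \<eta>} = 0"
      by (simp add: emeasure_eq_measure not_le)
    then show ?thesis by (subst AE_iff_measurable[OF _ refl]) simp_all
  qed
  have "AE \<omega> in M. \<forall>n. \<bar>a \<omega> - b \<omega>\<bar> \<le> 2 * inverse (real (Suc n))"
    unfolding AE_all_countable by (intro allI small) simp
  then show ?thesis
  proof eventually_elim
    case (elim \<omega>)
    have "\<bar>a \<omega> - b \<omega>\<bar> \<le> 0"
    proof (rule LIMSEQ_le_const)
      show "(\<lambda>n. 2 * inverse (real (Suc n))) \<longlonglongrightarrow> 0"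
        using tendsto_mult[OF tendsto_const LIMSEQ_inverse_real_of_nat, of 2] by simp
      show "\<exists>N. \<forall>n\<ge>N. \<bar>a \<omega> - b \<omega>\<bar> \<le> 2 * inverse (real (Suc n))" using elim by blast
    qed
    then show ?case by simp
  qed
qed

text \<open>A Cauchy sequence in \<open>L\<^sup>2\<close> is Cauchy in \<open>L\<^sup>1\<close>,
  which gives an almost surely convergent subsequence; Fatou's lemma along it carries the Cauchy
  bound over to the distance from the limit.\<close>

lemma L2_complete:
  assumes f[measurable]: "\<And>n. f n \<in> borel_measurable M" and fi: "\<And>n. integrable M (\<lambda>\<omega>. (f n \<omega>)\<^sup>2)"
    and Cauchy: "\<And>\<delta>. \<delta> > 0 \<Longrightarrow> \<exists>N. \<forall>m\<ge>N. \<forall>n\<ge>N. (\<integral>\<^sup>+\<omega>. ennreal ((f n \<omega> - f m \<omega>)\<^sup>2) \<partial>M) \<le> ennreal \<delta>"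
  obtains I where "L2_tendsto M f I"
proof -
  have L1: "\<exists>N. \<forall>i\<ge>N. \<forall>j\<ge>N. (LINT \<omega>|M. norm (f i \<omega> - f j \<omega>)) < e" if e: "e > 0" for e
  proof -
    \<comment> \<open>Half of the square of \<open>e\<close>, so that the weak bound on squares
      yields a strict one for \<open>e\<close>.\<close>
    have "e\<^sup>2 / 2 > 0" using e by simp
    from Cauchy[OF this] obtain N where N: "\<And>m n. m \<ge> N \<Longrightarrow> n \<ge> N \<Longrightarrow> (\<integral>\<^sup>+\<omega>. ennreal ((f n \<omega> - f m \<omega>)\<^sup>2) \<partial>M) \<le> ennreal (e\<^sup>2 / 2)"
      by blast
    have "(LINT \<omega>|M. norm (f i \<omega> - f j \<omega>)) < e" if "i \<ge> N" "j \<ge> N" for i j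
    proof -
      have i2: "integrable M (\<lambda>\<omega>. (f i \<omega> - f j \<omega>)\<^sup>2)"
        using integrable_square_add[of "f i" M "\<lambda>\<omega>. - f j \<omega>"] fi by simp
      then have "integrable M (\<lambda>\<omega>. (norm (f i \<omega> - f j \<omega>))\<^sup>2)" by simp
      from square_integrable_imp_integrable(2)[OF _ this]
      have "(LINT \<omega>|M. norm (f i \<omega> - f j \<omega>))\<^sup>2 \<le> (\<integral>\<omega>. (f i \<omega> - f j \<omega>)\<^sup>2 \<partial>M)" by simp
      also have "ennreal (\<integral>\<omega>. (f i \<omega> - f j \<omega>)\<^sup>2 \<partial>M) \<le> ennreal (e\<^sup>2 / 2)"
        using N[OF that(2,1)] nn_integral_eq_integral[OF i2] by simp
      then have "(\<integral>\<omega>. (f i \<omega> - f j \<omega>)\<^sup>2 \<partial>M) \<le> e\<^sup>2 / 2" by (simp add: ennreal_le_iff)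
      also have "\<dots> < e\<^sup>2" using e by simp
      finally show ?thesis using e by (rule power_less_imp_less_base[OF _ less_imp_le])
    qed
    then show ?thesis by blast
  qed
  have int: "integrable M (f n)" for n by (rule square_integrable_imp_integrable(1)[OF f fi])
  obtain r where r: "strict_mono r" "AE \<omega> in M. Cauchy (\<lambda>i. f (r i) \<omega>)"
    by (rule cauchy_L1_AE_cauchy_subseq[OF int L1])
  define I where "I \<omega> = lim (\<lambda>i. f (r i) \<omega>)" for \<omega>
  have [measurable]: "I \<in> borel_measurable M" unfolding I_def[abs_def] by (rule borel_measurable_lim_metric) simp
  have lim: "AE \<omega> in M. (\<lambda>i. f (r i) \<omega>) \<longlonglongrightarrow> I \<omega>"
    using r(2)
  proof eventually_elim
    case (elim \<omega>)
    then have "convergent (\<lambda>i. f (r i) \<omega>)" by (rule Cauchy_convergent)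
    then show ?case unfolding I_def by (simp add: convergent_LIMSEQ_iff)
  qed
  have "(\<lambda>n. \<integral>\<^sup>+\<omega>. ennreal ((f n \<omega> - I \<omega>)\<^sup>2) \<partial>M) \<longlonglongrightarrow> 0"
  proof (rule order_tendstoI)
    fix a :: ennreal assume "0 < a"
    then obtain b where b: "0 < b" "b < a" using dense by blast
    then obtain \<delta> where \<delta>: "\<delta> > 0" "ennreal \<delta> < a"
      by (cases b) auto
    from Cauchy[OF \<delta>(1)] obtain N where N: "\<And>m n. m \<ge> N \<Longrightarrow> n \<ge> N \<Longrightarrow> (\<integral>\<^sup>+\<omega>. ennreal ((f n \<omega> - f m \<omega>)\<^sup>2) \<partial>M) \<le> ennreal \<delta>"
      by blast
    have "(\<integral>\<^sup>+\<omega>. ennreal ((f n \<omega> - I \<omega>)\<^sup>2) \<partial>M) < a" if n: "n \<ge> N" for n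
    proof -
      have "(\<integral>\<^sup>+\<omega>. ennreal ((f n \<omega> - I \<omega>)\<^sup>2) \<partial>M) = (\<integral>\<^sup>+\<omega>. liminf (\<lambda>i. ennreal ((f n \<omega> - f (r i) \<omega>)\<^sup>2)) \<partial>M)"
      proof (rule nn_integral_cong_AE)
        show "AE \<omega> in M. ennreal ((f n \<omega> - I \<omega>)\<^sup>2) = liminf (\<lambda>i. ennreal ((f n \<omega> - f (r i) \<omega>)\<^sup>2))"
          using lim
        proof eventually_elim
          case (elim \<omega>)
          then have "(\<lambda>i. ennreal ((f n \<omega> - f (r i) \<omega>)\<^sup>2)) \<longlonglongrightarrow> ennreal ((f n \<omega> - I \<omega>)\<^sup>2)"
            by (intro tendsto_ennrealI tendsto_power tendsto_diff tendsto_const)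
          from lim_imp_Liminf[OF sequentially_bot this] show ?case by simp
        qed
      qed
      also have "\<dots> \<le> liminf (\<lambda>i. \<integral>\<^sup>+\<omega>. ennreal ((f n \<omega> - f (r i) \<omega>)\<^sup>2) \<partial>M)"
        by (rule nn_integral_liminf) measurable
      also have "\<dots> \<le> liminf (\<lambda>i::nat. ennreal \<delta>)"
      proof (rule Liminf_mono)
        have "r i \<ge> N" if "i \<ge> N" for i using seq_suble[OF r(1), of i] that by simp
        then show "\<forall>\<^sub>F i in sequentially. (\<integral>\<^sup>+\<omega>. ennreal ((f n \<omega> - f (r i) \<omega>)\<^sup>2) \<partial>M) \<le> ennreal \<delta>"
          unfolding eventually_sequentially using N n by blast
      qed
      also have "\<dots> = ennreal \<delta>" by (rule Liminf_const) simp
      finally show ?thesis using \<delta>(2) by simp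
    qed
    then show "\<forall>\<^sub>F n in sequentially. (\<integral>\<^sup>+\<omega>. ennreal ((f n \<omega> - I \<omega>)\<^sup>2) \<partial>M) < a"
      unfolding eventually_sequentially by blast
  qed simp
  then have "L2_tendsto M f I" unfolding L2_tendsto_def by simp
  then show thesis by (rule that)
qed

end

section \<open>The forward integral and the classical integral\<close>

text \<open>Reduces to the triangle lemma with the zero process. The other half of \<delta> is spent
  on that process, as the bound in \<open>sup_small\<close> is strict.\<close>

lemma (in prob_space) sup_small_AE_cong:
  assumes f: "sup_small T \<eta> (\<delta> / 2) f" and \<delta>: "\<delta> > 0" and eq: "AE \<omega> in M. \<forall>t\<in>{0..T}. h t \<omega> = f t \<omega>"
  shows "sup_small T \<eta> \<delta> h"
proof -
  have zero: "sup_small T 0 (\<delta> / 2) (\<lambda>t \<omega>. 0)" by (rule sup_smallI[of "{}"]) (use \<delta> in simp_all)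
  have "AE \<omega> in M. \<forall>t\<in>{0..T}. \<bar>h t \<omega>\<bar> \<le> \<bar>f t \<omega>\<bar> + \<bar>0\<bar>" using eq by eventually_elim simp
  from sup_small_triangle[OF f zero this] show ?thesis by simp
qed

lemma forward_approximation_cong:
  assumes "\<And>t. X t \<omega> = X' t \<omega>"
  shows "forward_approximation X Y \<epsilon> t \<omega> = forward_approximation X' Y \<epsilon> t \<omega>"
  unfolding forward_approximation_def assms ..

context completed_wiener
begin

section \<open>Coordinates of the integrand\<close>

context
  fixes J :: "nat set" and v :: "nat \<Rightarrow> 'w" and X :: "nat \<Rightarrow> real \<Rightarrow> 'a \<Rightarrow> real" and T :: real and g :: "real \<Rightarrow> 'a \<Rightarrow> 'w"
  assumes orth: "\<And>i j. i \<in> J \<Longrightarrow> j \<in> J \<Longrightarrow> inner (v i) (v j) = (if i = j then 1 else 0)"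
    and family: "orthonormal_family M F X J"
    and XW: "\<And>j. AE \<omega> in M. \<forall>t. X j t \<omega> = W t (v j) \<omega>"
    and T: "T > 0" and g: "predictable_L2 M F T g"
begin

interpretation X: orthonormal_family M F X J by (rule family)

abbreviation coordinate :: "nat \<Rightarrow> real \<Rightarrow> 'a \<Rightarrow> real" where
  "coordinate j s \<omega> \<equiv> inner (g s \<omega>) (v j)"

abbreviation integrator :: "nat \<Rightarrow> real \<Rightarrow> 'a \<Rightarrow> real" where
  "integrator j t \<equiv> W t (v j)"

lemma g_measurable: "(\<lambda>p. g (fst p) (snd p)) \<in> borel_measurable (predictable_sigma M F T)"
  using g unfolding predictable_L2_def by (simp add: case_prod_beta')

lemma g_integrable: "integrable (time_measure M T) (\<lambda>p. (norm (g (fst p) (snd p)))\<^sup>2)"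
  using g unfolding predictable_L2_def by (simp add: case_prod_beta')

lemma coordinate_measurable: "(\<lambda>p. coordinate j (fst p) (snd p)) \<in> borel_measurable (predictable_sigma M F T)"
  by (rule measurable_compose[OF g_measurable borel_measurable_continuous_onI]) (intro continuous_intros)

lemma coordinate_time_measurable: "(\<lambda>p. coordinate j (fst p) (snd p)) \<in> borel_measurable (time_measure M T)"
  by (rule predictable_measurable_time_measure[OF T coordinate_measurable])

text \<open>A coordinate is dominated by the norm, which is Bessel's inequality for one
  vector.\<close>

lemma coordinate_predictable:
  assumes j: "j \<in> J"
  shows "predictable_L2 M F T (coordinate j)"
proof -
  have "integrable (time_measure M T) (\<lambda>p. (norm (coordinate j (fst p) (snd p)))\<^sup>2)"
  proof (rule Bochner_Integration.integrable_bound[OF g_integrable])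
    show "(\<lambda>p. (norm (coordinate j (fst p) (snd p)))\<^sup>2) \<in> borel_measurable (time_measure M T)"
      using coordinate_time_measurable by simp
    show "AE p in time_measure M T. norm ((norm (coordinate j (fst p) (snd p)))\<^sup>2) \<le> norm ((norm (g (fst p) (snd p)))\<^sup>2)"
    proof (rule AE_I2)
      fix p
      show "norm ((norm (coordinate j (fst p) (snd p)))\<^sup>2) \<le> norm ((norm (g (fst p) (snd p)))\<^sup>2)"
        using Bessel_inequality[of "{j}" v "g (fst p) (snd p)"] orth[OF j j] by simp
    qed
  qed
  then show ?thesis
    unfolding predictable_L2_def using coordinate_measurable by (simp add: case_prod_beta')
qed

text \<open>Bessel's inequality at each point of time and probability. The bound does not depend on
  \<open>K\<close>, which makes the energies of the coordinates summable.\<close>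

lemma sum_energy_le:
  assumes K: "finite K" "K \<subseteq> J"
  shows "(\<Sum>j\<in>K. energy T (coordinate j)) \<le> (\<integral>\<^sup>+p. ennreal ((norm (g (fst p) (snd p)))\<^sup>2) \<partial>time_measure M T)"
proof -
  have "(\<Sum>j\<in>K. energy T (coordinate j)) = (\<Sum>j\<in>K. \<integral>\<^sup>+p. ennreal ((coordinate j (fst p) (snd p))\<^sup>2) \<partial>time_measure M T)"
    using coordinate_time_measurable
    by (intro sum.cong refl) (subst energy_eq_nn_integral[OF T], simp_all add: case_prod_beta')
  also have "\<dots> = (\<integral>\<^sup>+p. (\<Sum>j\<in>K. ennreal ((coordinate j (fst p) (snd p))\<^sup>2)) \<partial>time_measure M T)"
    using coordinate_time_measurable by (intro nn_integral_sum[symmetric]) simp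
  also have "\<dots> \<le> (\<integral>\<^sup>+p. ennreal ((norm (g (fst p) (snd p)))\<^sup>2) \<partial>time_measure M T)"
  proof (rule nn_integral_mono)
    fix p
    have "(\<Sum>j\<in>K. ennreal ((coordinate j (fst p) (snd p))\<^sup>2)) = ennreal (\<Sum>j\<in>K. (coordinate j (fst p) (snd p))\<^sup>2)"
      by (rule sum_ennreal) simp
    also have "\<dots> \<le> ennreal ((norm (g (fst p) (snd p)))\<^sup>2)"
      using K(2) by (intro ennreal_leI Bessel_inequality K(1) orth) auto
    finally show "(\<Sum>j\<in>K. ennreal ((coordinate j (fst p) (snd p))\<^sup>2)) \<le> ennreal ((norm (g (fst p) (snd p)))\<^sup>2)" .
  qed
  finally show ?thesis .
qed

lemma integrator_measurable: "0 \<le> t \<Longrightarrow> integrator j t \<in> borel_measurable M"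
  by (rule W_measurable)

lemma AE_forward_approximation:
  "AE \<omega> in M. \<forall>\<epsilon> t. forward_approximation (X j) Y \<epsilon> t \<omega> = forward_approximation (integrator j) Y \<epsilon> t \<omega>"
  using XW[of j]
proof eventually_elim
  case (elim \<omega>)
  then show ?case by (intro allI forward_approximation_cong) simp
qed

lemma AE_simple_integral:
  "AE \<omega> in M. simple_integral (integrator j) n \<tau> \<xi> \<omega> = simple_integral (X j) n \<tau> \<xi> \<omega>"
  using XW[of j] by eventually_elim (simp add: simple_integral_def)

text \<open>Time and probability together have finite measure, so square integrability implies
  integrability, and Fubini passes to almost every path.\<close>

lemma coordinate_path_integrable:
  assumes j: "j \<in> J"
  shows "AE \<omega> in M. set_integrable lborel {0..T} (\<lambda>s. coordinate j s \<omega>)"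
proof -
  interpret TM: finite_measure "time_measure M T" by (rule finite_time_measure[OF T])
  interpret R: finite_measure "restrict_space lborel {0..T}"
    by (rule finite_measureI) (use T in \<open>simp add: emeasure_restrict_space space_restrict_space\<close>)
  interpret P: pair_sigma_finite "restrict_space lborel {0..T}" M ..
  interpret P': pair_sigma_finite M "restrict_space lborel {0..T}" ..
  have "integrable (time_measure M T) (\<lambda>p. (coordinate j (fst p) (snd p))\<^sup>2)"
    using coordinate_predictable[OF j] unfolding predictable_L2_def by (simp add: case_prod_beta')
  then have "integrable (time_measure M T) (\<lambda>p. coordinate j (fst p) (snd p) * 1)"
    using coordinate_time_measurable by (intro integrable_mult_of_squares) simp_all
  then have "integrable (M \<Otimes>\<^sub>M restrict_space lborel {0..T}) (\<lambda>(\<omega>, s). coordinate j s \<omega>)"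
    using P.integrable_product_swap[of "\<lambda>p. coordinate j (fst p) (snd p)"] by (simp add: case_prod_beta')
  then have "AE \<omega> in M. integrable (restrict_space lborel {0..T}) (\<lambda>s. coordinate j s \<omega>)"
    using P'.AE_integrable_fst'[of "\<lambda>(\<omega>, s). coordinate j s \<omega>"] by simp
  then show ?thesis
    by eventually_elim (simp add: integrable_restrict_space set_integrable_def)
qed

lemma coordinate_limit:
  assumes j: "j \<in> J"
  obtains L where "\<And>t. 0 \<le> t \<Longrightarrow> t \<le> T \<Longrightarrow> L t \<in> borel_measurable M"
    and "\<And>\<eta> \<delta>. \<eta> > 0 \<Longrightarrow> \<delta> > 0 \<Longrightarrow>
      \<forall>\<^sub>F \<epsilon> in at_right 0. sup_small T \<eta> \<delta> (\<lambda>t \<omega>. forward_approximation (X j) (coordinate j) \<epsilon> t \<omega> - L t \<omega>)"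
proof (rule X.forward_limit_exists[OF T j predictable_L2_energy(2)[OF T coordinate_predictable[OF j]]
      predictable_L2_energy(1)[OF T coordinate_predictable[OF j]]
      predictable_L2_simple_approximation[OF T coordinate_predictable[OF j]]])
  fix L assume "\<And>t. 0 \<le> t \<Longrightarrow> t \<le> T \<Longrightarrow> L t \<in> borel_measurable M" "\<And>\<eta> \<delta>. \<eta> > 0 \<Longrightarrow> \<delta> > 0 \<Longrightarrow>
    \<forall>\<^sub>F \<epsilon> in at_right 0. sup_small T \<eta> \<delta> (\<lambda>t \<omega>. forward_approximation (X j) (coordinate j) \<epsilon> t \<omega> - L t \<omega>)"
  then show thesis by (rule that)
qed

text \<open>Limits are found for the modification \<open>X\<close>; they pass to \<open>W\<close>
  because the forward approximations of both agree for all \<epsilon> and \<open>t\<close> off one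
  null set.\<close>

lemma has_forward_integralI:
  assumes j: "j \<in> J" and L: "\<And>t. 0 \<le> t \<Longrightarrow> t \<le> T \<Longrightarrow> L t \<in> borel_measurable M"
    and lim: "\<And>\<eta> \<delta>. \<eta> > 0 \<Longrightarrow> \<delta> > 0 \<Longrightarrow>
      \<forall>\<^sub>F \<epsilon> in at_right 0. sup_small T \<eta> \<delta> (\<lambda>t \<omega>. forward_approximation (X j) (coordinate j) \<epsilon> t \<omega> - L t \<omega>)"
  shows "has_forward_integral M T (integrator j) (coordinate j) L"
  unfolding has_forward_integral_def sup_small_def[symmetric]
proof (intro conjI allI impI ballI W_continuous coordinate_path_integrable j)
  fix t assume "t \<in> {0..T}"
  then show "L t \<in> borel_measurable M" using L by simp
next
  fix \<eta> \<delta> :: real assume \<eta>: "\<eta> > 0" and \<delta>: "\<delta> > 0"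
  then have "\<forall>\<^sub>F \<epsilon> in at_right 0. sup_small T \<eta> (\<delta> / 2) (\<lambda>t \<omega>. forward_approximation (X j) (coordinate j) \<epsilon> t \<omega> - L t \<omega>)"
    by (intro lim) simp_all
  then show "\<forall>\<^sub>F \<epsilon> in at_right 0. sup_small T \<eta> \<delta> (\<lambda>t \<omega>. forward_approximation (integrator j) (coordinate j) \<epsilon> t \<omega> - L t \<omega>)"
  proof eventually_elim
    case (elim \<epsilon>)
    show ?case
    proof (rule sup_small_AE_cong[OF elim \<delta>])
      show "AE \<omega> in M. \<forall>t\<in>{0..T}. forward_approximation (integrator j) (coordinate j) \<epsilon> t \<omega> - L t \<omega>
          = forward_approximation (X j) (coordinate j) \<epsilon> t \<omega> - L t \<omega>"
        using AE_forward_approximation[of j "coordinate j"] by eventually_elim simp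
    qed
  qed
qed

text \<open>The converse transfer, for an arbitrary witness \<open>L\<close>; the uniqueness claim
  has to treat every such witness.\<close>

lemma has_forward_integralD:
  assumes "has_forward_integral M T (integrator j) (coordinate j) L"
  shows "limit_in_probability (\<lambda>\<epsilon>. forward_approximation (X j) (coordinate j) \<epsilon> T) (L T)"
    and "L T \<in> borel_measurable M"
proof -
  show "L T \<in> borel_measurable M" using assms T unfolding has_forward_integral_def by simp
  show "limit_in_probability (\<lambda>\<epsilon>. forward_approximation (X j) (coordinate j) \<epsilon> T) (L T)"
  proof (rule X.limit_in_probability_at_end[OF T])
    fix \<eta> \<delta> :: real assume \<eta>: "\<eta> > 0" and \<delta>: "\<delta> > 0"
    have "\<forall>\<^sub>F \<epsilon> in at_right 0. sup_small T \<eta> (\<delta> / 2) (\<lambda>t \<omega>. forward_approximation (integrator j) (coordinate j) \<epsilon> t \<omega> - L t \<omega>)"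
      using assms \<eta> \<delta> unfolding has_forward_integral_def sup_small_def[symmetric] by simp
    then show "\<forall>\<^sub>F \<epsilon> in at_right 0. sup_small T \<eta> \<delta> (\<lambda>t \<omega>. forward_approximation (X j) (coordinate j) \<epsilon> t \<omega> - L t \<omega>)"
    proof eventually_elim
      case (elim \<epsilon>)
      show ?case
      proof (rule sup_small_AE_cong[OF elim \<delta>])
        show "AE \<omega> in M. \<forall>t\<in>{0..T}. forward_approximation (X j) (coordinate j) \<epsilon> t \<omega> - L t \<omega>
            = forward_approximation (integrator j) (coordinate j) \<epsilon> t \<omega> - L t \<omega>"
          using AE_forward_approximation[of j "coordinate j"] by eventually_elim simp
      qed
    qed
  qed
qed

section \<open>Identification with the Ito integral\<close>

context
  fixes j c
  assumes j: "j \<in> J" and c: "limit_in_probability (\<lambda>\<epsilon>. forward_approximation (X j) (coordinate j) \<epsilon> T) c"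
    and c_measurable: "c \<in> borel_measurable M"
begin

lemma simple_integral_measurable:
  assumes "simple_data M F T n \<tau> \<xi>"
  shows "simple_integral (integrator j) n \<tau> \<xi> \<in> borel_measurable M"
  unfolding simple_integral_def[abs_def]
proof (intro borel_measurable_sum borel_measurable_times borel_measurable_diff)
  fix i assume "i \<in> {..<n}"
  then have i: "\<xi> i \<in> borel_measurable (F (\<tau> i))" "0 \<le> \<tau> i" "0 \<le> \<tau> (Suc i)"
    using assms unfolding simple_data_def by simp_all
  show "\<xi> i \<in> borel_measurable M" by (rule filtration_measurable[OF i(1)])
  show "integrator j (\<tau> (Suc i)) \<in> borel_measurable M" "integrator j (\<tau> i) \<in> borel_measurable M"
    using i by (simp_all add: integrator_measurable)
qed

text \<open>True along every approximating sequence, because the distance to \<open>c\<close> is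
  bounded by the energy of the approximation error. That energy is finite from some index on, as it
  tends to 0.\<close>

lemma simple_integrals_converge:
  assumes sd: "\<And>k. simple_data M F T (n k) (\<tau> k) (\<xi> k)"
    and conv: "L2_tendsto (time_measure M T) (\<lambda>k (s, \<omega>). simple_process (n k) (\<tau> k) (\<xi> k) s \<omega>) (\<lambda>(s, \<omega>). coordinate j s \<omega>)"
  shows "L2_tendsto M (\<lambda>k. simple_integral (integrator j) (n k) (\<tau> k) (\<xi> k)) c"
  unfolding L2_tendsto_def
proof (intro conjI allI simple_integral_measurable sd c_measurable)
  define E where "E k = energy T (\<lambda>s \<omega>. coordinate j s \<omega> - simple_process (n k) (\<tau> k) (\<xi> k) s \<omega>)" for k
  have E: "E \<longlonglongrightarrow> 0"
    unfolding E_def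
    using conv L2_tendsto_simple_process_iff[OF T coordinate_predictable[OF j] sd] by simp
  then have fin: "\<forall>\<^sub>F k in sequentially. E k < \<infinity>" by (rule order_tendstoD) simp
  have "(\<lambda>k. 2 * E k) \<longlonglongrightarrow> 2 * 0" by (intro ennreal_tendsto_cmult E) simp
  then have lim: "(\<lambda>k. 2 * E k) \<longlonglongrightarrow> 0" by simp
  show "(\<lambda>k. \<integral>\<^sup>+\<omega>. ennreal ((simple_integral (integrator j) (n k) (\<tau> k) (\<xi> k) \<omega> - c \<omega>)\<^sup>2) \<partial>M) \<longlonglongrightarrow> 0"
  proof (rule tendsto_sandwich[OF _ _ tendsto_const lim])
    show "\<forall>\<^sub>F k in sequentially. (\<integral>\<^sup>+\<omega>. ennreal ((simple_integral (integrator j) (n k) (\<tau> k) (\<xi> k) \<omega> - c \<omega>)\<^sup>2) \<partial>M) \<le> 2 * E k"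
      using fin
    proof eventually_elim
      case (elim k)
      have "(\<integral>\<^sup>+\<omega>. ennreal ((simple_integral (integrator j) (n k) (\<tau> k) (\<xi> k) \<omega> - c \<omega>)\<^sup>2) \<partial>M)
          = (\<integral>\<^sup>+\<omega>. ennreal ((c \<omega> - simple_integral (X j) (n k) (\<tau> k) (\<xi> k) \<omega>)\<^sup>2) \<partial>M)"
      proof (rule nn_integral_cong_AE)
        show "AE \<omega> in M. ennreal ((simple_integral (integrator j) (n k) (\<tau> k) (\<xi> k) \<omega> - c \<omega>)\<^sup>2)
            = ennreal ((c \<omega> - simple_integral (X j) (n k) (\<tau> k) (\<xi> k) \<omega>)\<^sup>2)"
          using AE_simple_integral[of j "n k" "\<tau> k" "\<xi> k"] by eventually_elim (simp add: power2_commute)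
      qed
      also have "\<dots> \<le> 2 * E k"
        unfolding E_def
        by (rule X.forward_limit_simple_distance[OF T j predictable_L2_energy(2)[OF T coordinate_predictable[OF j]]
              predictable_L2_energy(1)[OF T coordinate_predictable[OF j]] sd c c_measurable elim[unfolded E_def]])
      finally show ?case .
    qed
  qed simp
qed

lemma has_ito_integral_limit: "has_ito_integral M F T (integrator j) (coordinate j) c"
proof -
  \<comment> \<open>The data of the simple process are packed into one triple, for a single use of
    choice.\<close>
  have "\<forall>k. \<exists>p. simple_data M F T (fst p) (fst (snd p)) (snd (snd p)) \<and>
      energy T (\<lambda>s \<omega>. coordinate j s \<omega> - simple_process (fst p) (fst (snd p)) (snd (snd p)) s \<omega>) < ennreal (inverse (real (Suc k)))"
  proof
    fix k
    obtain n \<tau> \<xi> where "simple_data M F T n \<tau> \<xi>"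
      "energy T (\<lambda>s \<omega>. coordinate j s \<omega> - simple_process n \<tau> \<xi> s \<omega>) < ennreal (inverse (real (Suc k)))"
      using predictable_L2_simple_approximation[OF T coordinate_predictable[OF j], of "inverse (real (Suc k))"] by auto
    then show "\<exists>p. simple_data M F T (fst p) (fst (snd p)) (snd (snd p)) \<and>
      energy T (\<lambda>s \<omega>. coordinate j s \<omega> - simple_process (fst p) (fst (snd p)) (snd (snd p)) s \<omega>) < ennreal (inverse (real (Suc k)))"
      by (intro exI[of _ "(n, \<tau>, \<xi>)"]) simp
  qed
  from choice[OF this] obtain p where p: "\<And>k. simple_data M F T (fst (p k)) (fst (snd (p k))) (snd (snd (p k)))"
    "\<And>k. energy T (\<lambda>s \<omega>. coordinate j s \<omega> - simple_process (fst (p k)) (fst (snd (p k))) (snd (snd (p k))) s \<omega>) < ennreal (inverse (real (Suc k)))"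
    by blast
  have "(\<lambda>k. ennreal (inverse (real (Suc k)))) \<longlonglongrightarrow> ennreal 0"
    by (intro tendsto_ennrealI LIMSEQ_inverse_real_of_nat)
  then have lim: "(\<lambda>k. ennreal (inverse (real (Suc k)))) \<longlonglongrightarrow> 0" by simp
  have "(\<lambda>k. energy T (\<lambda>s \<omega>. coordinate j s \<omega> - simple_process (fst (p k)) (fst (snd (p k))) (snd (snd (p k))) s \<omega>)) \<longlonglongrightarrow> 0"
    by (rule tendsto_sandwich[OF _ _ tendsto_const lim]) (intro always_eventually allI zero_le less_imp_le[OF p(2)])+
  then have conv: "L2_tendsto (time_measure M T)
      (\<lambda>k (s, \<omega>). simple_process (fst (p k)) (fst (snd (p k))) (snd (snd (p k))) s \<omega>) (\<lambda>(s, \<omega>). coordinate j s \<omega>)"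
    using L2_tendsto_simple_process_iff[OF T coordinate_predictable[OF j] p(1)] by simp
  show ?thesis
    unfolding has_ito_integral_def
    using p(1) conv simple_integrals_converge[OF p(1) conv] coordinate_predictable[OF j]
    by (intro conjI exI[of _ "\<lambda>k. fst (p k)"] exI[of _ "\<lambda>k. fst (snd (p k))"] exI[of _ "\<lambda>k. snd (snd (p k))"] allI)
qed

text \<open>The simple integrals that witness \<open>c'\<close> converge to \<open>c\<close> as
  well.\<close>

lemma has_ito_integral_unique:
  assumes "has_ito_integral M F T (integrator j) (coordinate j) c'"
  shows "AE \<omega> in M. c \<omega> = c' \<omega>"
proof -
  obtain n \<tau> \<xi> where sd: "\<And>k. simple_data M F T (n k) (\<tau> k) (\<xi> k)"
    and conv: "L2_tendsto (time_measure M T) (\<lambda>k (s, \<omega>). simple_process (n k) (\<tau> k) (\<xi> k) s \<omega>) (\<lambda>(s, \<omega>). coordinate j s \<omega>)"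
    and c': "L2_tendsto M (\<lambda>k. simple_integral (integrator j) (n k) (\<tau> k) (\<xi> k)) c'"
    using assms unfolding has_ito_integral_def by auto
  show ?thesis by (rule L2_tendsto_unique[OF simple_integrals_converge[OF sd conv] c'])
qed

end

section \<open>Convergence of the series\<close>

text \<open>A stretch of the series has squared \<open>L\<^sup>2\<close> norm at most twice the sum
  of the energies of its coordinates. These energies are summable, so the partial sums are Cauchy in
  \<open>L\<^sup>2\<close>.\<close>

lemma partial_sums_converge:
  assumes c: "\<And>j. j \<in> J \<Longrightarrow> limit_in_probability (\<lambda>\<epsilon>. forward_approximation (X j) (coordinate j) \<epsilon> T) (c j)"
    and cm: "\<And>j. j \<in> J \<Longrightarrow> c j \<in> borel_measurable M"
  obtains I where "L2_tendsto M (\<lambda>m \<omega>. \<Sum>j | j \<in> J \<and> j < m. c j \<omega>) I"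
proof -
  \<comment> \<open>Extending the energies by 0 outside \<open>J\<close> turns sums over parts of
    \<open>J\<close> into sums over intervals of indices, for finite and infinite \<open>J\<close>
    alike.\<close>
  define a where "a j = (if j \<in> J then enn2real (energy T (coordinate j)) else 0)" for j
  define G where "G = enn2real (\<integral>\<^sup>+p. ennreal ((norm (g (fst p) (snd p)))\<^sup>2) \<partial>time_measure M T)"
  have G: "(\<integral>\<^sup>+p. ennreal ((norm (g (fst p) (snd p)))\<^sup>2) \<partial>time_measure M T) = ennreal G"
    unfolding G_def using g_integrable by (simp add: integrable_iff_bounded)
  have a: "a j \<ge> 0" for j by (simp add: a_def)
  have fin: "energy T (coordinate j) < \<infinity>" if "j \<in> J" for j
    by (rule predictable_L2_energy(1)[OF T coordinate_predictable[OF that]])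
  have sum_a: "(\<Sum>j\<in>K \<inter> J. energy T (coordinate j)) = ennreal (\<Sum>j\<in>K. a j)" if "finite K" for K
  proof -
    have "(\<Sum>j\<in>K \<inter> J. energy T (coordinate j)) = (\<Sum>j\<in>K \<inter> J. ennreal (a j))"
      using fin by (intro sum.cong refl) (simp add: a_def)
    also have "\<dots> = ennreal (\<Sum>j\<in>K \<inter> J. a j)" using a by (intro sum_ennreal)
    also have "(\<Sum>j\<in>K \<inter> J. a j) = (\<Sum>j\<in>K. a j)"
      using that by (intro sum.mono_neutral_left) (auto simp: a_def)
    finally show ?thesis .
  qed
  have "(\<Sum>j<n. a j) \<le> G" for n
  proof -
    have "ennreal (\<Sum>j<n. a j) \<le> ennreal G"
      using sum_energy_le[of "{..<n} \<inter> J"] sum_a[of "{..<n}"] unfolding G by simp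
    then show ?thesis by (subst (asm) ennreal_le_iff) (simp_all add: G_def)
  qed
  then have summable: "summable a" using a by (intro summableI_nonneg_bounded) auto
  have sq: "(\<integral>\<^sup>+\<omega>. ennreal ((\<Sum>j\<in>K \<inter> J. c j \<omega>)\<^sup>2) \<partial>M) \<le> ennreal (2 * (\<Sum>j\<in>K. a j))" if "finite K" for K
  proof -
    have "(\<integral>\<^sup>+\<omega>. ennreal ((\<Sum>j\<in>K \<inter> J. c j \<omega>)\<^sup>2) \<partial>M) \<le> 2 * (\<Sum>j\<in>K \<inter> J. energy T (coordinate j))"
      by (rule X.forward_limit_sum_square[OF T])
        (use that fin c cm predictable_L2_energy(2)[OF T coordinate_predictable] in auto)
    also have "\<dots> = ennreal (2 * (\<Sum>j\<in>K. a j))"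
      using a by (simp add: sum_a[OF that] ennreal_mult sum_nonneg)
    finally show ?thesis .
  qed
  define P where "P m \<omega> = (\<Sum>j | j \<in> J \<and> j < m. c j \<omega>)" for m \<omega>
  have P: "P m \<omega> = (\<Sum>j\<in>{..<m} \<inter> J. c j \<omega>)" for m \<omega>
    unfolding P_def by (intro sum.cong) auto
  have Pm: "P m \<in> borel_measurable M" for m
    unfolding P_def[abs_def] using cm by (intro borel_measurable_sum) auto
  have diff: "(\<integral>\<^sup>+\<omega>. ennreal ((P n \<omega> - P m \<omega>)\<^sup>2) \<partial>M) \<le> ennreal (2 * (\<Sum>j\<in>{m..<n}. a j))" if "m \<le> n" for m n
  proof -
    have "P n \<omega> - P m \<omega> = (\<Sum>j\<in>{m..<n} \<inter> J. c j \<omega>)" for \<omega>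
    proof -
      have "{..<n} \<inter> J = ({..<m} \<inter> J) \<union> ({m..<n} \<inter> J)" using that by auto
      moreover have "(\<Sum>j\<in>({..<m} \<inter> J) \<union> ({m..<n} \<inter> J). c j \<omega>) = (\<Sum>j\<in>{..<m} \<inter> J. c j \<omega>) + (\<Sum>j\<in>{m..<n} \<inter> J. c j \<omega>)"
        by (intro sum.union_disjoint) auto
      ultimately show ?thesis by (simp add: P)
    qed
    then show ?thesis using sq[of "{m..<n}"] by simp
  qed
  obtain I where "L2_tendsto M P I"
  proof (rule L2_complete[OF Pm])
    show "integrable M (\<lambda>\<omega>. (P n \<omega>)\<^sup>2)" for n
    proof (rule integrableI_bounded)
      show "(\<lambda>\<omega>. (P n \<omega>)\<^sup>2) \<in> borel_measurable M" using Pm by simp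
      have "(\<integral>\<^sup>+\<omega>. ennreal ((P n \<omega>)\<^sup>2) \<partial>M) < \<infinity>"
        using le_less_trans[OF sq[of "{..<n}"] ennreal_less_top] by (simp add: P)
      then show "(\<integral>\<^sup>+\<omega>. ennreal (norm ((P n \<omega>)\<^sup>2)) \<partial>M) < \<infinity>" by simp
    qed
    fix \<delta> :: real assume \<delta>: "\<delta> > 0"
    then have "\<delta> / 2 > 0" by simp
    with summable obtain N where N: "\<And>m n. m \<ge> N \<Longrightarrow> norm (sum a {m..<n}) < \<delta> / 2"
      unfolding summable_Cauchy by blast
    have *: "(\<integral>\<^sup>+\<omega>. ennreal ((P n \<omega> - P m \<omega>)\<^sup>2) \<partial>M) \<le> ennreal \<delta>" if "m \<ge> N" "m \<le> n" for m n
    proof -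
      have "2 * (\<Sum>j\<in>{m..<n}. a j) \<le> \<delta>" using N[OF that(1), of n] by simp
      with diff[OF that(2)] show ?thesis using order_trans ennreal_leI by blast
    qed
    have "(\<integral>\<^sup>+\<omega>. ennreal ((P n \<omega> - P m \<omega>)\<^sup>2) \<partial>M) \<le> ennreal \<delta>" if "m \<ge> N" "n \<ge> N" for m n
      using *[of m n] *[of n m] that by (cases "m \<le> n") (simp_all add: power2_commute)
    then show "\<exists>N. \<forall>m\<ge>N. \<forall>n\<ge>N. (\<integral>\<^sup>+\<omega>. ennreal ((P n \<omega> - P m \<omega>)\<^sup>2) \<partial>M) \<le> ennreal \<delta>" by blast
  qed
  then show thesis using that unfolding P_def[abs_def] by blast
qed

text \<open>The terminal values \<open>L j T\<close> of the forward limits serve as the Ito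
  integrals, so one \<open>L\<^sup>2\<close> limit is a witness for both notions. For the last claim
  arbitrary witnesses are compared term by term and then in the limit in probability.\<close>

lemma forward_and_classical_integral:
  shows "(\<exists>I. has_russo_vallois_forward_integral M T J v W g I) \<and>
    (\<exists>I. has_classical_integral M F T J v W g I) \<and>
    (\<forall>I I'. has_russo_vallois_forward_integral M T J v W g I \<longrightarrow>
       has_classical_integral M F T J v W g I' \<longrightarrow> (AE \<omega> in M. I \<omega> = I' \<omega>))"
proof (intro conjI allI impI)
  have "\<forall>j. \<exists>L. j \<in> J \<longrightarrow> has_forward_integral M T (integrator j) (coordinate j) L"
  proof
    fix j
    show "\<exists>L. j \<in> J \<longrightarrow> has_forward_integral M T (integrator j) (coordinate j) L"
    proof (cases "j \<in> J")
      case True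
      from coordinate_limit[OF True] obtain L where L: "\<And>t. 0 \<le> t \<Longrightarrow> t \<le> T \<Longrightarrow> L t \<in> borel_measurable M"
        "\<And>\<eta> \<delta>. \<eta> > 0 \<Longrightarrow> \<delta> > 0 \<Longrightarrow>
          \<forall>\<^sub>F \<epsilon> in at_right 0. sup_small T \<eta> \<delta> (\<lambda>t \<omega>. forward_approximation (X j) (coordinate j) \<epsilon> t \<omega> - L t \<omega>)" by blast
      have "has_forward_integral M T (integrator j) (coordinate j) L" by (rule has_forward_integralI[OF True L])
      then show ?thesis by blast
    qed simp
  qed
  from choice[OF this] obtain L where L: "\<And>j. j \<in> J \<Longrightarrow> has_forward_integral M T (integrator j) (coordinate j) (L j)" by blast
  have lim: "limit_in_probability (\<lambda>\<epsilon>. forward_approximation (X j) (coordinate j) \<epsilon> T) (L j T)"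
    and Lm: "L j T \<in> borel_measurable M" if "j \<in> J" for j
    by (rule has_forward_integralD[OF L[OF that]])+
  obtain I where I: "L2_tendsto M (\<lambda>m \<omega>. \<Sum>j | j \<in> J \<and> j < m. L j T \<omega>) I"
    using partial_sums_converge[of "\<lambda>j. L j T", OF lim Lm] by blast
  show "\<exists>I. has_classical_integral M F T J v W g I"
    unfolding has_classical_integral_def
    using I has_ito_integral_limit[OF _ lim Lm] by (intro exI[of _ I] exI[of _ "\<lambda>j. L j T"]) blast
  show "\<exists>I. has_russo_vallois_forward_integral M T J v W g I"
    unfolding has_russo_vallois_forward_integral_def
    using L L2_tendsto_imp_tendsto_in_probability[OF I] by (intro exI[of _ I] exI[of _ L]) blast
  fix I I'
  assume "has_russo_vallois_forward_integral M T J v W g I" "has_classical_integral M F T J v W g I'"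
  then obtain K c where K: "\<And>j. j \<in> J \<Longrightarrow> has_forward_integral M T (integrator j) (coordinate j) (K j)"
    and KI: "tendsto_in_probability M (\<lambda>m \<omega>. \<Sum>j | j \<in> J \<and> j < m. K j T \<omega>) I"
    and c: "\<And>j. j \<in> J \<Longrightarrow> has_ito_integral M F T (integrator j) (coordinate j) (c j)"
    and cI: "L2_tendsto M (\<lambda>m \<omega>. \<Sum>j | j \<in> J \<and> j < m. c j \<omega>) I'"
    unfolding has_russo_vallois_forward_integral_def has_classical_integral_def by blast
  \<comment> \<open>Any forward limit agrees with any version of the Ito integral, so the two given
    witnesses may be unrelated.\<close>
  have Kc: "AE \<omega> in M. K j T \<omega> = c j \<omega>" if "j \<in> J" for j
    by (rule has_ito_integral_unique[OF that has_forward_integralD[OF K[OF that]] c[OF that]])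
  show "AE \<omega> in M. I \<omega> = I' \<omega>"
  proof (rule tendsto_in_probability_unique[OF KI L2_tendsto_imp_tendsto_in_probability[OF cI]])
    fix m
    have "AE \<omega> in M. \<forall>j\<in>{j. j \<in> J \<and> j < m}. K j T \<omega> = c j \<omega>"
      by (rule AE_finite_allI) (use Kc in auto)
    then show "AE \<omega> in M. (\<Sum>j | j \<in> J \<and> j < m. K j T \<omega>) = (\<Sum>j | j \<in> J \<and> j < m. c j \<omega>)"
      by eventually_elim (intro sum.cong refl, blast)
  qed
qed

end

end

theorem proposition3p1:
  fixes M :: "'a measure"
    and Q :: "'v::{real_inner,polish_space} \<Rightarrow> 'v"
    and B :: "real \<Rightarrow> 'v \<Rightarrow> 'a \<Rightarrow> real"
    and \<iota> :: "'v \<Rightarrow> 'w::{real_inner,polish_space}"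
    and W :: "real \<Rightarrow> 'w \<Rightarrow> 'a \<Rightarrow> real"
    and J :: "nat set"
    and v :: "nat \<Rightarrow> 'w"
    and T :: real
    and g :: "real \<Rightarrow> 'a \<Rightarrow> 'w"
  assumes "prob_space M"
    and "bounded_linear Q"
    and "\<And>x y. inner (Q x) y = inner x (Q y)"
    and "\<And>x. inner (Q x) x \<ge> 0"
    and "cylindrical_wiener M Q B"
    and "is_completion_for Q \<iota>"
    and "isometric_extension M B \<iota> W"
    and "orthonormal_basis_on J v"
    and "T > 0"
    and "predictable_L2 M (generated_filtration M B) T g"
  shows "(\<exists>I. has_russo_vallois_forward_integral M T J v W g I) \<and>
    (\<exists>I. has_classical_integral M (generated_filtration M B) T J v W g I) \<and>
    (\<forall>I I'. has_russo_vallois_forward_integral M T J v W g I \<longrightarrow>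
       has_classical_integral M (generated_filtration M B) T J v W g I' \<longrightarrow>
       (AE \<omega> in M. I \<omega> = I' \<omega>))"
proof -
  interpret prob_space M by fact
  interpret completed_wiener M Q B \<iota> W
    by unfold_locales (fact assms(5-7))+
  have orth: "inner (v i) (v j) = (if i = j then 1 else 0)" if "i \<in> J" "j \<in> J" for i j
    using assms(8) that unfolding orthonormal_basis_on_def by blast
  show ?thesis
  proof (rule continuous_modification[of J v, OF orth])
    fix X assume X: "orthonormal_family M (generated_filtration M B) X J" "\<And>j. AE \<omega> in M. \<forall>t. X j t \<omega> = W t (v j) \<omega>"
    show ?thesis by (rule forward_and_classical_integral[OF orth X assms(9,10)])
  qed
qed

end
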